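(* Let $G$ be a finite group and let $(\mathcal B,\mathcal A,\mathsf i,\mathsf e,\mathsf l)$ be a $G$-equivariant cleft extension of abelian categories, with associated functors $\mathsf q\colon\mathcal A\to\mathcal B$, $\mathsf G\colon\mathcal A\to\mathcal A$ and $\mathsf F\colon\mathcal B\to\mathcal B$. Then: (i) The functors $\mathsf l$, $\mathsf q$, $\mathsf G$ and $\mathsf F$ canonically inherit the structure of $G$-functors. (ii) The induced equivariant categories and functors form a cleft extension $(\mathcal B^G,\mathcal A^G,\mathsf i^G,\mathsf e^G,\mathsf l^G)$, with $\mathsf q^G$ left adjoint to $\mathsf i^G$, and the forgetful functors $\mathsf{For}\colon\mathcal B^G\to\mathcal B$ and $\mathsf{For}\colon\mathcal A^G\to\mathcal A$ commute with all the functors involved, i.e. $\mathsf{For}\circ\mathsf H^G=\mathsf H\circ\mathsf{For}$ for each $\mathsf H\in\{\mathsf i,\mathsf e,\mathsf l,\mathsf q,\mathsf G,\mathsf F\}$.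
   Context: Group actions. A (left) action of $G$ on an additive category $\mathcal B$ consists of additive auto-equivalences $\rho_g$ ($g\in G$; write ${}^gX=\rho_g(X)$, ${}^gf=\rho_g(f)$) and natural isomorphisms $\theta_{g,h}\colon\rho_g\rho_h\to\rho_{gh}$ with $\theta_{g,hk}\circ\rho_g\theta_{h,k}=\theta_{gh,k}\circ\theta_{g,h}\rho_k$. It has a unit isomorphism $\upsilon\colon\rho_1\to\mathrm{Id}$, determined by $\rho_1\upsilon=\theta_{1,1}$. $G$-functors. A $G$-functor $(\mathsf H,\sigma)\colon\mathcal B\to\mathcal A$ between categories with $G$-actions $(\rho,\theta,\upsilon)$, $(\bar\rho,\bar\theta,\bar\upsilon)$ is a functor $\mathsf H$ with natural isomorphisms $\sigma_g\colon\mathsf H\rho_g\to\bar\rho_g\mathsf H$ such that $\sigma_{gh}\circ\mathsf H\theta_{g,h}=\bar\theta_{g,h}\mathsf H\circ\bar\rho_g\sigma_h\circ\sigma_g\rho_h$ and $\bar\upsilon\mathsf H\circ\sigma_1=\mathsf H\upsilon$. A natural transformation $\eta\colon\mathsf H\Rightarrow\mathsf H'$ of $G$-functors is $G$-natural if $\sigma'_g\circ\eta\rho_g=\bar\rho_g\eta\circ\sigma_g$ for all $g$. Compositions of $G$-functors are $G$-functors with $\sigma^{\mathsf H\mathsf H'}_g=\sigma^{\mathsf H}_g\mathsf H'\circ\mathsf H\sigma^{\mathsf H'}_g$. Equivariant category. $\mathcal B^G$ has as objects pairs $(X,\chi)$ with $X\in\mathcal B$ and isomorphisms $\chi_g\colon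 X\to{}^gX$ satisfying $\chi_{gh}=\theta_{g,h}\circ{}^g(\chi_h)\circ\chi_g$; morphisms $(X,\chi)\to(Y,\psi)$ are morphisms $f\colon X\to Y$ with $\psi_g f={}^gf\,\chi_g$. It is abelian when $\mathcal B$ is. The forgetful functor is $\mathsf{For}(X,\chi)=X$. A $G$-functor $(\mathsf H,\sigma)$ induces $\mathsf H^G\colon\mathcal B^G\to\mathcal A^G$, $(X,\chi)\mapsto(\mathsf HX,(\sigma_g\circ\mathsf H(\chi_g))_g)$, $f\mapsto\mathsf H(f)$. Cleft extensions. A cleft extension $(\mathcal B,\mathcal A,\mathsf i,\mathsf e,\mathsf l)$ of an abelian category $\mathcal B$ is an abelian category $\mathcal A$ with functors $\mathsf i\colon\mathcal B\to\mathcal A$, $\mathsf e\colon\mathcal A\to\mathcal B$, $\mathsf l\colon\mathcal B\to\mathcal A$ such that $\mathsf e$ is faithful exact, $\mathsf l$ is left adjoint to $\mathsf e$, and $\mathsf e\mathsf i\simeq\mathrm{Id}_{\mathcal B}$ naturally. It is known that $\mathsf i$ then has a left adjoint, denoted $\mathsf q$. With $\varepsilon\colon\mathsf l\mathsf e\to\mathrm{Id}_{\mathcal A}$ the counit, put $\mathsf G=\operatorname{Ker}\varepsilon\colon\mathcal A\to\mathcal A$ and $\mathsf F=\mathsf e\mathsf G\mathsf i\colon\mathcal B\to\mathcal B$. The cleft extension is $G$-equivariant if $G$ acts on $\mathcal A$ and $\mathcal B$, $\mathsf i$ and $\mathsf e$ are $G$-functors, and the isomorphism $\mathsf e\mathsf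 i\simeq\mathrm{Id}_{\mathcal B}$ is $G$-natural. "Canonically" means: for the adjoints $\mathsf l$ and $\mathsf q$, the $G$-functor structures making the units and counits of $(\mathsf l,\mathsf e)$ and $(\mathsf q,\mathsf i)$ $G$-natural; for $\mathsf G$, the structure making the inclusion $\operatorname{Ker}\varepsilon\to\mathsf l\mathsf e$ $G$-natural; for $\mathsf F$, the composite structure. *)

theory Defs
  imports "HOL-Algebra.Group"
begin

section \<open>Categories\<close>

text \<open>Categories are given by carrier sets of objects and arrows inside ambient types, so every
  arrow has one domain and one codomain. All operations are meaningful on the carriers only.\<close>

record ('o, 'm) cat =
  Obj :: "'o set"
  Arr :: "'m set"
  Dom :: "'m \<Rightarrow> 'o"
  Cod :: "'m \<Rightarrow> 'o"
  Ident :: "'o \<Rightarrow> 'm"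
  Comp :: "'m \<Rightarrow> 'm \<Rightarrow> 'm" (infixl "\<cdot>\<index>" 70)

definition Hom :: "('o, 'm, 'z) cat_scheme \<Rightarrow> 'o \<Rightarrow> 'o \<Rightarrow> 'm set" where
  "Hom C X Y = {f \<in> Arr C. Dom C f = X \<and> Cod C f = Y}"

locale category =
  fixes C :: "('o, 'm, 'z) cat_scheme" (structure)
  assumes Dom_in_Obj: "f \<in> Arr C \<Longrightarrow> Dom C f \<in> Obj C"
    and Cod_in_Obj: "f \<in> Arr C \<Longrightarrow> Cod C f \<in> Obj C"
    and Ident_in_Hom: "X \<in> Obj C \<Longrightarrow> Ident C X \<in> Hom C X X"
    and Comp_in_Hom: "\<lbrakk>f \<in> Hom C X Y; g \<in> Hom C Y Z\<rbrakk> \<Longrightarrow> g \<cdot> f \<in> Hom C X Z"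
    and Comp_Ident_left: "f \<in> Hom C X Y \<Longrightarrow> Ident C Y \<cdot> f = f"
    and Comp_Ident_right: "f \<in> Hom C X Y \<Longrightarrow> f \<cdot> Ident C X = f"
    and Comp_assoc: "\<lbrakk>f \<in> Hom C W X; g \<in> Hom C X Y; h \<in> Hom C Y Z\<rbrakk>
      \<Longrightarrow> h \<cdot> (g \<cdot> f) = (h \<cdot> g) \<cdot> f"

definition is_iso :: "('o, 'm, 'z) cat_scheme \<Rightarrow> 'm \<Rightarrow> bool" where
  "is_iso C f \<longleftrightarrow> f \<in> Arr C \<and> (\<exists>g \<in> Hom C (Cod C f) (Dom C f).
     g \<cdot>\<^bsub>C\<^esub> f = Ident C (Dom C f) \<and> f \<cdot>\<^bsub>C\<^esub> g = Ident C (Cod C f))"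

definition is_mono :: "('o, 'm, 'z) cat_scheme \<Rightarrow> 'm \<Rightarrow> bool" where
  "is_mono C f \<longleftrightarrow> f \<in> Arr C \<and> (\<forall>W \<in> Obj C. \<forall>g \<in> Hom C W (Dom C f). \<forall>h \<in> Hom C W (Dom C f).
     f \<cdot>\<^bsub>C\<^esub> g = f \<cdot>\<^bsub>C\<^esub> h \<longrightarrow> g = h)"

definition is_epi :: "('o, 'm, 'z) cat_scheme \<Rightarrow> 'm \<Rightarrow> bool" where
  "is_epi C f \<longleftrightarrow> f \<in> Arr C \<and> (\<forall>W \<in> Obj C. \<forall>g \<in> Hom C (Cod C f) W. \<forall>h \<in> Hom C (Cod C f) W.
     g \<cdot>\<^bsub>C\<^esub> f = h \<cdot>\<^bsub>C\<^esub> f \<longrightarrow> g = h)"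

definition is_zero_object :: "('o, 'm, 'z) cat_scheme \<Rightarrow> 'o \<Rightarrow> bool" where
  "is_zero_object C Z \<longleftrightarrow> Z \<in> Obj C \<and>
     (\<forall>X \<in> Obj C. (\<exists>!f. f \<in> Hom C X Z) \<and> (\<exists>!f. f \<in> Hom C Z X))"


section \<open>Functors and natural transformations\<close>

record ('o1, 'm1, 'o2, 'm2) funct =
  ObjMap :: "'o1 \<Rightarrow> 'o2"
  ArrMap :: "'m1 \<Rightarrow> 'm2"

definition is_functor ::
  "('o1, 'm1, 'z1) cat_scheme \<Rightarrow> ('o2, 'm2, 'z2) cat_scheme \<Rightarrow> ('o1, 'm1, 'o2, 'm2) funct \<Rightarrow> bool"
where
  "is_functor C D F \<longleftrightarrow> category C \<and> category D \<and>
     (\<forall>X \<in> Obj C. ObjMap F X \<in> Obj D) \<and>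
     (\<forall>X \<in> Obj C. \<forall>Y \<in> Obj C. \<forall>f \<in> Hom C X Y. ArrMap F f \<in> Hom D (ObjMap F X) (ObjMap F Y)) \<and>
     (\<forall>X \<in> Obj C. ArrMap F (Ident C X) = Ident D (ObjMap F X)) \<and>
     (\<forall>X \<in> Obj C. \<forall>Y \<in> Obj C. \<forall>Z \<in> Obj C. \<forall>f \<in> Hom C X Y. \<forall>g \<in> Hom C Y Z.
        ArrMap F (g \<cdot>\<^bsub>C\<^esub> f) = ArrMap F g \<cdot>\<^bsub>D\<^esub> ArrMap F f)"

definition id_funct :: "('o, 'm, 'o, 'm) funct" where
  "id_funct = \<lparr>ObjMap = (\<lambda>X. X), ArrMap = (\<lambda>f. f)\<rparr>"

definition comp_funct ::
  "('o2, 'm2, 'o3, 'm3) funct \<Rightarrow> ('o1, 'm1, 'o2, 'm2) funct \<Rightarrow> ('o1, 'm1, 'o3, 'm3) funct"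
  (infixr "\<circ>\<^sub>F" 75)
where
  "F \<circ>\<^sub>F F' = \<lparr>ObjMap = ObjMap F \<circ> ObjMap F', ArrMap = ArrMap F \<circ> ArrMap F'\<rparr>"

text \<open>Equality of functors: HOL equality would also compare junk values off the carriers.\<close>

definition functs_equal ::
  "('o1, 'm1, 'z1) cat_scheme \<Rightarrow> ('o2, 'm2, 'z2) cat_scheme
     \<Rightarrow> ('o1, 'm1, 'o2, 'm2) funct \<Rightarrow> ('o1, 'm1, 'o2, 'm2) funct \<Rightarrow> bool"
where
  "functs_equal C D F F' \<longleftrightarrow> is_functor C D F \<and> is_functor C D F' \<and>
     (\<forall>X \<in> Obj C. ObjMap F X = ObjMap F' X) \<and> (\<forall>f \<in> Arr C. ArrMap F f = ArrMap F' f)"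

definition nat_trans ::
  "('o1, 'm1, 'z1) cat_scheme \<Rightarrow> ('o2, 'm2, 'z2) cat_scheme
     \<Rightarrow> ('o1, 'm1, 'o2, 'm2) funct \<Rightarrow> ('o1, 'm1, 'o2, 'm2) funct \<Rightarrow> ('o1 \<Rightarrow> 'm2) \<Rightarrow> bool"
where
  "nat_trans C D F F' \<eta> \<longleftrightarrow> is_functor C D F \<and> is_functor C D F' \<and>
     (\<forall>X \<in> Obj C. \<eta> X \<in> Hom D (ObjMap F X) (ObjMap F' X)) \<and>
     (\<forall>X \<in> Obj C. \<forall>Y \<in> Obj C. \<forall>f \<in> Hom C X Y.
        \<eta> Y \<cdot>\<^bsub>D\<^esub> ArrMap F f = ArrMap F' f \<cdot>\<^bsub>D\<^esub> \<eta> X)"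

definition nat_iso ::
  "('o1, 'm1, 'z1) cat_scheme \<Rightarrow> ('o2, 'm2, 'z2) cat_scheme
     \<Rightarrow> ('o1, 'm1, 'o2, 'm2) funct \<Rightarrow> ('o1, 'm1, 'o2, 'm2) funct \<Rightarrow> ('o1 \<Rightarrow> 'm2) \<Rightarrow> bool"
where
  "nat_iso C D F F' \<eta> \<longleftrightarrow> nat_trans C D F F' \<eta> \<and> (\<forall>X \<in> Obj C. is_iso D (\<eta> X))"

definition is_equivalence ::
  "('o1, 'm1, 'z1) cat_scheme \<Rightarrow> ('o2, 'm2, 'z2) cat_scheme \<Rightarrow> ('o1, 'm1, 'o2, 'm2) funct \<Rightarrow> bool"
where
  "is_equivalence C D F \<longleftrightarrow> is_functor C D F \<and>
     (\<exists>F' \<alpha> \<beta>. is_functor D C F' \<and>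
        nat_iso C C (F' \<circ>\<^sub>F F) id_funct \<alpha> \<and> nat_iso D D (F \<circ>\<^sub>F F') id_funct \<beta>)"

definition is_faithful ::
  "('o1, 'm1, 'z1) cat_scheme \<Rightarrow> ('o2, 'm2, 'z2) cat_scheme \<Rightarrow> ('o1, 'm1, 'o2, 'm2) funct \<Rightarrow> bool"
where
  "is_faithful C D F \<longleftrightarrow> is_functor C D F \<and>
     (\<forall>X \<in> Obj C. \<forall>Y \<in> Obj C. inj_on (ArrMap F) (Hom C X Y))"

text \<open>\<open>L : C \<rightarrow> D\<close> is left adjoint to \<open>R : D \<rightarrow> C\<close>, with unit \<open>\<eta>\<close> and counit \<open>\<epsilon>\<close>.\<close>

definition adjunction ::
  "('o1, 'm1, 'z1) cat_scheme \<Rightarrow> ('o2, 'm2, 'z2) cat_scheme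
     \<Rightarrow> ('o1, 'm1, 'o2, 'm2) funct \<Rightarrow> ('o2, 'm2, 'o1, 'm1) funct
     \<Rightarrow> ('o1 \<Rightarrow> 'm1) \<Rightarrow> ('o2 \<Rightarrow> 'm2) \<Rightarrow> bool"
where
  "adjunction C D L R \<eta> \<epsilon> \<longleftrightarrow> is_functor C D L \<and> is_functor D C R \<and>
     nat_trans C C id_funct (R \<circ>\<^sub>F L) \<eta> \<and>
     nat_trans D D (L \<circ>\<^sub>F R) id_funct \<epsilon> \<and>
     (\<forall>X \<in> Obj C. \<epsilon> (ObjMap L X) \<cdot>\<^bsub>D\<^esub> ArrMap L (\<eta> X) = Ident D (ObjMap L X)) \<and>
     (\<forall>Y \<in> Obj D. ArrMap R (\<epsilon> Y) \<cdot>\<^bsub>C\<^esub> \<eta> (ObjMap R Y) = Ident C (ObjMap R Y))"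


section \<open>Additive and abelian categories\<close>

record ('o, 'm) addcat = "('o, 'm) cat" +
  Zero :: "'o \<Rightarrow> 'o \<Rightarrow> 'm"
  Add :: "'m \<Rightarrow> 'm \<Rightarrow> 'm"

definition hom_group :: "('o, 'm, 'z) addcat_scheme \<Rightarrow> 'o \<Rightarrow> 'o \<Rightarrow> 'm monoid" where
  "hom_group C X Y = \<lparr>carrier = Hom C X Y, mult = Add C, one = Zero C X Y\<rparr>"

locale preadditive_category = category C
  for C :: "('o, 'm, 'z) addcat_scheme" (structure) +
  assumes hom_group: "\<lbrakk>X \<in> Obj C; Y \<in> Obj C\<rbrakk> \<Longrightarrow> comm_group (hom_group C X Y)"
    and Comp_Add_right: "\<lbrakk>f \<in> Hom C X Y; f' \<in> Hom C X Y; g \<in> Hom C Y Z\<rbrakk>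
      \<Longrightarrow> g \<cdot> Add C f f' = Add C (g \<cdot> f) (g \<cdot> f')"
    and Comp_Add_left: "\<lbrakk>f \<in> Hom C X Y; g \<in> Hom C Y Z; g' \<in> Hom C Y Z\<rbrakk>
      \<Longrightarrow> Add C g g' \<cdot> f = Add C (g \<cdot> f) (g' \<cdot> f)"

definition is_biproduct ::
  "('o, 'm, 'z) addcat_scheme \<Rightarrow> 'o \<Rightarrow> 'o \<Rightarrow> 'o \<Rightarrow> 'm \<Rightarrow> 'm \<Rightarrow> 'm \<Rightarrow> 'm \<Rightarrow> bool"
where
  "is_biproduct C X Y P j1 j2 p1 p2 \<longleftrightarrow> P \<in> Obj C \<and>
     j1 \<in> Hom C X P \<and> j2 \<in> Hom C Y P \<and> p1 \<in> Hom C P X \<and> p2 \<in> Hom C P Y \<and>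
     p1 \<cdot>\<^bsub>C\<^esub> j1 = Ident C X \<and> p2 \<cdot>\<^bsub>C\<^esub> j2 = Ident C Y \<and>
     p1 \<cdot>\<^bsub>C\<^esub> j2 = Zero C Y X \<and> p2 \<cdot>\<^bsub>C\<^esub> j1 = Zero C X Y \<and>
     Add C (j1 \<cdot>\<^bsub>C\<^esub> p1) (j2 \<cdot>\<^bsub>C\<^esub> p2) = Ident C P"

locale additive_category = preadditive_category +
  assumes ex_zero_object: "\<exists>Z. is_zero_object C Z"
    and ex_biproduct: "\<lbrakk>X \<in> Obj C; Y \<in> Obj C\<rbrakk>
      \<Longrightarrow> \<exists>P j1 j2 p1 p2. is_biproduct C X Y P j1 j2 p1 p2"

text \<open>\<open>is_kernel C f k\<close>: the arrow \<open>k\<close> is a kernel of \<open>f\<close>; dually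
  \<open>is_cokernel C f c\<close>: the arrow \<open>c\<close> is a cokernel of \<open>f\<close>.\<close>

definition is_kernel :: "('o, 'm, 'z) addcat_scheme \<Rightarrow> 'm \<Rightarrow> 'm \<Rightarrow> bool" where
  "is_kernel C f k \<longleftrightarrow> f \<in> Arr C \<and> k \<in> Arr C \<and> Cod C k = Dom C f \<and>
     f \<cdot>\<^bsub>C\<^esub> k = Zero C (Dom C k) (Cod C f) \<and>
     (\<forall>W \<in> Obj C. \<forall>h \<in> Hom C W (Dom C f). f \<cdot>\<^bsub>C\<^esub> h = Zero C W (Cod C f) \<longrightarrow>
        (\<exists>!u. u \<in> Hom C W (Dom C k) \<and> k \<cdot>\<^bsub>C\<^esub> u = h))"

definition is_cokernel :: "('o, 'm, 'z) addcat_scheme \<Rightarrow> 'm \<Rightarrow> 'm \<Rightarrow> bool" where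
  "is_cokernel C f c \<longleftrightarrow> f \<in> Arr C \<and> c \<in> Arr C \<and> Dom C c = Cod C f \<and>
     c \<cdot>\<^bsub>C\<^esub> f = Zero C (Dom C f) (Cod C c) \<and>
     (\<forall>W \<in> Obj C. \<forall>h \<in> Hom C (Cod C f) W. h \<cdot>\<^bsub>C\<^esub> f = Zero C (Dom C f) W \<longrightarrow>
        (\<exists>!u. u \<in> Hom C (Cod C c) W \<and> u \<cdot>\<^bsub>C\<^esub> c = h))"

locale abelian_category = additive_category +
  assumes ex_kernel: "f \<in> Arr C \<Longrightarrow> \<exists>k. is_kernel C f k"
    and ex_cokernel: "f \<in> Arr C \<Longrightarrow> \<exists>c. is_cokernel C f c"
    and mono_is_kernel: "is_mono C m \<Longrightarrow> \<exists>f. is_kernel C f m"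
    and epi_is_cokernel: "is_epi C p \<Longrightarrow> \<exists>f. is_cokernel C f p"

definition is_additive_functor ::
  "('o1, 'm1, 'z1) addcat_scheme \<Rightarrow> ('o2, 'm2, 'z2) addcat_scheme
     \<Rightarrow> ('o1, 'm1, 'o2, 'm2) funct \<Rightarrow> bool"
where
  "is_additive_functor C D F \<longleftrightarrow> is_functor C D F \<and>
     (\<forall>X \<in> Obj C. \<forall>Y \<in> Obj C. \<forall>f \<in> Hom C X Y. \<forall>f' \<in> Hom C X Y.
        ArrMap F (Add C f f') = Add D (ArrMap F f) (ArrMap F f'))"

definition short_exact :: "('o, 'm, 'z) addcat_scheme \<Rightarrow> 'm \<Rightarrow> 'm \<Rightarrow> bool" where
  "short_exact C f g \<longleftrightarrow> is_kernel C g f \<and> is_cokernel C f g"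

definition is_exact_functor ::
  "('o1, 'm1, 'z1) addcat_scheme \<Rightarrow> ('o2, 'm2, 'z2) addcat_scheme
     \<Rightarrow> ('o1, 'm1, 'o2, 'm2) funct \<Rightarrow> bool"
where
  "is_exact_functor C D F \<longleftrightarrow> is_additive_functor C D F \<and>
     (\<forall>f g. short_exact C f g \<longrightarrow> short_exact D (ArrMap F f) (ArrMap F g))"


section \<open>Group actions and $G$-functors\<close>

record ('g, 'o, 'm) action =
  Act :: "'g \<Rightarrow> ('o, 'm, 'o, 'm) funct"
  Coh :: "'g \<Rightarrow> 'g \<Rightarrow> 'o \<Rightarrow> 'm"

definition is_action ::
  "('g, 'y) monoid_scheme \<Rightarrow> ('o, 'm, 'z) addcat_scheme \<Rightarrow> ('g, 'o, 'm) action \<Rightarrow> bool"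
where
  "is_action G C T \<longleftrightarrow> additive_category C \<and>
     (\<forall>g \<in> carrier G. is_additive_functor C C (Act T g) \<and> is_equivalence C C (Act T g)) \<and>
     (\<forall>g \<in> carrier G. \<forall>h \<in> carrier G.
        nat_iso C C (Act T g \<circ>\<^sub>F Act T h) (Act T (g \<otimes>\<^bsub>G\<^esub> h)) (Coh T g h)) \<and>
     (\<forall>g \<in> carrier G. \<forall>h \<in> carrier G. \<forall>k \<in> carrier G. \<forall>X \<in> Obj C.
        Coh T g (h \<otimes>\<^bsub>G\<^esub> k) X \<cdot>\<^bsub>C\<^esub> ArrMap (Act T g) (Coh T h k X)
        = Coh T (g \<otimes>\<^bsub>G\<^esub> h) k X \<cdot>\<^bsub>C\<^esub> Coh T g h (ObjMap (Act T k) X))"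

text \<open>The unit isomorphism \<open>\<upsilon> : \<rho>\<^sub>1 \<rightarrow> Id\<close> of an action; for an action the description determines
  \<open>\<upsilon>\<close> because \<open>\<rho>\<^sub>1\<close> is fully faithful.\<close>

definition action_unit ::
  "('g, 'y) monoid_scheme \<Rightarrow> ('o, 'm, 'z) addcat_scheme \<Rightarrow> ('g, 'o, 'm) action \<Rightarrow> 'o \<Rightarrow> 'm"
where
  "action_unit G C T X =
     (THE u. u \<in> Hom C (ObjMap (Act T \<one>\<^bsub>G\<^esub>) X) X \<and>
        ArrMap (Act T \<one>\<^bsub>G\<^esub>) u = Coh T \<one>\<^bsub>G\<^esub> \<one>\<^bsub>G\<^esub> X)"

text \<open>A $G$-functor is a pair \<open>(H, \<sigma>)\<close>.\<close>

type_synonym ('g, 'o1, 'm1, 'o2, 'm2) gfunct =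
  "('o1, 'm1, 'o2, 'm2) funct \<times> ('g \<Rightarrow> 'o1 \<Rightarrow> 'm2)"

definition is_gfunctor ::
  "('g, 'y) monoid_scheme \<Rightarrow> ('o1, 'm1, 'z1) addcat_scheme \<Rightarrow> ('o2, 'm2, 'z2) addcat_scheme
     \<Rightarrow> ('g, 'o1, 'm1) action \<Rightarrow> ('g, 'o2, 'm2) action
     \<Rightarrow> ('g, 'o1, 'm1, 'o2, 'm2) gfunct \<Rightarrow> bool"
where
  "is_gfunctor G C D T U = (\<lambda>(H, \<sigma>).
     is_action G C T \<and> is_action G D U \<and> is_functor C D H \<and>
     (\<forall>g \<in> carrier G. nat_iso C D (H \<circ>\<^sub>F Act T g) (Act U g \<circ>\<^sub>F H) (\<sigma> g)) \<and>
     (\<forall>g \<in> carrier G. \<forall>h \<in> carrier G. \<forall>X \<in> Obj C.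
        \<sigma> (g \<otimes>\<^bsub>G\<^esub> h) X \<cdot>\<^bsub>D\<^esub> ArrMap H (Coh T g h X)
        = Coh U g h (ObjMap H X) \<cdot>\<^bsub>D\<^esub> (ArrMap (Act U g) (\<sigma> h X) \<cdot>\<^bsub>D\<^esub> \<sigma> g (ObjMap (Act T h) X))) \<and>
     (\<forall>X \<in> Obj C.
        action_unit G D U (ObjMap H X) \<cdot>\<^bsub>D\<^esub> \<sigma> \<one>\<^bsub>G\<^esub> X = ArrMap H (action_unit G C T X)))"

definition id_gfunct ::
  "('o, 'm, 'z) addcat_scheme \<Rightarrow> ('g, 'o, 'm) action \<Rightarrow> ('g, 'o, 'm, 'o, 'm) gfunct"
where
  "id_gfunct C T = (id_funct, \<lambda>g X. Ident C (ObjMap (Act T g) X))"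

text \<open>\<open>E\<close> is the target category of the composite.\<close>

definition comp_gfunct ::
  "('o3, 'm3, 'z) addcat_scheme \<Rightarrow> ('g, 'o2, 'm2, 'o3, 'm3) gfunct
     \<Rightarrow> ('g, 'o1, 'm1, 'o2, 'm2) gfunct \<Rightarrow> ('g, 'o1, 'm1, 'o3, 'm3) gfunct"
where
  "comp_gfunct E = (\<lambda>(H, \<sigma>) (H', \<sigma>').
     (H \<circ>\<^sub>F H', \<lambda>g X. \<sigma> g (ObjMap H' X) \<cdot>\<^bsub>E\<^esub> ArrMap H (\<sigma>' g X)))"

definition is_gnatural ::
  "('g, 'y) monoid_scheme \<Rightarrow> ('o1, 'm1, 'z1) addcat_scheme \<Rightarrow> ('o2, 'm2, 'z2) addcat_scheme
     \<Rightarrow> ('g, 'o1, 'm1) action \<Rightarrow> ('g, 'o2, 'm2) action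
     \<Rightarrow> ('g, 'o1, 'm1, 'o2, 'm2) gfunct \<Rightarrow> ('g, 'o1, 'm1, 'o2, 'm2) gfunct
     \<Rightarrow> ('o1 \<Rightarrow> 'm2) \<Rightarrow> bool"
where
  "is_gnatural G C D T U = (\<lambda>(H, \<sigma>) (H', \<sigma>') \<eta>.
     is_gfunctor G C D T U (H, \<sigma>) \<and> is_gfunctor G C D T U (H', \<sigma>') \<and> nat_trans C D H H' \<eta> \<and>
     (\<forall>g \<in> carrier G. \<forall>X \<in> Obj C.
        \<sigma>' g X \<cdot>\<^bsub>D\<^esub> \<eta> (ObjMap (Act T g) X) = ArrMap (Act U g) (\<eta> X) \<cdot>\<^bsub>D\<^esub> \<sigma> g X))"


section \<open>Equivariant categories\<close>

text \<open>The family \<open>\<chi>\<close> is indexed by the carrier of \<open>G\<close>; making it extensional ensures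
  that equal families are equal as HOL functions. An arrow of the equivariant category is
  tagged with its domain and codomain, since the same arrow of \<open>C\<close> can be equivariant for several
  choices of equivariant structures.\<close>

type_synonym ('g, 'o, 'm) eqv_obj = "'o \<times> ('g \<Rightarrow> 'm)"
type_synonym ('g, 'o, 'm) eqv_arr =
  "('g, 'o, 'm) eqv_obj \<times> ('g, 'o, 'm) eqv_obj \<times> 'm"

definition eqv_objects ::
  "('g, 'y) monoid_scheme \<Rightarrow> ('o, 'm, 'z) addcat_scheme \<Rightarrow> ('g, 'o, 'm) action
     \<Rightarrow> ('g, 'o, 'm) eqv_obj set"
where
  "eqv_objects G C T = {(X, \<chi>). X \<in> Obj C \<and> \<chi> \<in> extensional (carrier G) \<and>
     (\<forall>g \<in> carrier G. \<chi> g \<in> Hom C X (ObjMap (Act T g) X) \<and> is_iso C (\<chi> g)) \<and>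
     (\<forall>g \<in> carrier G. \<forall>h \<in> carrier G.
        \<chi> (g \<otimes>\<^bsub>G\<^esub> h) = Coh T g h X \<cdot>\<^bsub>C\<^esub> (ArrMap (Act T g) (\<chi> h) \<cdot>\<^bsub>C\<^esub> \<chi> g))}"

definition eqv_arrows ::
  "('g, 'y) monoid_scheme \<Rightarrow> ('o, 'm, 'z) addcat_scheme \<Rightarrow> ('g, 'o, 'm) action
     \<Rightarrow> ('g, 'o, 'm) eqv_arr set"
where
  "eqv_arrows G C T = {((X, \<chi>), (Y, \<psi>), f).
     (X, \<chi>) \<in> eqv_objects G C T \<and> (Y, \<psi>) \<in> eqv_objects G C T \<and> f \<in> Hom C X Y \<and>
     (\<forall>g \<in> carrier G. \<psi> g \<cdot>\<^bsub>C\<^esub> f = ArrMap (Act T g) f \<cdot>\<^bsub>C\<^esub> \<chi> g)}"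

definition eqv_cat ::
  "('g, 'y) monoid_scheme \<Rightarrow> ('o, 'm, 'z) addcat_scheme \<Rightarrow> ('g, 'o, 'm) action
     \<Rightarrow> (('g, 'o, 'm) eqv_obj, ('g, 'o, 'm) eqv_arr) addcat"
where
  "eqv_cat G C T =
     \<lparr>Obj = eqv_objects G C T,
      Arr = eqv_arrows G C T,
      Dom = (\<lambda>(P, Q, f). P),
      Cod = (\<lambda>(P, Q, f). Q),
      Ident = (\<lambda>P. (P, P, Ident C (fst P))),
      Comp = (\<lambda>(Q', R, g) (P, Q, f). (P, R, g \<cdot>\<^bsub>C\<^esub> f)),
      Zero = (\<lambda>P Q. (P, Q, Zero C (fst P) (fst Q))),
      Add = (\<lambda>(P, Q, f) (P', Q', f'). (P, Q, Add C f f'))\<rparr>"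

definition forget :: "(('g, 'o, 'm) eqv_obj, ('g, 'o, 'm) eqv_arr, 'o, 'm) funct" where
  "forget = \<lparr>ObjMap = (\<lambda>(X, \<chi>). X), ArrMap = (\<lambda>(P, Q, f). f)\<rparr>"

definition eqv_ObjMap ::
  "('g, 'y) monoid_scheme \<Rightarrow> ('o2, 'm2, 'z) addcat_scheme \<Rightarrow> ('g, 'o1, 'm1, 'o2, 'm2) gfunct
     \<Rightarrow> ('g, 'o1, 'm1) eqv_obj \<Rightarrow> ('g, 'o2, 'm2) eqv_obj"
where
  "eqv_ObjMap G D = (\<lambda>(H, \<sigma>) (X, \<chi>).
     (ObjMap H X, \<lambda>g \<in> carrier G. \<sigma> g X \<cdot>\<^bsub>D\<^esub> ArrMap H (\<chi> g)))"

text \<open>The functor \<open>H\<^sup>G\<close> induced by \<open>(H, \<sigma>)\<close>; \<open>D\<close> is the target category of \<open>H\<close>.\<close>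

definition eqv_funct ::
  "('g, 'y) monoid_scheme \<Rightarrow> ('o2, 'm2, 'z) addcat_scheme \<Rightarrow> ('g, 'o1, 'm1, 'o2, 'm2) gfunct
     \<Rightarrow> (('g, 'o1, 'm1) eqv_obj, ('g, 'o1, 'm1) eqv_arr,
         ('g, 'o2, 'm2) eqv_obj, ('g, 'o2, 'm2) eqv_arr) funct"
where
  "eqv_funct G D H =
     \<lparr>ObjMap = eqv_ObjMap G D H,
      ArrMap = (\<lambda>(P, Q, f). (eqv_ObjMap G D H P, eqv_ObjMap G D H Q, ArrMap (fst H) f))\<rparr>"

text \<open>The transformation between two functors \<open>F, F'\<close> of equivariant categories whose component
  at \<open>(X, \<chi>)\<close> is \<open>\<eta> X\<close>.\<close>

definition eqv_trans ::
  "(('g, 'o1, 'm1) eqv_obj, ('g, 'o1, 'm1) eqv_arr,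
    ('g, 'o2, 'm2) eqv_obj, ('g, 'o2, 'm2) eqv_arr) funct
   \<Rightarrow> (('g, 'o1, 'm1) eqv_obj, ('g, 'o1, 'm1) eqv_arr,
       ('g, 'o2, 'm2) eqv_obj, ('g, 'o2, 'm2) eqv_arr) funct
   \<Rightarrow> ('o1 \<Rightarrow> 'm2) \<Rightarrow> ('g, 'o1, 'm1) eqv_obj \<Rightarrow> ('g, 'o2, 'm2) eqv_arr"
where
  "eqv_trans F F' \<eta> = (\<lambda>P. (ObjMap F P, ObjMap F' P, \<eta> (fst P)))"


section \<open>Cleft extensions\<close>

text \<open>The unit \<open>\<eta>\<close> and counit \<open>\<epsilon>\<close> of the adjunction \<open>(l, e)\<close> and the isomorphism
  \<open>\<kappa> : e i \<rightarrow> Id\<close> are part of the data.\<close>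

definition cleft_extension ::
  "('bo, 'bm, 'y) addcat_scheme \<Rightarrow> ('ao, 'am, 'z) addcat_scheme
     \<Rightarrow> ('bo, 'bm, 'ao, 'am) funct \<Rightarrow> ('ao, 'am, 'bo, 'bm) funct \<Rightarrow> ('bo, 'bm, 'ao, 'am) funct
     \<Rightarrow> ('bo \<Rightarrow> 'bm) \<Rightarrow> ('ao \<Rightarrow> 'am) \<Rightarrow> ('bo \<Rightarrow> 'bm) \<Rightarrow> bool"
where
  "cleft_extension B A i e l \<eta> \<epsilon> \<kappa> \<longleftrightarrow> abelian_category B \<and> abelian_category A \<and>
     is_functor B A i \<and> is_functor A B e \<and> is_functor B A l \<and>
     is_faithful A B e \<and> is_exact_functor A B e \<and>
     adjunction B A l e \<eta> \<epsilon> \<and>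
     nat_iso B B (e \<circ>\<^sub>F i) id_funct \<kappa>"

definition equivariant_cleft_extension ::
  "('g, 'x) monoid_scheme \<Rightarrow> ('bo, 'bm, 'y) addcat_scheme \<Rightarrow> ('ao, 'am, 'z) addcat_scheme
     \<Rightarrow> ('g, 'bo, 'bm) action \<Rightarrow> ('g, 'ao, 'am) action
     \<Rightarrow> ('g, 'bo, 'bm, 'ao, 'am) gfunct \<Rightarrow> ('g, 'ao, 'am, 'bo, 'bm) gfunct
     \<Rightarrow> ('bo, 'bm, 'ao, 'am) funct
     \<Rightarrow> ('bo \<Rightarrow> 'bm) \<Rightarrow> ('ao \<Rightarrow> 'am) \<Rightarrow> ('bo \<Rightarrow> 'bm) \<Rightarrow> bool"
where
  "equivariant_cleft_extension G B A T U i e l \<eta> \<epsilon> \<kappa> \<longleftrightarrow>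
     cleft_extension B A (fst i) (fst e) l \<eta> \<epsilon> \<kappa> \<and>
     is_action G B T \<and> is_action G A U \<and>
     is_gfunctor G B A T U i \<and> is_gfunctor G A B U T e \<and>
     is_gnatural G B B T T (comp_gfunct B e i) (id_gfunct B T) \<kappa>"

text \<open>\<open>K\<close> is the functor \<open>Ker \<epsilon>\<close> for a natural transformation \<open>\<epsilon> : F \<rightarrow> F'\<close>, with inclusion
  \<open>\<iota> : K \<rightarrow> F\<close>. Kernels are only determined up to isomorphism, so this is a relation.\<close>

definition is_kernel_functor ::
  "('o1, 'm1, 'z1) cat_scheme \<Rightarrow> ('o2, 'm2, 'z2) addcat_scheme
     \<Rightarrow> ('o1, 'm1, 'o2, 'm2) funct \<Rightarrow> ('o1, 'm1, 'o2, 'm2) funct \<Rightarrow> ('o1 \<Rightarrow> 'm2)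
     \<Rightarrow> ('o1, 'm1, 'o2, 'm2) funct \<Rightarrow> ('o1 \<Rightarrow> 'm2) \<Rightarrow> bool"
where
  "is_kernel_functor C D F F' \<epsilon> K \<iota> \<longleftrightarrow> nat_trans C D F F' \<epsilon> \<and> nat_trans C D K F \<iota> \<and>
     (\<forall>X \<in> Obj C. is_kernel D (\<epsilon> X) (\<iota> X))"


section \<open>Canonical structures of $G$-functors\<close>

text \<open>\<open>\<sigma>\<close> is a $G$-functor structure on the left adjoint \<open>L : C \<rightarrow> D\<close> of a $G$-functor
  \<open>R : D \<rightarrow> C\<close> for which unit and counit are $G$-natural.\<close>

definition left_adjoint_structure ::
  "('g, 'y) monoid_scheme \<Rightarrow> ('o1, 'm1, 'z1) addcat_scheme \<Rightarrow> ('o2, 'm2, 'z2) addcat_scheme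
     \<Rightarrow> ('g, 'o1, 'm1) action \<Rightarrow> ('g, 'o2, 'm2) action
     \<Rightarrow> ('o1, 'm1, 'o2, 'm2) funct \<Rightarrow> ('g, 'o2, 'm2, 'o1, 'm1) gfunct
     \<Rightarrow> ('o1 \<Rightarrow> 'm1) \<Rightarrow> ('o2 \<Rightarrow> 'm2) \<Rightarrow> ('g \<Rightarrow> 'o1 \<Rightarrow> 'm2) \<Rightarrow> bool"
where
  "left_adjoint_structure G C D T U L R \<eta> \<epsilon> \<sigma> \<longleftrightarrow>
     is_gfunctor G C D T U (L, \<sigma>) \<and>
     is_gnatural G C C T T (id_gfunct C T) (comp_gfunct C R (L, \<sigma>)) \<eta> \<and>
     is_gnatural G D D U U (comp_gfunct D (L, \<sigma>) R) (id_gfunct D U) \<epsilon>"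

text \<open>\<open>\<sigma>\<close> is a $G$-functor structure on a subfunctor \<open>K\<close> of a $G$-functor \<open>F\<close> for which the
  inclusion \<open>\<iota> : K \<rightarrow> F\<close> is $G$-natural.\<close>

definition subfunctor_structure ::
  "('g, 'y) monoid_scheme \<Rightarrow> ('o1, 'm1, 'z1) addcat_scheme \<Rightarrow> ('o2, 'm2, 'z2) addcat_scheme
     \<Rightarrow> ('g, 'o1, 'm1) action \<Rightarrow> ('g, 'o2, 'm2) action
     \<Rightarrow> ('o1, 'm1, 'o2, 'm2) funct \<Rightarrow> ('g, 'o1, 'm1, 'o2, 'm2) gfunct
     \<Rightarrow> ('o1 \<Rightarrow> 'm2) \<Rightarrow> ('g \<Rightarrow> 'o1 \<Rightarrow> 'm2) \<Rightarrow> bool"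
where
  "subfunctor_structure G C D T U K F \<iota> \<sigma> \<longleftrightarrow>
     is_gfunctor G C D T U (K, \<sigma>) \<and> is_gnatural G C D T U (K, \<sigma>) F \<iota>"

text \<open>\<open>\<sigma>\<close> is the only structure satisfying \<open>S\<close>, up to junk values off the carriers.\<close>

definition the_structure ::
  "('g, 'y) monoid_scheme \<Rightarrow> ('o1, 'm1, 'z1) cat_scheme
     \<Rightarrow> (('g \<Rightarrow> 'o1 \<Rightarrow> 'm2) \<Rightarrow> bool) \<Rightarrow> ('g \<Rightarrow> 'o1 \<Rightarrow> 'm2) \<Rightarrow> bool"
where
  "the_structure G C S \<sigma> \<longleftrightarrow> S \<sigma> \<and>
     (\<forall>\<sigma>'. S \<sigma>' \<longrightarrow> (\<forall>g \<in> carrier G. \<forall>X \<in> Obj C. \<sigma>' g X = \<sigma> g X))"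

text \<open>\<open>For \<circ> H\<^sup>G = H \<circ> For\<close> for a $G$-functor \<open>H : C \<rightarrow> D\<close>.\<close>

definition commutes_with_forget ::
  "('g, 'y) monoid_scheme \<Rightarrow> ('o1, 'm1, 'z1) addcat_scheme \<Rightarrow> ('o2, 'm2, 'z2) addcat_scheme
     \<Rightarrow> ('g, 'o1, 'm1) action \<Rightarrow> ('g, 'o2, 'm2) action
     \<Rightarrow> ('g, 'o1, 'm1, 'o2, 'm2) gfunct \<Rightarrow> bool"
where
  "commutes_with_forget G C D T U H \<longleftrightarrow>
     is_functor (eqv_cat G C T) (eqv_cat G D U) (eqv_funct G D H) \<and>
     functs_equal (eqv_cat G C T) D (forget \<circ>\<^sub>F eqv_funct G D H) (fst H \<circ>\<^sub>F forget)"

end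

theory Submission
  imports Defs
begin

text \<open>
  Everything is checked after applying a faithful operation. An arrow out of \<open>L X\<close> is determined by
  its transpose, so $G$-naturality of the unit forces the structure \<open>L \<rho>\<^sub>g X \<rightarrow> \<rho>\<^sub>g L X\<close> of a left
  adjoint, and all its axioms reduce to those of the right adjoint. Likewise \<open>\<rho>\<^sub>g\<close>, being an additive
  equivalence, preserves kernels, so the structure of \<open>Ker \<epsilon>\<close> is forced by its universal property.
  Kernels, cokernels, biproducts and the zero object of the equivariant category are those of the
  underlying category with the unique compatible equivariant structure. Hence the forgetful functor
  preserves and reflects kernels and cokernels, from which abelianness and the exactness of the
  induced functor follow; units and counits lift because they are $G$-natural.
\<close>

section \<open>Categories and functors\<close>

text \<open>The delicate direction leads from the equivariant category down to the underlying one. A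
  mono above cancels only against arrows from equivariant objects, so its underlying arrow is not
  visibly mono, and a kernel above is characterised by equivariant test arrows only. Both points are
  settled by comparison. A kernel computed below carries a compatible equivariant structure and is
  then a kernel above; any other kernel above differs from it by an isomorphism; a mono above has a
  zero kernel above, hence a zero kernel below. The second obstacle is invertibility: the
  definitions demand it of cocycles and of the components of a G-functor, while universal properties
  produce bare arrows. Inverses in the group supply it. The identities for a group element and its
  inverse, in both orders, give one-sided inverses as soon as the component at the unit of the group
  is invertible, and that is the content of the unit condition.\<close>

context category
begin

lemma Dom_Cod_Obj [simp]: "f \<in> Arr C \<Longrightarrow> Dom C f \<in> Obj C" "f \<in> Arr C \<Longrightarrow> Cod C f \<in> Obj C"
  by (simp_all add: Dom_in_Obj Cod_in_Obj)

lemma Ident_simps [simp]: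
  "X \<in> Obj C \<Longrightarrow> Ident C X \<in> Arr C"
  "X \<in> Obj C \<Longrightarrow> Dom C (Ident C X) = X"
  "X \<in> Obj C \<Longrightarrow> Cod C (Ident C X) = X"
  using Ident_in_Hom by (auto simp: Hom_def)

text \<open>Typing by \<open>Hom\<close> is traded for equations on \<open>Dom\<close> and
  \<open>Cod\<close>, which propagate through nested composites.\<close>

lemma Comp_simps [simp]:
  assumes "f \<in> Arr C" "g \<in> Arr C" "Dom C g = Cod C f"
  shows "g \<cdot> f \<in> Arr C" "Dom C (g \<cdot> f) = Dom C f" "Cod C (g \<cdot> f) = Cod C g"
  using Comp_in_Hom[of f "Dom C f" "Cod C f" g "Cod C g"] assms by (auto simp: Hom_def)

lemma Comp_Ident [simp]:
  "f \<in> Arr C \<Longrightarrow> Cod C f = Y \<Longrightarrow> Ident C Y \<cdot> f = f"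
  "f \<in> Arr C \<Longrightarrow> Dom C f = X \<Longrightarrow> f \<cdot> Ident C X = f"
  using Comp_Ident_left Comp_Ident_right by (auto simp: Hom_def)

lemma Comp_assoc' [simp]:
  assumes "f \<in> Arr C" "g \<in> Arr C" "h \<in> Arr C" "Dom C g = Cod C f" "Dom C h = Cod C g"
  shows "(h \<cdot> g) \<cdot> f = h \<cdot> (g \<cdot> f)"
  using Comp_assoc[of f "Dom C f" "Cod C f" g "Cod C g" h "Cod C h"] assms by (auto simp: Hom_def)

text \<open>Composites are kept bracketed to the right, so an equation \<open>g f = k h\<close> has to be applied to
  the head of a longer composite.\<close>

lemma Comp_reassoc:
  assumes "g \<cdot> f = k \<cdot> h" "f \<in> Arr C" "g \<in> Arr C" "Dom C g = Cod C f"
    and "h \<in> Arr C" "k \<in> Arr C" "Dom C k = Cod C h"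
    and "x \<in> Arr C" "Cod C x = Dom C f"
  shows "g \<cdot> (f \<cdot> x) = k \<cdot> (h \<cdot> x)"
proof -
  \<comment> \<open>Equal composites have equal domains, so this need not be assumed.\<close>
  have "Dom C h = Dom C f"
    using assms by (metis Comp_simps(2))
  then show ?thesis
    using assms by (metis Comp_assoc')
qed

lemma isoI:
  assumes "f \<in> Arr C" "g \<in> Arr C" "Dom C g = Cod C f" "Cod C g = Dom C f"
    "g \<cdot> f = Ident C (Dom C f)" "f \<cdot> g = Ident C (Cod C f)"
  shows "is_iso C f"
  using assms by (auto simp: is_iso_def Hom_def)

lemma isoE:
  assumes "is_iso C f"
  obtains g where "f \<in> Arr C" "g \<in> Arr C" "Dom C g = Cod C f" "Cod C g = Dom C f"
    "g \<cdot> f = Ident C (Dom C f)" "f \<cdot> g = Ident C (Cod C f)" "is_iso C g"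
proof -
  obtain g where g: "f \<in> Arr C" "g \<in> Arr C" "Dom C g = Cod C f" "Cod C g = Dom C f"
    "g \<cdot> f = Ident C (Dom C f)" "f \<cdot> g = Ident C (Cod C f)"
    using assms by (auto simp: is_iso_def Hom_def)
  then show thesis
    using that isoI[of g f] by auto
qed

lemma monoI:
  assumes "f \<in> Arr C"
    and "\<And>g h. \<lbrakk>g \<in> Arr C; h \<in> Arr C; Cod C g = Dom C f; Cod C h = Dom C f; Dom C g = Dom C h;
      f \<cdot> g = f \<cdot> h\<rbrakk> \<Longrightarrow> g = h"
  shows "is_mono C f"
  using assms by (auto simp: is_mono_def Hom_def)

lemma mono_cancel:
  assumes "is_mono C f" "f \<cdot> g = f \<cdot> h" "g \<in> Arr C" "h \<in> Arr C"
    "Cod C g = Dom C f" "Cod C h = Dom C f" "Dom C g = Dom C h"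
  shows "g = h"
  using assms unfolding is_mono_def Hom_def by (metis (mono_tags, lifting) mem_Collect_eq Dom_in_Obj)

lemma mono_Arr: "is_mono C f \<Longrightarrow> f \<in> Arr C"
  by (simp add: is_mono_def)

lemma epiI:
  assumes "f \<in> Arr C"
    and "\<And>g h. \<lbrakk>g \<in> Arr C; h \<in> Arr C; Dom C g = Cod C f; Dom C h = Cod C f; Cod C g = Cod C h;
      g \<cdot> f = h \<cdot> f\<rbrakk> \<Longrightarrow> g = h"
  shows "is_epi C f"
  using assms by (auto simp: is_epi_def Hom_def)

lemma epi_cancel:
  assumes "is_epi C f" "g \<cdot> f = h \<cdot> f" "g \<in> Arr C" "h \<in> Arr C"
    "Dom C g = Cod C f" "Dom C h = Cod C f" "Cod C g = Cod C h"
  shows "g = h"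
  using assms unfolding is_epi_def Hom_def by (metis (mono_tags, lifting) mem_Collect_eq Cod_in_Obj)

lemma epi_Arr: "is_epi C f \<Longrightarrow> f \<in> Arr C"
  by (simp add: is_epi_def)

lemma split_mono:
  assumes "f \<in> Arr C" "g \<in> Arr C" "Dom C g = Cod C f" "g \<cdot> f = Ident C (Dom C f)"
  shows "is_mono C f"
proof (rule monoI)
  fix a b
  assume ab: "a \<in> Arr C" "b \<in> Arr C" "Cod C a = Dom C f" "Cod C b = Dom C f" "f \<cdot> a = f \<cdot> b"
  have "(g \<cdot> f) \<cdot> a = (g \<cdot> f) \<cdot> b"
    using assms(1-3) ab by simp
  then show "a = b"
    using assms ab by simp
qed (use assms in simp)

lemma split_epi:
  assumes "f \<in> Arr C" "g \<in> Arr C" "Cod C g = Dom C f" "f \<cdot> g = Ident C (Cod C f)"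
  shows "is_epi C f"
proof (rule epiI)
  fix a b
  assume ab: "a \<in> Arr C" "b \<in> Arr C" "Dom C a = Cod C f" "Dom C b = Cod C f" "a \<cdot> f = b \<cdot> f"
  have "a \<cdot> (f \<cdot> g) = b \<cdot> (f \<cdot> g)"
    using assms(1-3) ab Comp_assoc' by metis
  then show "a = b"
    using assms ab by simp
qed (use assms in simp)

lemma iso_mono: "is_iso C f \<Longrightarrow> is_mono C f"
  by (metis isoE split_mono)

lemma iso_epi: "is_iso C f \<Longrightarrow> is_epi C f"
  by (metis isoE split_epi)

lemma iso_Ident: "X \<in> Obj C \<Longrightarrow> is_iso C (Ident C X)"
  by (rule isoI[where g = "Ident C X"]) auto

lemma iso_Comp:
  assumes "is_iso C f" "is_iso C g" "Dom C g = Cod C f"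
  shows "is_iso C (g \<cdot> f)"
proof -
  obtain f' where f': "f \<in> Arr C" "f' \<in> Arr C" "Dom C f' = Cod C f" "Cod C f' = Dom C f"
    "f' \<cdot> f = Ident C (Dom C f)" "f \<cdot> f' = Ident C (Cod C f)"
    using assms(1) by (rule isoE)
  obtain g' where g': "g \<in> Arr C" "g' \<in> Arr C" "Dom C g' = Cod C g" "Cod C g' = Dom C g"
    "g' \<cdot> g = Ident C (Dom C g)" "g \<cdot> g' = Ident C (Cod C g)"
    using assms(2) by (rule isoE)
  have "g' \<cdot> (g \<cdot> f) = f" "f \<cdot> (f' \<cdot> g') = g'"
    using Comp_assoc'[of f g g'] Comp_assoc'[of g' f' f] f' g' assms(3) by simp_all
  then show ?thesis
    using f' g' assms(3) by (intro isoI[where g = "f' \<cdot> g'"]) simp_all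
qed

text \<open>Cancelling the epi \<open>f\<close> in \<open>f g f = f\<close> turns the left inverse
  \<open>g\<close> into a right inverse.\<close>

lemma split_mono_epi_iso:
  assumes "f \<in> Arr C" "g \<in> Arr C" "Dom C g = Cod C f" "Cod C g = Dom C f"
    "g \<cdot> f = Ident C (Dom C f)" "is_epi C f"
  shows "is_iso C f"
proof (rule isoI[where g = g])
  show "f \<cdot> g = Ident C (Cod C f)"
    by (rule epi_cancel[OF assms(6)]) (use assms in simp_all)
qed (use assms in simp_all)

text \<open>Cancelling the mono \<open>f\<close> in \<open>f g f = f\<close> turns the right inverse
  \<open>g\<close> into a left inverse.\<close>

lemma split_epi_mono_iso:
  assumes "f \<in> Arr C" "g \<in> Arr C" "Dom C g = Cod C f" "Cod C g = Dom C f"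
    "f \<cdot> g = Ident C (Cod C f)" "is_mono C f"
  shows "is_iso C f"
proof (rule isoI[where g = g])
  show "g \<cdot> f = Ident C (Dom C f)"
    by (rule mono_cancel[OF assms(6)])
      (use assms Comp_assoc'[of f g f] in simp_all)
qed (use assms in simp_all)

text \<open>The composite followed by the inverse of \<open>g\<close> is \<open>f\<close>. Coherence
  isomorphisms are divided out of cocycle identities in this way.\<close>

lemma iso_right_factor:
  assumes "is_iso C (g \<cdot> f)" "is_iso C g" "f \<in> Arr C" "g \<in> Arr C" "Dom C g = Cod C f"
  shows "is_iso C f"
proof -
  obtain g' where g': "g' \<in> Arr C" "Dom C g' = Cod C g" "Cod C g' = Dom C g"
    "g' \<cdot> g = Ident C (Dom C g)" "is_iso C g'"
    using assms(2) by (rule isoE)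
  have "is_iso C (g' \<cdot> (g \<cdot> f))"
    by (rule iso_Comp) (use assms g' in simp_all)
  moreover have "g' \<cdot> (g \<cdot> f) = f"
    using assms g' Comp_assoc'[of f g g'] by simp
  ultimately show ?thesis
    by simp
qed

text \<open>With \<open>k\<close> the inverse of the composite, rebracketing makes
  \<open>k g\<close> a left inverse of \<open>f\<close> and \<open>f k\<close> a right inverse of
  \<open>g\<close>. The other sides have to come from a second composite.\<close>

lemma iso_Comp_splits:
  assumes "is_iso C (g \<cdot> f)" "f \<in> Arr C" "g \<in> Arr C" "Dom C g = Cod C f"
  obtains a b where "a \<in> Arr C" "Dom C a = Cod C f" "Cod C a = Dom C f" "a \<cdot> f = Ident C (Dom C f)"
    "b \<in> Arr C" "Dom C b = Cod C g" "Cod C b = Dom C g" "g \<cdot> b = Ident C (Cod C g)"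
proof -
  obtain k where k: "k \<in> Arr C" "Dom C k = Cod C g" "Cod C k = Dom C f"
    "k \<cdot> (g \<cdot> f) = Ident C (Dom C f)" "(g \<cdot> f) \<cdot> k = Ident C (Cod C g)"
    using isoE[OF assms(1)] assms(2-) by (metis Comp_simps)
  show thesis
    by (rule that[of "k \<cdot> g" "f \<cdot> k"]) (use k assms in simp_all)
qed

lemma mono_Comp:
  assumes "is_mono C f" "is_mono C g" "Dom C g = Cod C f"
  shows "is_mono C (g \<cdot> f)"
proof (rule monoI)
  note [simp] = mono_Arr[OF assms(1)] mono_Arr[OF assms(2)] assms(3)
  fix a b
  assume ab: "a \<in> Arr C" "b \<in> Arr C" "Cod C a = Dom C (g \<cdot> f)" "Cod C b = Dom C (g \<cdot> f)"
    "Dom C a = Dom C b" "g \<cdot> f \<cdot> a = g \<cdot> f \<cdot> b"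
  have "f \<cdot> a = f \<cdot> b"
    by (rule mono_cancel[OF assms(2)]) (use ab in simp_all)
  then show "a = b"
    by (rule mono_cancel[OF assms(1)]) (use ab in simp_all)
qed (use assms mono_Arr in simp)

text \<open>\<open>m\<close> equals \<open>(m v) v'\<close> with \<open>v'\<close> inverse to
  \<open>v\<close>. This isolates a component from a naturality square along an isomorphism.\<close>

lemma mono_if_Comp_iso:
  assumes m: "is_mono C (m \<cdot> v)" and v: "is_iso C v" and [simp]: "m \<in> Arr C" "Dom C m = Cod C v"
  shows "is_mono C m"
proof -
  obtain v' where v' [simp]: "v \<in> Arr C" "v' \<in> Arr C" "Dom C v' = Cod C v" "Cod C v' = Dom C v"
    "v \<cdot> v' = Ident C (Cod C v)" and iso: "is_iso C v'"
    using v by (rule isoE)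
  have "is_mono C ((m \<cdot> v) \<cdot> v')"
    by (rule mono_Comp[OF iso_mono[OF iso] m]) simp
  then show ?thesis
    by simp
qed

end

section \<open>Functors and natural transformations\<close>

lemma functor_simps:
  assumes "is_functor C D F"
  shows "X \<in> Obj C \<Longrightarrow> ObjMap F X \<in> Obj D"
    and "f \<in> Arr C \<Longrightarrow> ArrMap F f \<in> Arr D"
    and "f \<in> Arr C \<Longrightarrow> Dom D (ArrMap F f) = ObjMap F (Dom C f)"
    and "f \<in> Arr C \<Longrightarrow> Cod D (ArrMap F f) = ObjMap F (Cod C f)"
    and "X \<in> Obj C \<Longrightarrow> ArrMap F (Ident C X) = Ident D (ObjMap F X)"
    and "\<lbrakk>f \<in> Arr C; g \<in> Arr C; Dom C g = Cod C f\<rbrakk>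
      \<Longrightarrow> ArrMap F (g \<cdot>\<^bsub>C\<^esub> f) = ArrMap F g \<cdot>\<^bsub>D\<^esub> ArrMap F f"
proof -
  interpret category C using assms by (simp add: is_functor_def)
  show "X \<in> Obj C \<Longrightarrow> ObjMap F X \<in> Obj D"
    and "X \<in> Obj C \<Longrightarrow> ArrMap F (Ident C X) = Ident D (ObjMap F X)"
    using assms by (simp_all add: is_functor_def)
  have *: "ArrMap F f \<in> Hom D (ObjMap F (Dom C f)) (ObjMap F (Cod C f))" if "f \<in> Arr C" for f
    using assms that Dom_in_Obj Cod_in_Obj unfolding is_functor_def Hom_def by blast
  show "f \<in> Arr C \<Longrightarrow> ArrMap F f \<in> Arr D"
    "f \<in> Arr C \<Longrightarrow> Dom D (ArrMap F f) = ObjMap F (Dom C f)"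
    "f \<in> Arr C \<Longrightarrow> Cod D (ArrMap F f) = ObjMap F (Cod C f)"
    using * by (auto simp: Hom_def)
  assume fg: "f \<in> Arr C" "g \<in> Arr C" "Dom C g = Cod C f"
  have "\<forall>X\<in>Obj C. \<forall>Y\<in>Obj C. \<forall>Z\<in>Obj C. \<forall>f\<in>Hom C X Y. \<forall>g\<in>Hom C Y Z.
      ArrMap F (g \<cdot>\<^bsub>C\<^esub> f) = ArrMap F g \<cdot>\<^bsub>D\<^esub> ArrMap F f"
    using assms unfolding is_functor_def by blast
  then show "ArrMap F (g \<cdot>\<^bsub>C\<^esub> f) = ArrMap F g \<cdot>\<^bsub>D\<^esub> ArrMap F f"
    using fg Dom_in_Obj Cod_in_Obj unfolding Hom_def by blast
qed

lemma is_functorI: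
  assumes "category C" "category D"
    and "\<And>X. X \<in> Obj C \<Longrightarrow> ObjMap F X \<in> Obj D"
    and "\<And>f. f \<in> Arr C \<Longrightarrow> ArrMap F f \<in> Hom D (ObjMap F (Dom C f)) (ObjMap F (Cod C f))"
    and "\<And>X. X \<in> Obj C \<Longrightarrow> ArrMap F (Ident C X) = Ident D (ObjMap F X)"
    and "\<And>f g. \<lbrakk>f \<in> Arr C; g \<in> Arr C; Dom C g = Cod C f\<rbrakk>
      \<Longrightarrow> ArrMap F (g \<cdot>\<^bsub>C\<^esub> f) = ArrMap F g \<cdot>\<^bsub>D\<^esub> ArrMap F f"
  shows "is_functor C D F"
  unfolding is_functor_def using assms by (auto simp: Hom_def)

lemma funct_maps [simp]:
  "ObjMap (F \<circ>\<^sub>F F') X = ObjMap F (ObjMap F' X)"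
  "ArrMap (F \<circ>\<^sub>F F') f = ArrMap F (ArrMap F' f)"
  "ObjMap id_funct Y = Y" "ArrMap id_funct g = g"
  by (simp_all add: comp_funct_def id_funct_def)

lemma is_functor_category: "is_functor C D F \<Longrightarrow> category C" "is_functor C D F \<Longrightarrow> category D"
  by (simp_all add: is_functor_def)

lemma is_functor_id: "category C \<Longrightarrow> is_functor C C id_funct"
  by (rule is_functorI) (auto simp: Hom_def category.Dom_in_Obj)

lemma is_functor_comp:
  assumes "is_functor C D F'" "is_functor D E F"
  shows "is_functor C E (F \<circ>\<^sub>F F')"
  using is_functor_category[OF assms(1)] is_functor_category[OF assms(2)]
  by (intro is_functorI) (auto simp: Hom_def functor_simps[OF assms(1)] functor_simps[OF assms(2)])

lemma functor_iso:
  assumes "is_functor C D F" "is_iso C f"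
  shows "is_iso D (ArrMap F f)"
proof -
  interpret C: category C using assms is_functor_category by blast
  interpret D: category D using assms is_functor_category by blast
  note [simp] = functor_simps[OF assms(1)]
  obtain g where g: "f \<in> Arr C" "g \<in> Arr C" "Dom C g = Cod C f" "Cod C g = Dom C f"
    "g \<cdot>\<^bsub>C\<^esub> f = Ident C (Dom C f)" "f \<cdot>\<^bsub>C\<^esub> g = Ident C (Cod C f)"
    using assms(2) by (rule C.isoE)
  show ?thesis
    by (rule D.isoI[where g = "ArrMap F g"])
      (use g functor_simps(6)[OF assms(1), of f g] functor_simps(6)[OF assms(1), of g f] in simp_all)
qed

text \<open>The codomain enters the square as a variable \<open>Y\<close>, so that the rule also
  matches objects only known to equal \<open>Cod C f\<close>. The last clause is the square at the
  head of a longer composite.\<close>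

lemma nat_trans_simps:
  assumes "nat_trans C D F F' \<eta>"
  shows "X \<in> Obj C \<Longrightarrow> \<eta> X \<in> Arr D"
    and "X \<in> Obj C \<Longrightarrow> Dom D (\<eta> X) = ObjMap F X"
    and "X \<in> Obj C \<Longrightarrow> Cod D (\<eta> X) = ObjMap F' X"
    and "\<lbrakk>f \<in> Arr C; Y = Cod C f\<rbrakk>
      \<Longrightarrow> \<eta> Y \<cdot>\<^bsub>D\<^esub> ArrMap F f = ArrMap F' f \<cdot>\<^bsub>D\<^esub> \<eta> (Dom C f)"
    and "\<lbrakk>f \<in> Arr C; Y = Cod C f; x \<in> Arr D; Cod D x = ObjMap F (Dom C f)\<rbrakk>
      \<Longrightarrow> \<eta> Y \<cdot>\<^bsub>D\<^esub> (ArrMap F f \<cdot>\<^bsub>D\<^esub> x) = ArrMap F' f \<cdot>\<^bsub>D\<^esub> (\<eta> (Dom C f) \<cdot>\<^bsub>D\<^esub> x)"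
proof -
  have F: "is_functor C D F" "is_functor C D F'"
    using assms by (simp_all add: nat_trans_def)
  interpret C: category C using F is_functor_category by blast
  interpret D: category D using F is_functor_category by blast
  note [simp] = functor_simps[OF F(1)] functor_simps[OF F(2)]
  show \<eta>: "X \<in> Obj C \<Longrightarrow> \<eta> X \<in> Arr D" "X \<in> Obj C \<Longrightarrow> Dom D (\<eta> X) = ObjMap F X"
    "X \<in> Obj C \<Longrightarrow> Cod D (\<eta> X) = ObjMap F' X" for X
    using assms by (auto simp: nat_trans_def Hom_def)
  show nat: "\<eta> Y \<cdot>\<^bsub>D\<^esub> ArrMap F f = ArrMap F' f \<cdot>\<^bsub>D\<^esub> \<eta> (Dom C f)"
    if "f \<in> Arr C" "Y = Cod C f" for f Y
    using assms that C.Dom_in_Obj C.Cod_in_Obj unfolding nat_trans_def Hom_def by blast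
  show "\<eta> Y \<cdot>\<^bsub>D\<^esub> (ArrMap F f \<cdot>\<^bsub>D\<^esub> x) = ArrMap F' f \<cdot>\<^bsub>D\<^esub> (\<eta> (Dom C f) \<cdot>\<^bsub>D\<^esub> x)"
    if "f \<in> Arr C" "Y = Cod C f" "x \<in> Arr D" "Cod D x = ObjMap F (Dom C f)"
    by (rule D.Comp_reassoc) (use nat that \<eta> in simp_all)
qed

lemma nat_transI:
  assumes "is_functor C D F" "is_functor C D F'"
    and "\<And>X. X \<in> Obj C \<Longrightarrow> \<eta> X \<in> Hom D (ObjMap F X) (ObjMap F' X)"
    and "\<And>f. f \<in> Arr C \<Longrightarrow> \<eta> (Cod C f) \<cdot>\<^bsub>D\<^esub> ArrMap F f = ArrMap F' f \<cdot>\<^bsub>D\<^esub> \<eta> (Dom C f)"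
  shows "nat_trans C D F F' \<eta>"
  using assms by (auto simp: nat_trans_def Hom_def)

lemma nat_iso_nat_trans: "nat_iso C D F F' \<eta> \<Longrightarrow> nat_trans C D F F' \<eta>"
  by (simp add: nat_iso_def)

lemma nat_iso_iso: "nat_iso C D F F' \<eta> \<Longrightarrow> X \<in> Obj C \<Longrightarrow> is_iso D (\<eta> X)"
  by (simp add: nat_iso_def)

section \<open>Equivalences: full, faithful, essentially surjective, compatible with monos and
  isomorphisms\<close>

lemma faithful_if_left_inverse:
  assumes "is_functor C D F" "is_functor D C F'" "nat_iso C C (F' \<circ>\<^sub>F F) id_funct \<alpha>"
    and "f \<in> Arr C" "g \<in> Arr C" "Dom C f = Dom C g" "Cod C f = Cod C g" "ArrMap F f = ArrMap F g"
  shows "f = g"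
proof -
  interpret C: category C using assms is_functor_category by blast
  note \<alpha> = nat_trans_simps[OF nat_iso_nat_trans[OF assms(3)]]
  \<comment> \<open>By naturality both sides equal the component of \<alpha> at the codomain
    composed with \<open>F' (F f) = F' (F g)\<close>; the component at the domain is then cancelled
    as an epi.\<close>
  have "f \<cdot>\<^bsub>C\<^esub> \<alpha> (Dom C f) = g \<cdot>\<^bsub>C\<^esub> \<alpha> (Dom C f)"
    using \<alpha>(4)[of f "Cod C f"] \<alpha>(4)[of g "Cod C g"] assms(4-) by simp
  then show ?thesis
    using C.iso_epi[OF nat_iso_iso[OF assms(3)], of "Dom C f"] assms(4-) \<alpha>
    by (intro C.epi_cancel[of "\<alpha> (Dom C f)" f g]) auto
qed

lemma equivalence_faithful:
  assumes "is_equivalence C D F"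
    and "ArrMap F f = ArrMap F g" "f \<in> Arr C" "g \<in> Arr C" "Dom C f = Dom C g" "Cod C f = Cod C g"
  shows "f = g"
proof -
  obtain F' \<alpha> where "is_functor C D F" "is_functor D C F'"
    "nat_iso C C (F' \<circ>\<^sub>F F) id_funct \<alpha>"
    using assms(1) by (auto simp: is_equivalence_def)
  then show ?thesis
    by (rule faithful_if_left_inverse) (use assms(2-) in simp_all)
qed

text \<open>The preimage of \<open>h\<close> is \<open>F' h\<close> conjugated by \<alpha>.
  Naturality shows that \<open>F' (F f)\<close> and \<open>F' h\<close> agree, and \<open>F'\<close>
  is faithful because of \<beta>.\<close>

lemma equivalence_full:
  assumes "is_equivalence C D F"
    and "X \<in> Obj C" "Y \<in> Obj C" "h \<in> Arr D" "Dom D h = ObjMap F X" "Cod D h = ObjMap F Y"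
  obtains f where "f \<in> Arr C" "Dom C f = X" "Cod C f = Y" "ArrMap F f = h"
proof -
  obtain F' \<alpha> \<beta> where F: "is_functor C D F" "is_functor D C F'"
    "nat_iso C C (F' \<circ>\<^sub>F F) id_funct \<alpha>" "nat_iso D D (F \<circ>\<^sub>F F') id_funct \<beta>"
    using assms(1) by (auto simp: is_equivalence_def)
  interpret C: category C using F is_functor_category by blast
  interpret D: category D using F is_functor_category by blast
  note [simp] = functor_simps[OF F(1)] functor_simps[OF F(2)]
  note \<alpha> = nat_trans_simps[OF nat_iso_nat_trans[OF F(3)]]
  have [simp]: "\<alpha> X \<in> Arr C" "Dom C (\<alpha> X) = ObjMap F' (ObjMap F X)" "Cod C (\<alpha> X) = X"
    if "X \<in> Obj C" for X
    using \<alpha>(1-3) that by auto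
  obtain a where a: "a \<in> Arr C" "Dom C a = X" "Cod C a = ObjMap F' (ObjMap F X)"
    "a \<cdot>\<^bsub>C\<^esub> \<alpha> X = Ident C (ObjMap F' (ObjMap F X))"
    using C.isoE[OF nat_iso_iso[OF F(3) assms(2)]] assms(2) by auto
  define f where "f = \<alpha> Y \<cdot>\<^bsub>C\<^esub> (ArrMap F' h \<cdot>\<^bsub>C\<^esub> a)"
  have f: "f \<in> Arr C" "Dom C f = X" "Cod C f = Y"
    using assms a by (simp_all add: f_def)
  have "\<alpha> Y \<cdot>\<^bsub>C\<^esub> ArrMap F' (ArrMap F f) = f \<cdot>\<^bsub>C\<^esub> \<alpha> X"
    using \<alpha>(4)[of f Y] f by simp
  also have "\<dots> = \<alpha> Y \<cdot>\<^bsub>C\<^esub> ArrMap F' h"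
    using assms a by (simp add: f_def)
  finally have "ArrMap F' (ArrMap F f) = ArrMap F' h"
    using C.mono_cancel[OF C.iso_mono[OF nat_iso_iso[OF F(3) assms(3)]]] assms f by simp
  then have "ArrMap F f = h"
    using faithful_if_left_inverse[OF F(2,1,4), of "ArrMap F f" h] assms f by simp
  then show thesis
    using that f by blast
qed

lemma equivalence_ess_surj:
  assumes "is_equivalence C D F" "Y \<in> Obj D"
  obtains X b where "X \<in> Obj C" "b \<in> Arr D" "Dom D b = ObjMap F X" "Cod D b = Y" "is_iso D b"
proof -
  obtain F' \<beta> where F: "is_functor D C F'" "nat_iso D D (F \<circ>\<^sub>F F') id_funct \<beta>"
    using assms(1) by (auto simp: is_equivalence_def)
  show thesis
    using that[of "ObjMap F' Y" "\<beta> Y"] assms(2) functor_simps(1)[OF F(1)] nat_iso_iso[OF F(2)]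
      nat_trans_simps(1-3)[OF nat_iso_nat_trans[OF F(2)]] by simp
qed

text \<open>A test object of \<open>D\<close> need not lie in the image of \<open>F\<close>. An
  isomorphism \<open>b\<close> from some \<open>F X\<close> moves the test arrows to where fullness
  lifts them to \<open>C\<close>, and is cancelled at the end.\<close>

lemma equivalence_mono:
  assumes F: "is_equivalence C D F" and k: "is_mono C k"
  shows "is_mono D (ArrMap F k)"
proof -
  have F': "is_functor C D F" using F by (simp add: is_equivalence_def)
  interpret C: category C using F' is_functor_category by blast
  interpret D: category D using F' is_functor_category by blast
  note [simp] = functor_simps[OF F']
  have [simp]: "k \<in> Arr C" using k C.mono_Arr by blast
  show ?thesis
  proof (rule D.monoI)
    fix g h
    assume gh [simp]: "g \<in> Arr D" "h \<in> Arr D" "Cod D g = Dom D (ArrMap F k)"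
      "Cod D h = Dom D (ArrMap F k)" "Dom D g = Dom D h" "ArrMap F k \<cdot>\<^bsub>D\<^esub> g = ArrMap F k \<cdot>\<^bsub>D\<^esub> h"
    obtain X b where b [simp]: "X \<in> Obj C" "b \<in> Arr D" "Dom D b = ObjMap F X" "Cod D b = Dom D h"
      and iso: "is_iso D b"
      by (rule equivalence_ess_surj[OF F, of "Dom D h"]) simp_all
    obtain g' where g': "g' \<in> Arr C" "Dom C g' = X" "Cod C g' = Dom C k" "ArrMap F g' = g \<cdot>\<^bsub>D\<^esub> b"
      by (rule equivalence_full[OF F, of X "Dom C k" "g \<cdot>\<^bsub>D\<^esub> b"]) simp_all
    obtain h' where h': "h' \<in> Arr C" "Dom C h' = X" "Cod C h' = Dom C k" "ArrMap F h' = h \<cdot>\<^bsub>D\<^esub> b"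
      by (rule equivalence_full[OF F, of X "Dom C k" "h \<cdot>\<^bsub>D\<^esub> b"]) simp_all
    have "ArrMap F k \<cdot>\<^bsub>D\<^esub> (g \<cdot>\<^bsub>D\<^esub> b) = ArrMap F k \<cdot>\<^bsub>D\<^esub> (h \<cdot>\<^bsub>D\<^esub> b)"
      by (rule D.Comp_reassoc[OF gh(6)]) simp_all
    then have "k \<cdot>\<^bsub>C\<^esub> g' = k \<cdot>\<^bsub>C\<^esub> h'"
      using g' h' by (intro equivalence_faithful[OF F]) simp_all
    then have "g' = h'"
      using C.mono_cancel[OF k] g' h' by simp
    then have "g \<cdot>\<^bsub>D\<^esub> b = h \<cdot>\<^bsub>D\<^esub> b"
      using g' h' by simp
    then show "g = h"
      by (rule D.epi_cancel[OF D.iso_epi[OF iso]]) simp_all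
  qed simp
qed

text \<open>Fullness lifts the inverse, faithfulness the two equations for it.\<close>

lemma equivalence_reflects_iso:
  assumes F: "is_equivalence C D F" and f: "f \<in> Arr C" and iso: "is_iso D (ArrMap F f)"
  shows "is_iso C f"
proof -
  have F': "is_functor C D F" using F by (simp add: is_equivalence_def)
  interpret C: category C using F' is_functor_category by blast
  interpret D: category D using F' is_functor_category by blast
  note [simp] = functor_simps[OF F'] f
  obtain h where h: "h \<in> Arr D" "Dom D h = ObjMap F (Cod C f)" "Cod D h = ObjMap F (Dom C f)"
    "h \<cdot>\<^bsub>D\<^esub> ArrMap F f = Ident D (ObjMap F (Dom C f))"
    "ArrMap F f \<cdot>\<^bsub>D\<^esub> h = Ident D (ObjMap F (Cod C f))"
    using D.isoE[OF iso] by simp metis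
  obtain g where g: "g \<in> Arr C" "Dom C g = Cod C f" "Cod C g = Dom C f" "ArrMap F g = h"
    by (rule equivalence_full[OF F _ _ h(1-3)]) simp_all
  show ?thesis
  proof (rule C.isoI[where g = g])
    show "g \<cdot>\<^bsub>C\<^esub> f = Ident C (Dom C f)" "f \<cdot>\<^bsub>C\<^esub> g = Ident C (Cod C f)"
      by (rule equivalence_faithful[OF F]; use g h in simp)+
  qed (use g in simp_all)
qed

section \<open>Preadditive categories\<close>

context preadditive_category
begin

lemma Zero_simps [simp]:
  assumes "X \<in> Obj C" "Y \<in> Obj C"
  shows "Zero C X Y \<in> Arr C" "Dom C (Zero C X Y) = X" "Cod C (Zero C X Y) = Y"
proof -
  interpret comm_group "hom_group C X Y" using assms by (rule hom_group)
  show "Zero C X Y \<in> Arr C" "Dom C (Zero C X Y) = X" "Cod C (Zero C X Y) = Y"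
    using one_closed by (simp_all add: hom_group_def Hom_def)
qed

lemma Add_simps [simp]:
  assumes "f \<in> Arr C" "g \<in> Arr C" "Dom C f = Dom C g" "Cod C f = Cod C g"
  shows "Add C f g \<in> Arr C" "Dom C (Add C f g) = Dom C g" "Cod C (Add C f g) = Cod C g"
proof -
  interpret comm_group "hom_group C (Dom C f) (Cod C f)" using assms by (intro hom_group) simp_all
  show "Add C f g \<in> Arr C" "Dom C (Add C f g) = Dom C g" "Cod C (Add C f g) = Cod C g"
    using m_closed[of f g] assms by (simp_all add: hom_group_def Hom_def)
qed

lemma Add_Zero:
  assumes "f \<in> Arr C" "X = Dom C f" "Y = Cod C f"
  shows "Add C f (Zero C X Y) = f" "Add C (Zero C X Y) f = f"
proof -
  interpret comm_group "hom_group C X Y" using assms by (intro hom_group) simp_all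
  show "Add C f (Zero C X Y) = f" "Add C (Zero C X Y) f = f"
    using r_one[of f] l_one[of f] assms by (simp_all add: hom_group_def Hom_def)
qed

text \<open>The only idempotent of a group is its unit. This identifies the image of a zero arrow
  under any additive operation, first composition and later additive functors.\<close>

lemma Add_idem_Zero:
  assumes "f \<in> Arr C" "Add C f f = f"
  shows "f = Zero C (Dom C f) (Cod C f)"
proof -
  interpret comm_group "hom_group C (Dom C f) (Cod C f)" using assms by (intro hom_group) simp_all
  show ?thesis
    using l_cancel_one[of f f] assms by (simp add: hom_group_def Hom_def)
qed

lemma ex_neg:
  assumes "f \<in> Arr C"
  obtains f' where "f' \<in> Arr C" "Dom C f' = Dom C f" "Cod C f' = Cod C f"
    "Add C f' f = Zero C (Dom C f) (Cod C f)" "Add C f f' = Zero C (Dom C f) (Cod C f)"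
proof -
  interpret comm_group "hom_group C (Dom C f) (Cod C f)" using assms by (intro hom_group) simp_all
  show thesis
    using that[of "inv\<^bsub>hom_group C (Dom C f) (Cod C f)\<^esub> f"] inv_closed[of f] l_inv[of f] r_inv[of f] assms
    by (simp add: hom_group_def Hom_def)
qed

text \<open>The arrow \<open>g'\<close> stands for the negative of \<open>g\<close>, since the
  record carries no negation; the hypothesis on \<open>f\<close> reads
  \<open>f - g = 0\<close>.\<close>

lemma eq_if_diff_Zero:
  assumes "f \<in> Arr C" "g \<in> Arr C" "g' \<in> Arr C" "Dom C f = Dom C g" "Cod C f = Cod C g"
    "Dom C g' = Dom C g" "Cod C g' = Cod C g"
    and "Add C g' g = Zero C (Dom C g) (Cod C g)" "Add C f g' = Zero C (Dom C g) (Cod C g)"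
  shows "f = g"
proof -
  interpret comm_group "hom_group C (Dom C g) (Cod C g)" using assms by (intro hom_group) simp_all
  have "Add C (Add C f g') g = Add C f (Add C g' g)"
    using m_assoc[of f g' g] assms(1-7) by (simp add: hom_group_def Hom_def)
  then show ?thesis
    using assms Add_Zero by simp
qed

lemma Comp_Add [simp]:
  "\<lbrakk>f \<in> Arr C; f' \<in> Arr C; g \<in> Arr C; Dom C f = Dom C f'; Cod C f = Cod C f'; Dom C g = Cod C f'\<rbrakk>
    \<Longrightarrow> g \<cdot> Add C f f' = Add C (g \<cdot> f) (g \<cdot> f')"
  "\<lbrakk>g \<in> Arr C; g' \<in> Arr C; f \<in> Arr C; Dom C g = Dom C g'; Cod C g = Cod C g'; Dom C g' = Cod C f\<rbrakk>
    \<Longrightarrow> Add C g g' \<cdot> f = Add C (g \<cdot> f) (g' \<cdot> f)"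
  using Comp_Add_right[of f "Dom C f" "Cod C f" f' g "Cod C g"]
    Comp_Add_left[of f "Dom C f" "Cod C f" g "Cod C g" g'] by (auto simp: Hom_def)

lemma Comp_Zero [simp]:
  assumes "f \<in> Arr C" "X \<in> Obj C"
  shows "Y = Dom C f \<Longrightarrow> f \<cdot> Zero C X Y = Zero C X (Cod C f)"
    and "Y = Cod C f \<Longrightarrow> Zero C Y X \<cdot> f = Zero C (Dom C f) X"
proof -
  show "f \<cdot> Zero C X Y = Zero C X (Cod C f)" if Y: "Y = Dom C f"
  proof -
    have "Add C (f \<cdot> Zero C X Y) (f \<cdot> Zero C X Y) = f \<cdot> Add C (Zero C X Y) (Zero C X Y)"
      by (rule Comp_Add(1)[symmetric]) (use assms Y in simp_all)
    also have "Add C (Zero C X Y) (Zero C X Y) = Zero C X Y"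
      by (rule Add_Zero) (use assms Y in simp_all)
    finally show ?thesis
      using Add_idem_Zero[of "f \<cdot> Zero C X Y"] assms Y by simp
  qed
  show "Zero C Y X \<cdot> f = Zero C (Dom C f) X" if Y: "Y = Cod C f"
  proof -
    have "Add C (Zero C Y X \<cdot> f) (Zero C Y X \<cdot> f) = Add C (Zero C Y X) (Zero C Y X) \<cdot> f"
      by (rule Comp_Add(2)[symmetric]) (use assms Y in simp_all)
    also have "Add C (Zero C Y X) (Zero C Y X) = Zero C Y X"
      by (rule Add_Zero) (use assms Y in simp_all)
    finally show ?thesis
      using Add_idem_Zero[of "Zero C Y X \<cdot> f"] assms Y by simp
  qed
qed

section \<open>Kernels, cokernels and biproducts\<close>

lemma kernel_mono:
  assumes "is_kernel C f k"
  shows "is_mono C k"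
proof -
  have k: "f \<in> Arr C" "k \<in> Arr C" "Cod C k = Dom C f" "f \<cdot> k = Zero C (Dom C k) (Cod C f)"
    using assms by (simp_all add: is_kernel_def)
  show ?thesis
  proof (rule monoI)
    fix g h
    assume gh: "g \<in> Arr C" "h \<in> Arr C" "Cod C g = Dom C k" "Cod C h = Dom C k"
      "Dom C g = Dom C h" "k \<cdot> g = k \<cdot> h"
    have "f \<cdot> (k \<cdot> h) = (f \<cdot> k) \<cdot> h"
      by (rule Comp_assoc'[symmetric]) (use k gh in simp_all)
    then have "f \<cdot> (k \<cdot> h) = Zero C (Dom C h) (Cod C f)"
      using k gh by simp
    then have "\<exists>!u. u \<in> Hom C (Dom C h) (Dom C k) \<and> k \<cdot> u = k \<cdot> h"
      using assms gh k unfolding is_kernel_def by (simp add: Hom_def)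
    then show "g = h"
      using gh by (auto simp: Hom_def)
  qed (use k in simp)
qed

lemma kernelD:
  assumes "is_kernel C f k"
  shows "f \<in> Arr C" "k \<in> Arr C" "Cod C k = Dom C f" "f \<cdot> k = Zero C (Dom C k) (Cod C f)"
  using assms by (simp_all add: is_kernel_def)

lemma kernel_factor:
  assumes "is_kernel C f k" "h \<in> Arr C" "Cod C h = Dom C f" "f \<cdot> h = Zero C (Dom C h) (Cod C f)"
  obtains u where "u \<in> Arr C" "Dom C u = Dom C h" "Cod C u = Dom C k" "k \<cdot> u = h"
proof -
  have "\<exists>!u. u \<in> Hom C (Dom C h) (Dom C k) \<and> k \<cdot> u = h"
    using assms unfolding is_kernel_def by (simp add: Hom_def)
  then show thesis
    using that by (auto simp: Hom_def)
qed

text \<open>Monicity of \<open>k\<close> takes over the uniqueness clause of the definition, so that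
  only the existence of a factorisation remains.\<close>

lemma kernelI:
  assumes "f \<in> Arr C" "is_mono C k" "Cod C k = Dom C f" "f \<cdot> k = Zero C (Dom C k) (Cod C f)"
    and "\<And>h. \<lbrakk>h \<in> Arr C; Cod C h = Dom C f; f \<cdot> h = Zero C (Dom C h) (Cod C f)\<rbrakk>
      \<Longrightarrow> \<exists>u \<in> Hom C (Dom C h) (Dom C k). k \<cdot> u = h"
  shows "is_kernel C f k"
  unfolding is_kernel_def
proof (intro conjI ballI impI)
  fix W h
  assume "W \<in> Obj C" "h \<in> Hom C W (Dom C f)" "f \<cdot> h = Zero C W (Cod C f)"
  then obtain u where "u \<in> Hom C W (Dom C k)" "k \<cdot> u = h"
    using assms(5)[of h] by (auto simp: Hom_def)
  then show "\<exists>!u. u \<in> Hom C W (Dom C k) \<and> k \<cdot> u = h"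
    using mono_cancel[OF assms(2)] by (intro ex1I[of _ u]) (auto simp: Hom_def)
qed (use assms mono_Arr in simp_all)

lemma cokernel_epi:
  assumes "is_cokernel C f c"
  shows "is_epi C c"
proof -
  have c: "f \<in> Arr C" "c \<in> Arr C" "Dom C c = Cod C f" "c \<cdot> f = Zero C (Dom C f) (Cod C c)"
    using assms by (simp_all add: is_cokernel_def)
  show ?thesis
  proof (rule epiI)
    fix g h
    assume gh: "g \<in> Arr C" "h \<in> Arr C" "Dom C g = Cod C c" "Dom C h = Cod C c"
      "Cod C g = Cod C h" "g \<cdot> c = h \<cdot> c"
    have "(h \<cdot> c) \<cdot> f = Zero C (Dom C f) (Cod C h)"
      using c gh by simp
    then have "\<exists>!u. u \<in> Hom C (Cod C c) (Cod C h) \<and> u \<cdot> c = h \<cdot> c"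
      using assms gh c unfolding is_cokernel_def by (simp add: Hom_def)
    then show "g = h"
      using gh by (auto simp: Hom_def)
  qed (use c in simp)
qed

lemma cokernelD:
  assumes "is_cokernel C f c"
  shows "f \<in> Arr C" "c \<in> Arr C" "Dom C c = Cod C f" "c \<cdot> f = Zero C (Dom C f) (Cod C c)"
  using assms by (simp_all add: is_cokernel_def)

lemma cokernel_factor:
  assumes "is_cokernel C f c" "h \<in> Arr C" "Dom C h = Cod C f" "h \<cdot> f = Zero C (Dom C f) (Cod C h)"
  obtains u where "u \<in> Arr C" "Dom C u = Cod C c" "Cod C u = Cod C h" "u \<cdot> c = h"
proof -
  have "\<exists>!u. u \<in> Hom C (Cod C c) (Cod C h) \<and> u \<cdot> c = h"
    using assms unfolding is_cokernel_def by (simp add: Hom_def)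
  then show thesis
    using that by (auto simp: Hom_def)
qed

lemma cokernelI:
  assumes "f \<in> Arr C" "is_epi C c" "Dom C c = Cod C f" "c \<cdot> f = Zero C (Dom C f) (Cod C c)"
    and "\<And>h. \<lbrakk>h \<in> Arr C; Dom C h = Cod C f; h \<cdot> f = Zero C (Dom C f) (Cod C h)\<rbrakk>
      \<Longrightarrow> \<exists>u \<in> Hom C (Cod C c) (Cod C h). u \<cdot> c = h"
  shows "is_cokernel C f c"
  unfolding is_cokernel_def
proof (intro conjI ballI impI)
  fix W h
  assume "W \<in> Obj C" "h \<in> Hom C (Cod C f) W" "h \<cdot> f = Zero C (Dom C f) W"
  then obtain u where "u \<in> Hom C (Cod C c) W" "u \<cdot> c = h"
    using assms(5)[of h] by (auto simp: Hom_def)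
  then show "\<exists>!u. u \<in> Hom C (Cod C c) W \<and> u \<cdot> c = h"
    using epi_cancel[OF assms(2)] by (intro ex1I[of _ u]) (auto simp: Hom_def)
qed (use assms epi_Arr in simp_all)

lemma kernel_Comp_iso:
  assumes k: "is_kernel C f k" and v: "is_iso C v" "Cod C v = Dom C k"
  shows "is_kernel C f (k \<cdot> v)"
proof -
  note kD = kernelD[OF k]
  obtain u where u: "v \<in> Arr C" "u \<in> Arr C" "Dom C u = Cod C v" "Cod C u = Dom C v"
    "u \<cdot> v = Ident C (Dom C v)" "v \<cdot> u = Ident C (Cod C v)"
    using v(1) by (rule isoE)
  show ?thesis
  proof (rule kernelI)
    show "is_mono C (k \<cdot> v)"
    proof (rule monoI)
      fix g h
      assume gh: "g \<in> Arr C" "h \<in> Arr C" "Cod C g = Dom C (k \<cdot> v)" "Cod C h = Dom C (k \<cdot> v)"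
        "Dom C g = Dom C h" "(k \<cdot> v) \<cdot> g = (k \<cdot> v) \<cdot> h"
      have "v \<cdot> g = v \<cdot> h"
        by (rule mono_cancel[OF kernel_mono[OF k]]) (use gh kD v u in simp_all)
      then show "g = h"
        by (rule mono_cancel[OF iso_mono[OF v(1)]]) (use gh kD v u in simp_all)
    qed (use kD v u in simp)
    show "f \<cdot> (k \<cdot> v) = Zero C (Dom C (k \<cdot> v)) (Cod C f)"
      using kD v u Comp_assoc'[of v k f] by simp
    fix h
    assume h: "h \<in> Arr C" "Cod C h = Dom C f" "f \<cdot> h = Zero C (Dom C h) (Cod C f)"
    obtain w where w: "w \<in> Arr C" "Dom C w = Dom C h" "Cod C w = Dom C k" "k \<cdot> w = h"
      using kernel_factor[OF k h] .
    show "\<exists>u\<in>Hom C (Dom C h) (Dom C (k \<cdot> v)). k \<cdot> v \<cdot> u = h"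
    proof (rule bexI[where x = "u \<cdot> w"])
      have "v \<cdot> (u \<cdot> w) = w"
        using Comp_assoc'[of w u v] w u v by simp
      then show "k \<cdot> v \<cdot> (u \<cdot> w) = h"
        using w u v kD by simp
    qed (use w u v kD in \<open>simp add: Hom_def\<close>)
  qed (use kD v u in simp_all)
qed

lemma cokernel_Comp_iso:
  assumes c: "is_cokernel C f c" and v: "is_iso C v" "Dom C v = Cod C c"
  shows "is_cokernel C f (v \<cdot> c)"
proof -
  note cD = cokernelD[OF c]
  obtain u where u: "v \<in> Arr C" "u \<in> Arr C" "Dom C u = Cod C v" "Cod C u = Dom C v"
    "u \<cdot> v = Ident C (Dom C v)" "v \<cdot> u = Ident C (Cod C v)"
    using v(1) by (rule isoE)
  show ?thesis
  proof (rule cokernelI)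
    show "is_epi C (v \<cdot> c)"
    proof (rule epiI)
      fix g h
      assume gh: "g \<in> Arr C" "h \<in> Arr C" "Dom C g = Cod C (v \<cdot> c)" "Dom C h = Cod C (v \<cdot> c)"
        "Cod C g = Cod C h" "g \<cdot> (v \<cdot> c) = h \<cdot> (v \<cdot> c)"
      have "g \<cdot> v = h \<cdot> v"
        by (rule epi_cancel[OF cokernel_epi[OF c]]) (use gh cD v u in simp_all)
      then show "g = h"
        by (rule epi_cancel[OF iso_epi[OF v(1)]]) (use gh cD v u in simp_all)
    qed (use cD v u in simp)
    show "v \<cdot> c \<cdot> f = Zero C (Dom C f) (Cod C (v \<cdot> c))"
      using cD v u by simp
    fix h
    assume h: "h \<in> Arr C" "Dom C h = Cod C f" "h \<cdot> f = Zero C (Dom C f) (Cod C h)"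
    obtain w where w: "w \<in> Arr C" "Dom C w = Cod C c" "Cod C w = Cod C h" "w \<cdot> c = h"
      using cokernel_factor[OF c h] .
    show "\<exists>u\<in>Hom C (Cod C (v \<cdot> c)) (Cod C h). u \<cdot> (v \<cdot> c) = h"
    proof (rule bexI[where x = "w \<cdot> u"])
      have "u \<cdot> (v \<cdot> c) = c"
        using Comp_assoc'[of c v u] w u v cD by simp
      then show "w \<cdot> u \<cdot> (v \<cdot> c) = h"
        using w u v cD by simp
    qed (use w u v cD in \<open>simp add: Hom_def\<close>)
  qed (use cD v u in simp_all)
qed

text \<open>Each kernel factors through the other, and monicity makes the two factorisations
  mutually inverse. Since kernels form a relation, this is the means to pass from a constructed
  kernel to a given one.\<close>

lemma kernel_unique:
  assumes "is_kernel C f k" "is_kernel C f k'"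
  obtains v where "is_iso C v" "v \<in> Arr C" "Dom C v = Dom C k'" "Cod C v = Dom C k" "k \<cdot> v = k'"
proof -
  note D = kernelD[OF assms(1)] kernelD[OF assms(2)]
  obtain v where v: "v \<in> Arr C" "Dom C v = Dom C k'" "Cod C v = Dom C k" "k \<cdot> v = k'"
    by (rule kernel_factor[OF assms(1), of k']) (use D in simp_all)
  obtain u where u: "u \<in> Arr C" "Dom C u = Dom C k" "Cod C u = Dom C k'" "k' \<cdot> u = k"
    by (rule kernel_factor[OF assms(2), of k]) (use D in simp_all)
  have "v \<cdot> u = Ident C (Dom C k)"
  proof (rule mono_cancel[OF kernel_mono[OF assms(1)]])
    show "k \<cdot> (v \<cdot> u) = k \<cdot> Ident C (Dom C k)"
      using Comp_assoc'[of u v k] u v D by simp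
  qed (use u v D in simp_all)
  moreover have "u \<cdot> v = Ident C (Dom C k')"
  proof (rule mono_cancel[OF kernel_mono[OF assms(2)]])
    show "k' \<cdot> (u \<cdot> v) = k' \<cdot> Ident C (Dom C k')"
      using Comp_assoc'[of v u k'] u v D by simp
  qed (use u v D in simp_all)
  ultimately have "is_iso C v"
    using isoI[of v u] u v by simp
  then show thesis
    using that v by blast
qed

lemma cokernel_unique:
  assumes "is_cokernel C f c" "is_cokernel C f c'"
  obtains v where "is_iso C v" "v \<in> Arr C" "Dom C v = Cod C c" "Cod C v = Cod C c'" "v \<cdot> c = c'"
proof -
  note D = cokernelD[OF assms(1)] cokernelD[OF assms(2)]
  obtain v where v: "v \<in> Arr C" "Dom C v = Cod C c" "Cod C v = Cod C c'" "v \<cdot> c = c'"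
    by (rule cokernel_factor[OF assms(1), of c']) (use D in simp_all)
  obtain u where u: "u \<in> Arr C" "Dom C u = Cod C c'" "Cod C u = Cod C c" "u \<cdot> c' = c"
    by (rule cokernel_factor[OF assms(2), of c]) (use D in simp_all)
  have "u \<cdot> v = Ident C (Cod C c)"
    by (rule epi_cancel[OF cokernel_epi[OF assms(1)]]) (use u v D in simp_all)
  moreover have "v \<cdot> u = Ident C (Cod C c')"
    by (rule epi_cancel[OF cokernel_epi[OF assms(2)]]) (use u v D in simp_all)
  ultimately have "is_iso C v"
    using isoI[of v u] u v by simp
  then show thesis
    using that v by blast
qed

text \<open>If \<open>m g = m h\<close>, then \<open>m\<close> kills \<open>g - h\<close>, which
  therefore factors through the zero arrow \<open>k\<close>.\<close>

lemma mono_if_trivial_kernel: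
  assumes "m \<in> Arr C" "is_kernel C m k" "k = Zero C (Dom C k) (Cod C k)"
  shows "is_mono C m"
proof (rule monoI)
  fix g h
  assume gh: "g \<in> Arr C" "h \<in> Arr C" "Cod C g = Dom C m" "Cod C h = Dom C m"
    "Dom C g = Dom C h" "m \<cdot> g = m \<cdot> h"
  obtain h' where h': "h' \<in> Arr C" "Dom C h' = Dom C h" "Cod C h' = Cod C h"
    "Add C h' h = Zero C (Dom C h) (Cod C h)" "Add C h h' = Zero C (Dom C h) (Cod C h)"
    using ex_neg[OF gh(2)] .
  note kD = kernelD[OF assms(2)]
  have "m \<cdot> Add C g h' = m \<cdot> Add C h h'"
    using gh h'(1-3) assms(1) by simp
  then have "m \<cdot> Add C g h' = Zero C (Dom C h) (Cod C m)"
    using gh h'(5) assms(1) by simp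
  then obtain u where u: "u \<in> Arr C" "Dom C u = Dom C h" "Cod C u = Dom C k" "k \<cdot> u = Add C g h'"
    using kernel_factor[OF assms(2), of "Add C g h'"] gh h' by auto
  have "Zero C (Dom C k) (Cod C k) \<cdot> u = Zero C (Dom C h) (Cod C h)"
    using u gh kD by simp
  then have "Add C g h' = Zero C (Dom C h) (Cod C h)"
    using u(4) assms(3) by simp
  then show "g = h"
    using eq_if_diff_Zero[of g h h'] gh h' by simp
qed (use assms in simp)

lemma epi_if_trivial_cokernel:
  assumes "p \<in> Arr C" "is_cokernel C p c" "c = Zero C (Dom C c) (Cod C c)"
  shows "is_epi C p"
proof (rule epiI)
  fix g h
  assume gh: "g \<in> Arr C" "h \<in> Arr C" "Dom C g = Cod C p" "Dom C h = Cod C p"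
    "Cod C g = Cod C h" "g \<cdot> p = h \<cdot> p"
  obtain h' where h': "h' \<in> Arr C" "Dom C h' = Dom C h" "Cod C h' = Cod C h"
    "Add C h' h = Zero C (Dom C h) (Cod C h)" "Add C h h' = Zero C (Dom C h) (Cod C h)"
    using ex_neg[OF gh(2)] .
  note cD = cokernelD[OF assms(2)]
  have "Add C g h' \<cdot> p = Add C h h' \<cdot> p"
    using gh h'(1-3) assms(1) by simp
  then have "Add C g h' \<cdot> p = Zero C (Dom C p) (Cod C h)"
    using gh h'(5) assms(1) by simp
  then obtain u where u: "u \<in> Arr C" "Dom C u = Cod C c" "Cod C u = Cod C h" "u \<cdot> c = Add C g h'"
    using cokernel_factor[OF assms(2), of "Add C g h'"] gh h' by auto
  have "u \<cdot> Zero C (Dom C c) (Cod C c) = Zero C (Dom C h) (Cod C h)"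
    using u gh cD by simp
  then have "Add C g h' = Zero C (Dom C h) (Cod C h)"
    using u(4) assms(3) by simp
  then show "g = h"
    using eq_if_diff_Zero[of g h h'] gh h' by simp
qed (use assms in simp)

text \<open>Insert the identity of \<open>P\<close>, written as \<open>j1 p1 + j2 p2\<close>, to the
  right of \<open>a\<close> and \<open>b\<close>.\<close>

lemma biproduct_epic:
  assumes "is_biproduct C X Y P j1 j2 p1 p2"
    and "a \<in> Arr C" "b \<in> Arr C" "Dom C a = P" "Dom C b = P" "Cod C a = Cod C b"
    and "a \<cdot> j1 = b \<cdot> j1" "a \<cdot> j2 = b \<cdot> j2"
  shows "a = b"
proof -
  have bp: "P \<in> Obj C" "j1 \<in> Arr C" "Dom C j1 = X" "Cod C j1 = P" "j2 \<in> Arr C" "Dom C j2 = Y"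
    "Cod C j2 = P" "p1 \<in> Arr C" "Dom C p1 = P" "Cod C p1 = X" "p2 \<in> Arr C" "Dom C p2 = P" "Cod C p2 = Y"
    and sum: "Add C (j1 \<cdot> p1) (j2 \<cdot> p2) = Ident C P"
    using assms(1) by (auto simp: is_biproduct_def Hom_def)
  have 1: "a \<cdot> (j1 \<cdot> p1) = b \<cdot> (j1 \<cdot> p1)"
    by (rule Comp_reassoc[OF assms(7)]) (use assms(2-6) bp in simp_all)
  have 2: "a \<cdot> (j2 \<cdot> p2) = b \<cdot> (j2 \<cdot> p2)"
    by (rule Comp_reassoc[OF assms(8)]) (use assms(2-6) bp in simp_all)
  have "a \<cdot> Add C (j1 \<cdot> p1) (j2 \<cdot> p2) = b \<cdot> Add C (j1 \<cdot> p1) (j2 \<cdot> p2)"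
    using assms(2-6) bp 1 2 by simp
  then show ?thesis
    unfolding sum using assms(2-6) by simp
qed

end

section \<open>Additive functors and additive equivalences\<close>

lemma additive_functor_Add:
  assumes "is_additive_functor C D F" "category C"
    and "f \<in> Arr C" "g \<in> Arr C" "Dom C f = Dom C g" "Cod C f = Cod C g"
  shows "ArrMap F (Add C f g) = Add D (ArrMap F f) (ArrMap F g)"
proof -
  interpret category C by fact
  have "ArrMap F (Add C f f') = Add D (ArrMap F f) (ArrMap F f')"
    if "X \<in> Obj C" "Y \<in> Obj C" "f \<in> Hom C X Y" "f' \<in> Hom C X Y" for X Y f f'
    using assms(1) that by (simp add: is_additive_functor_def)
  from this[of "Dom C g" "Cod C g" f g] show ?thesis
    using assms by (simp add: Hom_def)
qed

lemma additive_functor_Zero: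
  assumes "is_additive_functor C D F" "preadditive_category C" "preadditive_category D"
    and "X \<in> Obj C" "Y \<in> Obj C"
  shows "ArrMap F (Zero C X Y) = Zero D (ObjMap F X) (ObjMap F Y)"
proof -
  interpret C: preadditive_category C by fact
  interpret D: preadditive_category D by fact
  have F: "is_functor C D F" using assms(1) by (simp add: is_additive_functor_def)
  note [simp] = functor_simps[OF F]
  have "Add D (ArrMap F (Zero C X Y)) (ArrMap F (Zero C X Y))
      = ArrMap F (Add C (Zero C X Y) (Zero C X Y))"
    by (rule additive_functor_Add[OF assms(1) C.category_axioms, symmetric]) (use assms in simp_all)
  also have "Add C (Zero C X Y) (Zero C X Y) = Zero C X Y"
    by (rule C.Add_Zero) (use assms in simp_all)
  finally show ?thesis
    using D.Add_idem_Zero[of "ArrMap F (Zero C X Y)"] assms by simp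
qed

text \<open>A test arrow \<open>h\<close> is precomposed with an isomorphism \<open>b\<close> from
  an object in the image of \<open>F\<close>. The result lifts to \<open>C\<close>, is killed by
  \<open>f\<close> there by faithfulness, and factors through \<open>k\<close>.\<close>

lemma equivalence_kernel:
  assumes F: "is_additive_functor C D F" "is_equivalence C D F"
    and "preadditive_category C" "preadditive_category D" and k: "is_kernel C f k"
  shows "is_kernel D (ArrMap F f) (ArrMap F k)"
proof -
  interpret C: preadditive_category C by fact
  interpret D: preadditive_category D by fact
  have F': "is_functor C D F" using F(1) by (simp add: is_additive_functor_def)
  note [simp] = functor_simps[OF F'] additive_functor_Zero[OF F(1) assms(3,4)]
  note kD [simp] = C.kernelD[OF k]
  show ?thesis
  proof (rule D.kernelI)
    show "is_mono D (ArrMap F k)"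
      by (rule equivalence_mono[OF F(2) C.kernel_mono[OF k]])
    have "ArrMap F (f \<cdot>\<^bsub>C\<^esub> k) = Zero D (ObjMap F (Dom C k)) (ObjMap F (Cod C f))"
      by simp
    then show "ArrMap F f \<cdot>\<^bsub>D\<^esub> ArrMap F k = Zero D (Dom D (ArrMap F k)) (Cod D (ArrMap F f))"
      using functor_simps(6)[OF F', of k f] by simp
    fix h
    assume h [simp]: "h \<in> Arr D" "Cod D h = Dom D (ArrMap F f)"
      and "ArrMap F f \<cdot>\<^bsub>D\<^esub> h = Zero D (Dom D h) (Cod D (ArrMap F f))"
    then have fh: "ArrMap F f \<cdot>\<^bsub>D\<^esub> h = Zero D (Dom D h) (ObjMap F (Cod C f))"
      by simp
    obtain X b where b [simp]: "X \<in> Obj C" "b \<in> Arr D" "Dom D b = ObjMap F X" "Cod D b = Dom D h"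
      and iso: "is_iso D b"
      by (rule equivalence_ess_surj[OF F(2), of "Dom D h"]) simp_all
    obtain b' where b' [simp]: "b' \<in> Arr D" "Dom D b' = Dom D h" "Cod D b' = ObjMap F X"
      "b \<cdot>\<^bsub>D\<^esub> b' = Ident D (Dom D h)"
      using D.isoE[OF iso] by simp metis
    obtain h' where h' [simp]: "h' \<in> Arr C" "Dom C h' = X" "Cod C h' = Dom C f"
      and h'b: "ArrMap F h' = h \<cdot>\<^bsub>D\<^esub> b"
      by (rule equivalence_full[OF F(2), of X "Dom C f" "h \<cdot>\<^bsub>D\<^esub> b"]) simp_all
    have "ArrMap F f \<cdot>\<^bsub>D\<^esub> (h \<cdot>\<^bsub>D\<^esub> b) = (ArrMap F f \<cdot>\<^bsub>D\<^esub> h) \<cdot>\<^bsub>D\<^esub> b"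
      by (rule D.Comp_assoc'[symmetric]) simp_all
    then have "ArrMap F f \<cdot>\<^bsub>D\<^esub> (h \<cdot>\<^bsub>D\<^esub> b) = Zero D (ObjMap F X) (ObjMap F (Cod C f))"
      unfolding fh by simp
    then have "f \<cdot>\<^bsub>C\<^esub> h' = Zero C X (Cod C f)"
      using h'b by (intro equivalence_faithful[OF F(2)]) simp_all
    then obtain u where u: "u \<in> Arr C" "Dom C u = X" "Cod C u = Dom C k" "k \<cdot>\<^bsub>C\<^esub> u = h'"
      using C.kernel_factor[OF k, of h'] by auto
    \<comment> \<open>\<open>u\<close> factors the lift of \<open>h b\<close>; the right inverse
      \<open>b'\<close> of \<open>b\<close> removes \<open>b\<close> again.\<close>
    have "ArrMap F k \<cdot>\<^bsub>D\<^esub> (ArrMap F u \<cdot>\<^bsub>D\<^esub> b') = (h \<cdot>\<^bsub>D\<^esub> b) \<cdot>\<^bsub>D\<^esub> b'"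
      using D.Comp_assoc'[of b' "ArrMap F u" "ArrMap F k"] functor_simps(6)[OF F', of u k] u h'b
      by simp
    then have "ArrMap F k \<cdot>\<^bsub>D\<^esub> (ArrMap F u \<cdot>\<^bsub>D\<^esub> b') = h"
      by simp
    then show "\<exists>u\<in>Hom D (Dom D h) (Dom D (ArrMap F k)). ArrMap F k \<cdot>\<^bsub>D\<^esub> u = h"
      using u by (intro bexI[of _ "ArrMap F u \<cdot>\<^bsub>D\<^esub> b'"]) (simp_all add: Hom_def)
  qed simp_all
qed

section \<open>Group actions\<close>

locale cat_action = group G + additive_category C
  for G :: "('g, 'y) monoid_scheme" and C :: "('o, 'm, 'z) addcat_scheme" +
  fixes T :: "('g, 'o, 'm) action"
  assumes is_action: "is_action G C T"
begin

abbreviation unit ("\<upsilon>") where "\<upsilon> \<equiv> action_unit G C T"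

lemma act_additive: "g \<in> carrier G \<Longrightarrow> is_additive_functor C C (Act T g)"
  and act_equivalence: "g \<in> carrier G \<Longrightarrow> is_equivalence C C (Act T g)"
  and Coh_nat_iso: "\<lbrakk>g \<in> carrier G; h \<in> carrier G\<rbrakk>
    \<Longrightarrow> nat_iso C C (Act T g \<circ>\<^sub>F Act T h) (Act T (g \<otimes>\<^bsub>G\<^esub> h)) (Coh T g h)"
  using is_action by (auto simp: is_action_def)

lemma act_functor: "g \<in> carrier G \<Longrightarrow> is_functor C C (Act T g)"
  using act_additive by (simp add: is_additive_functor_def)

lemmas act_simps [simp] = functor_simps[OF act_functor]

lemma act_Zero [simp]:
  assumes "g \<in> carrier G" "X \<in> Obj C" "Y \<in> Obj C"
  shows "ArrMap (Act T g) (Zero C X Y) = Zero C (ObjMap (Act T g) X) (ObjMap (Act T g) Y)"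
  by (rule additive_functor_Zero[OF act_additive]) (use assms preadditive_category_axioms in simp_all)

lemma act_Add [simp]:
  assumes "g \<in> carrier G" "f \<in> Arr C" "f' \<in> Arr C" "Dom C f = Dom C f'" "Cod C f = Cod C f'"
  shows "ArrMap (Act T g) (Add C f f') = Add C (ArrMap (Act T g) f) (ArrMap (Act T g) f')"
  by (rule additive_functor_Add[OF act_additive]) (use assms category_axioms in simp_all)

lemma act_faithful:
  assumes "ArrMap (Act T g) f = ArrMap (Act T g) f'" "g \<in> carrier G" "f \<in> Arr C" "f' \<in> Arr C"
    "Dom C f = Dom C f'" "Cod C f = Cod C f'"
  shows "f = f'"
  using equivalence_faithful[OF act_equivalence] assms by blast

lemma act_mono: "g \<in> carrier G \<Longrightarrow> is_mono C k \<Longrightarrow> is_mono C (ArrMap (Act T g) k)"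
  by (rule equivalence_mono[OF act_equivalence])

lemma act_iso: "g \<in> carrier G \<Longrightarrow> is_iso C k \<Longrightarrow> is_iso C (ArrMap (Act T g) k)"
  by (rule functor_iso[OF act_functor])

lemma act_kernel:
  "g \<in> carrier G \<Longrightarrow> is_kernel C f k \<Longrightarrow> is_kernel C (ArrMap (Act T g) f) (ArrMap (Act T g) k)"
  using equivalence_kernel[OF act_additive act_equivalence] preadditive_category_axioms by blast

lemma Coh_simps [simp]:
  assumes "g \<in> carrier G" "h \<in> carrier G" "X \<in> Obj C"
  shows "Coh T g h X \<in> Arr C"
    and "Dom C (Coh T g h X) = ObjMap (Act T g) (ObjMap (Act T h) X)"
    and "Cod C (Coh T g h X) = ObjMap (Act T (g \<otimes>\<^bsub>G\<^esub> h)) X"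
    and "is_iso C (Coh T g h X)"
  using nat_trans_simps(1-3)[OF nat_iso_nat_trans[OF Coh_nat_iso[OF assms(1,2)]] assms(3)]
    nat_iso_iso[OF Coh_nat_iso[OF assms(1,2)] assms(3)] by simp_all

lemma Coh_natural:
  assumes "g \<in> carrier G" "h \<in> carrier G" "f \<in> Arr C"
  shows "Coh T g h (Cod C f) \<cdot>\<^bsub>C\<^esub> ArrMap (Act T g) (ArrMap (Act T h) f)
      = ArrMap (Act T (g \<otimes>\<^bsub>G\<^esub> h)) f \<cdot>\<^bsub>C\<^esub> Coh T g h (Dom C f)"
  using nat_trans_simps(4)[OF nat_iso_nat_trans[OF Coh_nat_iso[OF assms(1,2)]]] assms(3) by simp

lemma Coh_natural_Comp:
  assumes "g \<in> carrier G" "h \<in> carrier G" "f \<in> Arr C"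
    and "x \<in> Arr C" "Cod C x = ObjMap (Act T g) (ObjMap (Act T h) (Dom C f))"
  shows "Coh T g h (Cod C f) \<cdot>\<^bsub>C\<^esub> (ArrMap (Act T g) (ArrMap (Act T h) f) \<cdot>\<^bsub>C\<^esub> x)
      = ArrMap (Act T (g \<otimes>\<^bsub>G\<^esub> h)) f \<cdot>\<^bsub>C\<^esub> (Coh T g h (Dom C f) \<cdot>\<^bsub>C\<^esub> x)"
  by (rule Comp_reassoc[OF Coh_natural]) (use assms in simp_all)

text \<open>Images of composites are always distributed into composites of images, so an identity
  has to be transported by \<open>\<rho>\<^sub>g\<close> in this already distributed form.\<close>

lemma act_eq:
  assumes "a \<cdot>\<^bsub>C\<^esub> b = c \<cdot>\<^bsub>C\<^esub> d" "g \<in> carrier G" "a \<in> Arr C" "b \<in> Arr C" "c \<in> Arr C" "d \<in> Arr C"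
    "Dom C a = Cod C b" "Dom C c = Cod C d"
  shows "ArrMap (Act T g) a \<cdot>\<^bsub>C\<^esub> ArrMap (Act T g) b = ArrMap (Act T g) c \<cdot>\<^bsub>C\<^esub> ArrMap (Act T g) d"
  using arg_cong[OF assms(1), of "ArrMap (Act T g)"] assms(2-) by simp

lemma act_Comp:
  assumes "a \<cdot>\<^bsub>C\<^esub> b = c" "g \<in> carrier G" "a \<in> Arr C" "b \<in> Arr C" "Dom C a = Cod C b"
  shows "ArrMap (Act T g) a \<cdot>\<^bsub>C\<^esub> ArrMap (Act T g) b = ArrMap (Act T g) c"
  using assms by auto

lemma unit_ex1:
  assumes "X \<in> Obj C"
  shows "\<exists>!u. u \<in> Hom C (ObjMap (Act T \<one>\<^bsub>G\<^esub>) X) X \<and>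
    ArrMap (Act T \<one>\<^bsub>G\<^esub>) u = Coh T \<one>\<^bsub>G\<^esub> \<one>\<^bsub>G\<^esub> X"
proof -
  obtain u where u: "u \<in> Arr C" "Dom C u = ObjMap (Act T \<one>\<^bsub>G\<^esub>) X" "Cod C u = X"
    "ArrMap (Act T \<one>\<^bsub>G\<^esub>) u = Coh T \<one>\<^bsub>G\<^esub> \<one>\<^bsub>G\<^esub> X"
    by (rule equivalence_full[OF act_equivalence, of "\<one>\<^bsub>G\<^esub>" "ObjMap (Act T \<one>\<^bsub>G\<^esub>) X" X
          "Coh T \<one>\<^bsub>G\<^esub> \<one>\<^bsub>G\<^esub> X"]) (use assms in simp_all)
  show ?thesis
  proof (rule ex1I[of _ u])
    fix v
    assume "v \<in> Hom C (ObjMap (Act T \<one>\<^bsub>G\<^esub>) X) X \<and>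
      ArrMap (Act T \<one>\<^bsub>G\<^esub>) v = Coh T \<one>\<^bsub>G\<^esub> \<one>\<^bsub>G\<^esub> X"
    then show "v = u"
      using u by (intro act_faithful[of "\<one>\<^bsub>G\<^esub>" v u]) (simp_all add: Hom_def)
  qed (use u in \<open>simp add: Hom_def\<close>)
qed

lemma unit_simps [simp]:
  assumes "X \<in> Obj C"
  shows "\<upsilon> X \<in> Arr C" "Dom C (\<upsilon> X) = ObjMap (Act T \<one>\<^bsub>G\<^esub>) X" "Cod C (\<upsilon> X) = X"
    and "ArrMap (Act T \<one>\<^bsub>G\<^esub>) (\<upsilon> X) = Coh T \<one>\<^bsub>G\<^esub> \<one>\<^bsub>G\<^esub> X"
  using theI'[OF unit_ex1[OF assms]] by (simp_all add: action_unit_def Hom_def)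

text \<open>The equivalence \<open>\<rho>\<^sub>1\<close> sends the unit component to an invertible
  coherence component, and equivalences reflect isomorphisms.\<close>

lemma unit_iso [simp]:
  assumes "X \<in> Obj C"
  shows "is_iso C (\<upsilon> X)"
  by (rule equivalence_reflects_iso[OF act_equivalence, of "\<one>\<^bsub>G\<^esub>"]) (use assms in simp_all)

text \<open>Under the faithful \<open>\<rho>\<^sub>1\<close> the square becomes naturality of the
  coherence isomorphism for the pair of group units.\<close>

lemma unit_natural:
  assumes "f \<in> Arr C"
  shows "\<upsilon> (Cod C f) \<cdot>\<^bsub>C\<^esub> ArrMap (Act T \<one>\<^bsub>G\<^esub>) f = f \<cdot>\<^bsub>C\<^esub> \<upsilon> (Dom C f)"
  by (rule act_faithful[of "\<one>\<^bsub>G\<^esub>"])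
    (use assms Coh_natural[of "\<one>\<^bsub>G\<^esub>" "\<one>\<^bsub>G\<^esub>" f] in simp_all)


section \<open>The equivariant category\<close>

abbreviation E where "E \<equiv> eqv_cat G C T"

abbreviation und :: "('g, 'o, 'm) eqv_arr \<Rightarrow> 'm" where "und a \<equiv> snd (snd a)"

lemma eqv_Obj_simps [simp]:
  assumes "P \<in> Obj E"
  shows "fst P \<in> Obj C"
    and "g \<in> carrier G \<Longrightarrow> snd P g \<in> Arr C"
    and "g \<in> carrier G \<Longrightarrow> Dom C (snd P g) = fst P"
    and "g \<in> carrier G \<Longrightarrow> Cod C (snd P g) = ObjMap (Act T g) (fst P)"
    and "g \<in> carrier G \<Longrightarrow> is_iso C (snd P g)"
  using assms by (auto simp: eqv_cat_def eqv_objects_def Hom_def)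

lemma eqv_Obj_extensional: "P \<in> Obj E \<Longrightarrow> snd P \<in> extensional (carrier G)"
  by (auto simp: eqv_cat_def eqv_objects_def)

lemma eqv_Obj_cocycle:
  assumes "P \<in> Obj E" "g \<in> carrier G" "h \<in> carrier G"
  shows "snd P (g \<otimes>\<^bsub>G\<^esub> h)
    = Coh T g h (fst P) \<cdot>\<^bsub>C\<^esub> (ArrMap (Act T g) (snd P h) \<cdot>\<^bsub>C\<^esub> snd P g)"
  using assms by (auto simp: eqv_cat_def eqv_objects_def)

text \<open>The definition of equivariant objects states no unit condition. It is hidden in the
  cocycle identity for the pair of group units, whose coherence factor is the image of the unit
  under \<open>\<rho>\<^sub>1\<close>: cancel the invertible cocycle on the right, then use
  faithfulness of \<open>\<rho>\<^sub>1\<close>.\<close>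

lemma eqv_Obj_unit:
  assumes P: "P \<in> Obj E"
  shows "\<upsilon> (fst P) \<cdot>\<^bsub>C\<^esub> snd P \<one>\<^bsub>G\<^esub> = Ident C (fst P)"
proof (rule act_faithful[of "\<one>\<^bsub>G\<^esub>"])
  let ?\<rho> = "ArrMap (Act T \<one>\<^bsub>G\<^esub>)"
  have "(?\<rho> (\<upsilon> (fst P)) \<cdot>\<^bsub>C\<^esub> ?\<rho> (snd P \<one>\<^bsub>G\<^esub>)) \<cdot>\<^bsub>C\<^esub> snd P \<one>\<^bsub>G\<^esub>
      = Ident C (ObjMap (Act T \<one>\<^bsub>G\<^esub>) (fst P)) \<cdot>\<^bsub>C\<^esub> snd P \<one>\<^bsub>G\<^esub>"
    using P eqv_Obj_cocycle[OF P, of "\<one>\<^bsub>G\<^esub>" "\<one>\<^bsub>G\<^esub>"] by simp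
  then have "?\<rho> (\<upsilon> (fst P)) \<cdot>\<^bsub>C\<^esub> ?\<rho> (snd P \<one>\<^bsub>G\<^esub>) = Ident C (ObjMap (Act T \<one>\<^bsub>G\<^esub>) (fst P))"
    by (rule epi_cancel[OF iso_epi, rotated]) (use P in simp_all)
  then show "?\<rho> (\<upsilon> (fst P) \<cdot>\<^bsub>C\<^esub> snd P \<one>\<^bsub>G\<^esub>) = ?\<rho> (Ident C (fst P))"
    using P by simp
qed (use P in simp_all)

text \<open>A cocycle is invertible as soon as it is so at the unit of the group: with \<open>h = inv g\<close>, the
  cocycle identity for \<open>g, h\<close> makes \<open>\<chi> g\<close> split mono, and the one for \<open>h, g\<close> makes
  \<open>\<rho>\<^sub>h (\<chi> g)\<close> split epi.\<close>

lemma eqv_ObjI: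
  assumes X: "X \<in> Obj C" and ext: "\<chi> \<in> extensional (carrier G)"
    and \<chi>: "\<And>g. g \<in> carrier G \<Longrightarrow> \<chi> g \<in> Arr C \<and> Dom C (\<chi> g) = X \<and> Cod C (\<chi> g) = ObjMap (Act T g) X"
    and cocycle: "\<And>g h. \<lbrakk>g \<in> carrier G; h \<in> carrier G\<rbrakk>
      \<Longrightarrow> \<chi> (g \<otimes>\<^bsub>G\<^esub> h) = Coh T g h X \<cdot>\<^bsub>C\<^esub> (ArrMap (Act T g) (\<chi> h) \<cdot>\<^bsub>C\<^esub> \<chi> g)"
    and unit: "\<upsilon> X \<cdot>\<^bsub>C\<^esub> \<chi> \<one>\<^bsub>G\<^esub> = Ident C X"
  shows "(X, \<chi>) \<in> Obj E"
proof -
  note [simp] = X \<chi>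
  have one: "is_iso C (\<chi> \<one>\<^bsub>G\<^esub>)"
    by (rule iso_right_factor[where g = "\<upsilon> X"]) (use unit in \<open>simp_all add: iso_Ident\<close>)
  \<comment> \<open>The cocycle identity for a pair with product 1 writes the invertible value at 1
    as a coherence isomorphism times this composite.\<close>
  have iso: "is_iso C (ArrMap (Act T g) (\<chi> h) \<cdot>\<^bsub>C\<^esub> \<chi> g)"
    if "g \<in> carrier G" "h \<in> carrier G" "g \<otimes>\<^bsub>G\<^esub> h = \<one>\<^bsub>G\<^esub>" for g h
    by (rule iso_right_factor[where g = "Coh T g h X"])
      (use that one cocycle[of g h] in simp_all)
  have "is_iso C (\<chi> g)" if g: "g \<in> carrier G" for g
  proof -
    let ?h = "inv\<^bsub>G\<^esub> g"
    have h: "?h \<in> carrier G" "g \<otimes>\<^bsub>G\<^esub> ?h = \<one>\<^bsub>G\<^esub>" "?h \<otimes>\<^bsub>G\<^esub> g = \<one>\<^bsub>G\<^esub>"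
      using g by simp_all
    obtain a where a: "a \<in> Arr C" "Dom C a = ObjMap (Act T g) X" "Cod C a = X" "a \<cdot>\<^bsub>C\<^esub> \<chi> g = Ident C X"
      by (rule iso_Comp_splits[OF iso[OF g h(1,2)]]) (use g h(1) in simp_all)
    obtain b where b: "b \<in> Arr C" "Dom C b = ObjMap (Act T ?h) (ObjMap (Act T g) X)"
      "Cod C b = ObjMap (Act T ?h) X"
      "ArrMap (Act T ?h) (\<chi> g) \<cdot>\<^bsub>C\<^esub> b = Ident C (ObjMap (Act T ?h) (ObjMap (Act T g) X))"
      by (rule iso_Comp_splits[OF iso[OF h(1) g h(3)]]) (use g h(1) in simp_all)
    have "is_iso C (ArrMap (Act T ?h) (\<chi> g))"
    proof (rule split_mono_epi_iso[where g = "ArrMap (Act T ?h) a"])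
      show "ArrMap (Act T ?h) a \<cdot>\<^bsub>C\<^esub> ArrMap (Act T ?h) (\<chi> g)
          = Ident C (Dom C (ArrMap (Act T ?h) (\<chi> g)))"
        using act_Comp[OF a(4) h(1)] a g h(1) by simp
      show "is_epi C (ArrMap (Act T ?h) (\<chi> g))"
        by (rule split_epi[where g = b]) (use b g h(1) in simp_all)
    qed (use a g h(1) in simp_all)
    then show ?thesis
      by (rule equivalence_reflects_iso[OF act_equivalence, rotated 2]) (use g h(1) in simp_all)
  qed
  then show ?thesis
    using assms by (simp add: eqv_cat_def eqv_objects_def Hom_def)
qed

lemma eqv_Arr_simps [simp]:
  assumes "a \<in> Arr E"
  shows "Dom E a \<in> Obj E" "Cod E a \<in> Obj E"
    and "und a \<in> Arr C" "Dom C (und a) = fst (Dom E a)" "Cod C (und a) = fst (Cod E a)"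
  using assms by (auto simp: eqv_cat_def eqv_arrows_def Hom_def)

lemma eqv_Arr_eqv:
  assumes "a \<in> Arr E" "g \<in> carrier G"
  shows "snd (Cod E a) g \<cdot>\<^bsub>C\<^esub> und a = ArrMap (Act T g) (und a) \<cdot>\<^bsub>C\<^esub> snd (Dom E a) g"
  using assms by (auto simp: eqv_cat_def eqv_arrows_def)

lemma eqv_ArrI:
  assumes "P \<in> Obj E" "Q \<in> Obj E" "f \<in> Arr C" "Dom C f = fst P" "Cod C f = fst Q"
    and "\<And>g. g \<in> carrier G \<Longrightarrow> snd Q g \<cdot>\<^bsub>C\<^esub> f = ArrMap (Act T g) f \<cdot>\<^bsub>C\<^esub> snd P g"
  shows "(P, Q, f) \<in> Arr E"
  using assms by (auto simp: eqv_cat_def eqv_arrows_def Hom_def split: prod.splits)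

text \<open>Phrased through \<open>Dom\<close>, \<open>Cod\<close> and \<open>und\<close>,
  composition and addition apply to arrows that are not displayed as triples.\<close>

lemma eqv_cat_simps [simp]:
  "Dom E (P, Q, f) = P" "Cod E (P, Q, f) = Q"
  "Ident E P = (P, P, Ident C (fst P))"
  "Comp E b a = (Dom E a, Cod E b, und b \<cdot>\<^bsub>C\<^esub> und a)"
  "Zero E P Q = (P, Q, Zero C (fst P) (fst Q))"
  "Add E a b = (Dom E a, Cod E a, Add C (und a) (und b))"
  by (auto simp: eqv_cat_def split: prod.splits)

lemma eqv_Arr_collapse: "(Dom E a, Cod E a, und a) = a"
  by (auto simp: eqv_cat_def split: prod.splits)

lemma eqv_Arr_eqI:
  "\<lbrakk>Dom E a = Dom E b; Cod E a = Cod E b; und a = und b\<rbrakk> \<Longrightarrow> a = b"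
  using eqv_Arr_collapse by metis

section \<open>Category axioms and hom groups of the equivariant category; first transfer
  results\<close>

lemma eqv_category: "category E"
proof (unfold_locales)
  fix X assume X: "X \<in> Obj E"
  then show "Ident E X \<in> Hom E X X"
    by (auto simp: Hom_def intro!: eqv_ArrI)
next
  fix f X Y g Z assume fg: "f \<in> Hom E X Y" "g \<in> Hom E Y Z"
  have "snd (Cod E g) k \<cdot>\<^bsub>C\<^esub> (und g \<cdot>\<^bsub>C\<^esub> und f)
      = ArrMap (Act T k) (und g) \<cdot>\<^bsub>C\<^esub> (ArrMap (Act T k) (und f) \<cdot>\<^bsub>C\<^esub> snd (Dom E f) k)"
    if "k \<in> carrier G" for k
    using fg that Comp_reassoc[OF eqv_Arr_eqv[of g k], of "und f"] eqv_Arr_eqv[of f k]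
    by (auto simp: Hom_def)
  then show "g \<cdot>\<^bsub>E\<^esub> f \<in> Hom E X Z"
    using fg by (auto simp: Hom_def intro!: eqv_ArrI)
qed (auto simp: Hom_def intro!: eqv_Arr_eqI)

sublocale eqv: category E
  by (rule eqv_category)

lemma eqv_Zero:
  assumes "P \<in> Obj E" "Q \<in> Obj E"
  shows "(P, Q, Zero C (fst P) (fst Q)) \<in> Arr E"
  by (rule eqv_ArrI) (use assms in simp_all)

lemma eqv_Add:
  assumes "a \<in> Arr E" "b \<in> Arr E" "Dom E a = Dom E b" "Cod E a = Cod E b"
  shows "(Dom E b, Cod E b, Add C (und a) (und b)) \<in> Arr E"
  by (rule eqv_ArrI) (use assms eqv_Arr_eqv[of a] eqv_Arr_eqv[of b] in simp_all)

lemma eqv_preadditive: "preadditive_category E"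
proof (intro preadditive_category.intro preadditive_category_axioms.intro eqv_category)
  fix P Q assume PQ: "P \<in> Obj E" "Q \<in> Obj E"
  interpret A: comm_group "hom_group C (fst P) (fst Q)"
    using PQ by (intro hom_group) simp_all
  have und: "und a \<in> carrier (hom_group C (fst P) (fst Q))"
    if "a \<in> Arr E" "Dom E a = P" "Cod E a = Q" for a
    using that by (auto simp: hom_group_def Hom_def)
  note ops = hom_group_def[of C "fst P" "fst Q"]
  show "comm_group (hom_group E P Q)"
  proof (rule comm_groupI)
    fix a b c
    assume "a \<in> carrier (hom_group E P Q)" "b \<in> carrier (hom_group E P Q)"
      "c \<in> carrier (hom_group E P Q)"
    then have abc: "a \<in> Arr E" "Dom E a = P" "Cod E a = Q" "b \<in> Arr E" "Dom E b = P" "Cod E b = Q"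
      "c \<in> Arr E" "Dom E c = P" "Cod E c = Q"
      by (auto simp: hom_group_def Hom_def)
    show "a \<otimes>\<^bsub>hom_group E P Q\<^esub> b \<in> carrier (hom_group E P Q)"
      using abc eqv_Add[of a b] by (simp add: hom_group_def Hom_def)
    show "(a \<otimes>\<^bsub>hom_group E P Q\<^esub> b) \<otimes>\<^bsub>hom_group E P Q\<^esub> c
        = a \<otimes>\<^bsub>hom_group E P Q\<^esub> (b \<otimes>\<^bsub>hom_group E P Q\<^esub> c)"
      using abc A.m_assoc[OF und und und, of a b c] by (simp add: hom_group_def)
    show "a \<otimes>\<^bsub>hom_group E P Q\<^esub> b = b \<otimes>\<^bsub>hom_group E P Q\<^esub> a"
      using abc A.m_comm[OF und und, of a b] by (simp add: hom_group_def)
    show "\<one>\<^bsub>hom_group E P Q\<^esub> \<otimes>\<^bsub>hom_group E P Q\<^esub> a = a"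
      using abc A.l_one[OF und, of a] by (auto simp: hom_group_def intro: eqv_Arr_eqI)
    obtain f where f: "f \<in> Arr C" "Dom C f = fst P" "Cod C f = fst Q"
      "Add C f (und a) = Zero C (fst P) (fst Q)" "Add C (und a) f = Zero C (fst P) (fst Q)"
      using ex_neg[of "und a"] abc by auto
    \<comment> \<open>The negative of an equivariant arrow is equivariant: both sides of the
      condition are negatives of the common value of the condition for \<open>a\<close>.\<close>
    have "(P, Q, f) \<in> Arr E"
    proof (rule eqv_ArrI)
      fix g assume g: "g \<in> carrier G"
      let ?\<rho> = "ArrMap (Act T g)"
      have *: "snd Q g \<cdot>\<^bsub>C\<^esub> und a = ?\<rho> (und a) \<cdot>\<^bsub>C\<^esub> snd P g"
        using eqv_Arr_eqv[OF abc(1) g] abc by simp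
      have "Add C (snd Q g \<cdot>\<^bsub>C\<^esub> f) (snd Q g \<cdot>\<^bsub>C\<^esub> und a) = snd Q g \<cdot>\<^bsub>C\<^esub> Add C f (und a)"
        using PQ f(1-3) abc g by (intro Comp_Add(1)[symmetric]) simp_all
      then have 1: "Add C (snd Q g \<cdot>\<^bsub>C\<^esub> f) (?\<rho> (und a) \<cdot>\<^bsub>C\<^esub> snd P g)
          = Zero C (fst P) (ObjMap (Act T g) (fst Q))"
        using PQ f g * by simp
      have "Add C (?\<rho> (und a) \<cdot>\<^bsub>C\<^esub> snd P g) (?\<rho> f \<cdot>\<^bsub>C\<^esub> snd P g) = ?\<rho> (Add C (und a) f) \<cdot>\<^bsub>C\<^esub> snd P g"
        using PQ f(1-3) abc g by simp
      then have 2: "Add C (?\<rho> (und a) \<cdot>\<^bsub>C\<^esub> snd P g) (?\<rho> f \<cdot>\<^bsub>C\<^esub> snd P g)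
          = Zero C (fst P) (ObjMap (Act T g) (fst Q))"
        unfolding f(5) using PQ g by simp
      show "snd Q g \<cdot>\<^bsub>C\<^esub> f = ?\<rho> f \<cdot>\<^bsub>C\<^esub> snd P g"
        by (rule eq_if_diff_Zero[of _ _ "?\<rho> (und a) \<cdot>\<^bsub>C\<^esub> snd P g"]) (use PQ f(1-3) abc g 1 2 in simp_all)
    qed (use PQ f in simp_all)
    then show "\<exists>b\<in>carrier (hom_group E P Q). b \<otimes>\<^bsub>hom_group E P Q\<^esub> a = \<one>\<^bsub>hom_group E P Q\<^esub>"
      using f by (intro bexI[of _ "(P, Q, f)"]) (simp_all add: hom_group_def Hom_def)
  qed (use PQ eqv_Zero in \<open>simp_all add: hom_group_def Hom_def\<close>)
qed (auto simp: Hom_def)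

sublocale eqv: preadditive_category E
  by (rule eqv_preadditive)

text \<open>This direction is formal, the forgetful functor being faithful. The converse
  \<open>eqv_monoD\<close> rests on the construction of kernels.\<close>

lemma eqv_mono_if_mono:
  assumes "a \<in> Arr E" "is_mono C (und a)"
  shows "is_mono E a"
proof (rule eqv.monoI)
  fix g h
  assume gh: "g \<in> Arr E" "h \<in> Arr E" "Cod E g = Dom E a" "Cod E h = Dom E a" "Dom E g = Dom E h"
    "a \<cdot>\<^bsub>E\<^esub> g = a \<cdot>\<^bsub>E\<^esub> h"
  have "und g = und h"
    by (rule mono_cancel[OF assms(2)]) (use assms gh in simp_all)
  then show "g = h"
    using gh by (intro eqv_Arr_eqI) simp_all
qed (fact assms)

lemma eqv_epi_if_epi:
  assumes "a \<in> Arr E" "is_epi C (und a)"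
  shows "is_epi E a"
proof (rule eqv.epiI)
  fix g h
  assume gh: "g \<in> Arr E" "h \<in> Arr E" "Dom E g = Cod E a" "Dom E h = Cod E a" "Cod E g = Cod E h"
    "g \<cdot>\<^bsub>E\<^esub> a = h \<cdot>\<^bsub>E\<^esub> a"
  have "und g = und h"
    by (rule epi_cancel[OF assms(2)]) (use assms gh in simp_all)
  then show "g = h"
    using gh by (intro eqv_Arr_eqI) simp_all
qed (fact assms)

text \<open>The two sides of the equivariance condition for the inverse agree after precomposition
  with \<open>und a\<close>, which is epi.\<close>

lemma eqv_iso_if_iso:
  assumes a: "a \<in> Arr E" "is_iso C (und a)"
  shows "is_iso E a"
proof -
  obtain f where f: "f \<in> Arr C" "Dom C f = fst (Cod E a)" "Cod C f = fst (Dom E a)"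
    "f \<cdot>\<^bsub>C\<^esub> und a = Ident C (fst (Dom E a))" "und a \<cdot>\<^bsub>C\<^esub> f = Ident C (fst (Cod E a))"
    using isoE[OF a(2)] a(1) by simp metis
  have "(Cod E a, Dom E a, f) \<in> Arr E"
  proof (rule eqv_ArrI)
    fix g assume g: "g \<in> carrier G"
    let ?\<rho> = "ArrMap (Act T g)"
    have "?\<rho> f \<cdot>\<^bsub>C\<^esub> (snd (Cod E a) g \<cdot>\<^bsub>C\<^esub> und a) = (?\<rho> f \<cdot>\<^bsub>C\<^esub> ?\<rho> (und a)) \<cdot>\<^bsub>C\<^esub> snd (Dom E a) g"
      using a f(1-3) g eqv_Arr_eqv[OF a(1) g] by simp
    also have "?\<rho> f \<cdot>\<^bsub>C\<^esub> ?\<rho> (und a) = Ident C (ObjMap (Act T g) (fst (Dom E a)))"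
      using act_Comp[OF f(4) g] a f(1-3) g by simp
    also have "\<dots> \<cdot>\<^bsub>C\<^esub> snd (Dom E a) g = snd (Dom E a) g \<cdot>\<^bsub>C\<^esub> (f \<cdot>\<^bsub>C\<^esub> und a)"
      unfolding f(4) using a g by simp
    finally have "(snd (Dom E a) g \<cdot>\<^bsub>C\<^esub> f) \<cdot>\<^bsub>C\<^esub> und a = (?\<rho> f \<cdot>\<^bsub>C\<^esub> snd (Cod E a) g) \<cdot>\<^bsub>C\<^esub> und a"
      using a f(1-3) g by simp
    then show "snd (Dom E a) g \<cdot>\<^bsub>C\<^esub> f = ?\<rho> f \<cdot>\<^bsub>C\<^esub> snd (Cod E a) g"
      by (rule epi_cancel[OF iso_epi[OF a(2)]]) (use a(1) f(1-3) g in simp_all)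
  qed (use a f in simp_all)
  then show ?thesis
    using a f by (intro eqv.isoI[of a "(Cod E a, Dom E a, f)"]) simp_all
qed

end

section \<open>Kernels, cokernels, zero object and biproducts lifted to the equivariant
  category\<close>

context cat_action
begin

text \<open>An equivariant structure may be checked after composition with a jointly epic family of
  arrows from equivariant objects. This yields cokernels (one arrow), biproducts (two coprojections)
  and the zero object (the empty family).\<close>

lemma eqv_Obj_if_jointly_epic:
  assumes Q: "Q \<in> Obj C" and ext: "\<chi> \<in> extensional (carrier G)"
    and \<chi>: "\<And>g. g \<in> carrier G \<Longrightarrow> \<chi> g \<in> Arr C \<and> Dom C (\<chi> g) = Q \<and> Cod C (\<chi> g) = ObjMap (Act T g) Q"
    and J: "\<And>P c. (P, c) \<in> J \<Longrightarrow> P \<in> Obj E \<and> c \<in> Arr C \<and> Dom C c = fst P \<and> Cod C c = Q"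
    and J\<chi>: "\<And>P c g. \<lbrakk>(P, c) \<in> J; g \<in> carrier G\<rbrakk>
      \<Longrightarrow> \<chi> g \<cdot>\<^bsub>C\<^esub> c = ArrMap (Act T g) c \<cdot>\<^bsub>C\<^esub> snd P g"
    and epic: "\<And>a b. \<lbrakk>a \<in> Arr C; b \<in> Arr C; Dom C a = Q; Dom C b = Q; Cod C a = Cod C b;
      \<And>P c. (P, c) \<in> J \<Longrightarrow> a \<cdot>\<^bsub>C\<^esub> c = b \<cdot>\<^bsub>C\<^esub> c\<rbrakk> \<Longrightarrow> a = b"
  shows "(Q, \<chi>) \<in> Obj E"
proof (rule eqv_ObjI[OF Q ext \<chi>])
  note [simp] = Q \<chi>
  show "\<upsilon> Q \<cdot>\<^bsub>C\<^esub> \<chi> \<one>\<^bsub>G\<^esub> = Ident C Q"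
  proof (rule epic)
    fix P c assume Pc: "(P, c) \<in> J"
    note [simp] = J[OF Pc]
    have "(\<upsilon> Q \<cdot>\<^bsub>C\<^esub> \<chi> \<one>\<^bsub>G\<^esub>) \<cdot>\<^bsub>C\<^esub> c = \<upsilon> (Cod C c) \<cdot>\<^bsub>C\<^esub> (ArrMap (Act T \<one>\<^bsub>G\<^esub>) c \<cdot>\<^bsub>C\<^esub> snd P \<one>\<^bsub>G\<^esub>)"
      using J\<chi>[OF Pc, of "\<one>\<^bsub>G\<^esub>"] by simp
    also have "\<dots> = c \<cdot>\<^bsub>C\<^esub> (\<upsilon> (Dom C c) \<cdot>\<^bsub>C\<^esub> snd P \<one>\<^bsub>G\<^esub>)"
      by (rule Comp_reassoc[OF unit_natural]) simp_all
    finally show "\<upsilon> Q \<cdot>\<^bsub>C\<^esub> \<chi> \<one>\<^bsub>G\<^esub> \<cdot>\<^bsub>C\<^esub> c = Ident C Q \<cdot>\<^bsub>C\<^esub> c"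
      using eqv_Obj_unit[of P] by simp
  qed simp_all
  fix g h assume [simp]: "g \<in> carrier G" "h \<in> carrier G"
  let ?\<rho> = "ArrMap (Act T g)"
  show "\<chi> (g \<otimes>\<^bsub>G\<^esub> h) = Coh T g h Q \<cdot>\<^bsub>C\<^esub> (?\<rho> (\<chi> h) \<cdot>\<^bsub>C\<^esub> \<chi> g)"
  proof (rule epic)
    fix P c assume Pc: "(P, c) \<in> J"
    note [simp] = J[OF Pc]
    have "\<chi> (g \<otimes>\<^bsub>G\<^esub> h) \<cdot>\<^bsub>C\<^esub> c
        = ArrMap (Act T (g \<otimes>\<^bsub>G\<^esub> h)) c \<cdot>\<^bsub>C\<^esub> (Coh T g h (fst P) \<cdot>\<^bsub>C\<^esub> (?\<rho> (snd P h) \<cdot>\<^bsub>C\<^esub> snd P g))"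
      using J\<chi>[OF Pc, of "g \<otimes>\<^bsub>G\<^esub> h"] eqv_Obj_cocycle[of P g h] by simp
    \<comment> \<open>Naturality of the coherence isomorphism at \<open>c\<close> exchanges the
      action of the product for the iterated action, where the condition for \<open>h\<close> and
      then the one for \<open>g\<close> can be used.\<close>
    also have "\<dots> = Coh T g h Q \<cdot>\<^bsub>C\<^esub> (?\<rho> (ArrMap (Act T h) c) \<cdot>\<^bsub>C\<^esub> (?\<rho> (snd P h) \<cdot>\<^bsub>C\<^esub> snd P g))"
      using Coh_natural_Comp[of g h c "?\<rho> (snd P h) \<cdot>\<^bsub>C\<^esub> snd P g"] by simp
    also have "?\<rho> (ArrMap (Act T h) c) \<cdot>\<^bsub>C\<^esub> (?\<rho> (snd P h) \<cdot>\<^bsub>C\<^esub> snd P g)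
        = ?\<rho> (\<chi> h) \<cdot>\<^bsub>C\<^esub> (?\<rho> c \<cdot>\<^bsub>C\<^esub> snd P g)"
      using act_eq[OF J\<chi>[OF Pc, of h], of g] by (intro Comp_reassoc) simp_all
    also have "?\<rho> c \<cdot>\<^bsub>C\<^esub> snd P g = \<chi> g \<cdot>\<^bsub>C\<^esub> c"
      using J\<chi>[OF Pc, of g] by simp
    finally show "\<chi> (g \<otimes>\<^bsub>G\<^esub> h) \<cdot>\<^bsub>C\<^esub> c = Coh T g h Q \<cdot>\<^bsub>C\<^esub> (?\<rho> (\<chi> h) \<cdot>\<^bsub>C\<^esub> \<chi> g) \<cdot>\<^bsub>C\<^esub> c"
      by simp
  qed simp_all
qed

text \<open>The counterpart for a subobject: the unit condition is checked after \<open>k\<close>,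
  and the cocycle identity after the image of \<open>k\<close> under the product of \<open>g\<close>
  and \<open>h\<close>, which is mono because equivalences preserve monos.\<close>

lemma eqv_Obj_if_mono:
  assumes P: "P \<in> Obj E" and k: "is_mono C k" "Cod C k = fst P" and ext: "\<chi> \<in> extensional (carrier G)"
    and \<chi>: "\<And>g. g \<in> carrier G \<Longrightarrow>
      \<chi> g \<in> Arr C \<and> Dom C (\<chi> g) = Dom C k \<and> Cod C (\<chi> g) = ObjMap (Act T g) (Dom C k)"
    and k\<chi>: "\<And>g. g \<in> carrier G \<Longrightarrow> snd P g \<cdot>\<^bsub>C\<^esub> k = ArrMap (Act T g) k \<cdot>\<^bsub>C\<^esub> \<chi> g"
  shows "(Dom C k, \<chi>) \<in> Obj E"
proof (rule eqv_ObjI[OF _ ext \<chi>])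
  note [simp] = P k(2) mono_Arr[OF k(1)] \<chi>
  show "Dom C k \<in> Obj C"
    by simp
  show "\<upsilon> (Dom C k) \<cdot>\<^bsub>C\<^esub> \<chi> \<one>\<^bsub>G\<^esub> = Ident C (Dom C k)"
  proof (rule mono_cancel[OF k(1)])
    have "k \<cdot>\<^bsub>C\<^esub> (\<upsilon> (Dom C k) \<cdot>\<^bsub>C\<^esub> \<chi> \<one>\<^bsub>G\<^esub>)
        = \<upsilon> (Cod C k) \<cdot>\<^bsub>C\<^esub> (ArrMap (Act T \<one>\<^bsub>G\<^esub>) k \<cdot>\<^bsub>C\<^esub> \<chi> \<one>\<^bsub>G\<^esub>)"
      by (rule Comp_reassoc[OF unit_natural[symmetric]]) simp_all
    also have "\<dots> = (\<upsilon> (fst P) \<cdot>\<^bsub>C\<^esub> snd P \<one>\<^bsub>G\<^esub>) \<cdot>\<^bsub>C\<^esub> k"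
      using k\<chi>[of "\<one>\<^bsub>G\<^esub>"] by simp
    finally show "k \<cdot>\<^bsub>C\<^esub> (\<upsilon> (Dom C k) \<cdot>\<^bsub>C\<^esub> \<chi> \<one>\<^bsub>G\<^esub>) = k \<cdot>\<^bsub>C\<^esub> Ident C (Dom C k)"
      unfolding eqv_Obj_unit[OF P] by simp
  qed simp_all
  fix g h assume [simp]: "g \<in> carrier G" "h \<in> carrier G"
  let ?\<rho> = "ArrMap (Act T g)"
  show "\<chi> (g \<otimes>\<^bsub>G\<^esub> h) = Coh T g h (Dom C k) \<cdot>\<^bsub>C\<^esub> (?\<rho> (\<chi> h) \<cdot>\<^bsub>C\<^esub> \<chi> g)"
  proof (rule mono_cancel[OF act_mono[OF _ k(1), of "g \<otimes>\<^bsub>G\<^esub> h"]])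
    have "ArrMap (Act T (g \<otimes>\<^bsub>G\<^esub> h)) k \<cdot>\<^bsub>C\<^esub> \<chi> (g \<otimes>\<^bsub>G\<^esub> h)
        = Coh T g h (fst P) \<cdot>\<^bsub>C\<^esub> (?\<rho> (snd P h) \<cdot>\<^bsub>C\<^esub> (snd P g \<cdot>\<^bsub>C\<^esub> k))"
      using k\<chi>[of "g \<otimes>\<^bsub>G\<^esub> h"] eqv_Obj_cocycle[of P g h] by simp
    also have "snd P g \<cdot>\<^bsub>C\<^esub> k = ?\<rho> k \<cdot>\<^bsub>C\<^esub> \<chi> g"
      by (rule k\<chi>) simp
    also have "?\<rho> (snd P h) \<cdot>\<^bsub>C\<^esub> (?\<rho> k \<cdot>\<^bsub>C\<^esub> \<chi> g)
        = ?\<rho> (ArrMap (Act T h) k) \<cdot>\<^bsub>C\<^esub> (?\<rho> (\<chi> h) \<cdot>\<^bsub>C\<^esub> \<chi> g)"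
      using act_eq[OF k\<chi>[of h], of g] by (intro Comp_reassoc) simp_all
    also have "Coh T g h (fst P) \<cdot>\<^bsub>C\<^esub> \<dots>
        = ArrMap (Act T (g \<otimes>\<^bsub>G\<^esub> h)) k \<cdot>\<^bsub>C\<^esub> (Coh T g h (Dom C k) \<cdot>\<^bsub>C\<^esub> (?\<rho> (\<chi> h) \<cdot>\<^bsub>C\<^esub> \<chi> g))"
      using Coh_natural_Comp[of g h k "?\<rho> (\<chi> h) \<cdot>\<^bsub>C\<^esub> \<chi> g"] by simp
    finally show "ArrMap (Act T (g \<otimes>\<^bsub>G\<^esub> h)) k \<cdot>\<^bsub>C\<^esub> \<chi> (g \<otimes>\<^bsub>G\<^esub> h)
        = ArrMap (Act T (g \<otimes>\<^bsub>G\<^esub> h)) k \<cdot>\<^bsub>C\<^esub> (Coh T g h (Dom C k) \<cdot>\<^bsub>C\<^esub> (?\<rho> (\<chi> h) \<cdot>\<^bsub>C\<^esub> \<chi> g))" .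
  qed simp_all
qed

text \<open>Equivariance of \<open>f\<close> shows that \<open>\<rho>\<^sub>g f\<close> kills the
  structure of the domain restricted along \<open>k\<close>. As \<open>\<rho>\<^sub>g k\<close> is a
  kernel of \<open>\<rho>\<^sub>g f\<close>, the restriction factors through it, and the factor is
  the structure on the kernel.\<close>

lemma eqv_kernel_lift:
  assumes f: "f \<in> Arr E" and k: "is_kernel C (und f) k"
  obtains P where "P \<in> Obj E" "fst P = Dom C k" "(P, Dom E f, k) \<in> Arr E"
proof -
  note [simp] = f kernelD[OF k]
  have "\<exists>u. u \<in> Arr C \<and> Dom C u = Dom C k \<and> Cod C u = ObjMap (Act T g) (Dom C k) \<and>
      ArrMap (Act T g) k \<cdot>\<^bsub>C\<^esub> u = snd (Dom E f) g \<cdot>\<^bsub>C\<^esub> k" if g [simp]: "g \<in> carrier G" for g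
  proof -
    have "ArrMap (Act T g) (und f) \<cdot>\<^bsub>C\<^esub> (snd (Dom E f) g \<cdot>\<^bsub>C\<^esub> k) = snd (Cod E f) g \<cdot>\<^bsub>C\<^esub> (und f \<cdot>\<^bsub>C\<^esub> k)"
      by (rule Comp_reassoc[OF eqv_Arr_eqv[symmetric]]) simp_all
    then show ?thesis
      using kernel_factor[OF act_kernel[OF g k], of "snd (Dom E f) g \<cdot>\<^bsub>C\<^esub> k"] by simp metis
  qed
  then obtain \<chi> where \<chi>: "\<And>g. g \<in> carrier G \<Longrightarrow> \<chi> g \<in> Arr C \<and> Dom C (\<chi> g) = Dom C k \<and>
      Cod C (\<chi> g) = ObjMap (Act T g) (Dom C k) \<and>
      ArrMap (Act T g) k \<cdot>\<^bsub>C\<^esub> \<chi> g = snd (Dom E f) g \<cdot>\<^bsub>C\<^esub> k"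
    by metis
  \<comment> \<open>Restriction makes the chosen family extensional, as equivariant objects
    require.\<close>
  have P: "(Dom C k, restrict \<chi> (carrier G)) \<in> Obj E"
    by (rule eqv_Obj_if_mono[OF _ kernel_mono[OF k], of "Dom E f"]) (use \<chi> in simp_all)
  show thesis
    by (rule that[OF P]) (use P \<chi> in \<open>simp_all add: eqv_ArrI\<close>)
qed

text \<open>The structure is obtained from the universal property of \<open>c\<close> itself: the
  structure of the codomain followed by \<open>\<rho>\<^sub>g c\<close> kills \<open>f\<close>,
  because \<open>\<rho>\<^sub>g\<close> preserves the relation \<open>c f = 0\<close>.\<close>

lemma eqv_cokernel_lift:
  assumes f: "f \<in> Arr E" and c: "is_cokernel C (und f) c"
  obtains Q where "Q \<in> Obj E" "fst Q = Cod C c" "(Cod E f, Q, c) \<in> Arr E"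
proof -
  note [simp] = f cokernelD[OF c]
  have "\<exists>u. u \<in> Arr C \<and> Dom C u = Cod C c \<and> Cod C u = ObjMap (Act T g) (Cod C c) \<and>
      u \<cdot>\<^bsub>C\<^esub> c = ArrMap (Act T g) c \<cdot>\<^bsub>C\<^esub> snd (Cod E f) g" if g [simp]: "g \<in> carrier G" for g
  proof -
    have "ArrMap (Act T g) c \<cdot>\<^bsub>C\<^esub> (snd (Cod E f) g \<cdot>\<^bsub>C\<^esub> und f)
        = (ArrMap (Act T g) c \<cdot>\<^bsub>C\<^esub> ArrMap (Act T g) (und f)) \<cdot>\<^bsub>C\<^esub> snd (Dom E f) g"
      by (simp add: eqv_Arr_eqv)
    also have "ArrMap (Act T g) c \<cdot>\<^bsub>C\<^esub> ArrMap (Act T g) (und f)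
        = ArrMap (Act T g) (Zero C (fst (Dom E f)) (Cod C c))"
      by (rule act_Comp) simp_all
    finally show ?thesis
      using cokernel_factor[OF c, of "ArrMap (Act T g) c \<cdot>\<^bsub>C\<^esub> snd (Cod E f) g"] by simp metis
  qed
  then obtain \<chi> where \<chi>: "\<And>g. g \<in> carrier G \<Longrightarrow> \<chi> g \<in> Arr C \<and> Dom C (\<chi> g) = Cod C c \<and>
      Cod C (\<chi> g) = ObjMap (Act T g) (Cod C c) \<and>
      \<chi> g \<cdot>\<^bsub>C\<^esub> c = ArrMap (Act T g) c \<cdot>\<^bsub>C\<^esub> snd (Cod E f) g"
    by metis
  have Q: "(Cod C c, restrict \<chi> (carrier G)) \<in> Obj E"
  proof (rule eqv_Obj_if_jointly_epic[where J = "{(Cod E f, c)}"])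
    fix a b
    assume "a \<in> Arr C" "b \<in> Arr C" "Dom C a = Cod C c" "Dom C b = Cod C c" "Cod C a = Cod C b"
      and "\<And>P c'. (P, c') \<in> {(Cod E f, c)} \<Longrightarrow> a \<cdot>\<^bsub>C\<^esub> c' = b \<cdot>\<^bsub>C\<^esub> c'"
    then show "a = b"
      by (intro epi_cancel[OF cokernel_epi[OF c], of a b]) simp_all
  qed (use \<chi> in simp_all)
  show thesis
    by (rule that[OF Q]) (use Q \<chi> in \<open>simp_all add: eqv_ArrI\<close>)
qed

text \<open>The point is that the factorisation \<open>u\<close> found below is equivariant. This is
  tested after the mono \<open>\<rho>\<^sub>g k\<close>, where it follows from equivariance of
  \<open>k\<close> and \<open>h\<close>.\<close>

lemma eqv_kernelI:
  assumes f: "f \<in> Arr E" and k: "k \<in> Arr E" "Cod E k = Dom E f" and ker: "is_kernel C (und f) (und k)"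
  shows "is_kernel E f k"
proof (rule eqv.kernelI)
  note [simp] = f k
  show "is_mono E k"
    by (rule eqv_mono_if_mono[OF k(1) kernel_mono[OF ker]])
  show "f \<cdot>\<^bsub>E\<^esub> k = Zero E (Dom E k) (Cod E f)"
    using kernelD[OF ker] by simp
  fix h
  assume h [simp]: "h \<in> Arr E" "Cod E h = Dom E f" and "f \<cdot>\<^bsub>E\<^esub> h = Zero E (Dom E h) (Cod E f)"
  then have fh: "und f \<cdot>\<^bsub>C\<^esub> und h = Zero C (fst (Dom E h)) (fst (Cod E f))"
    by simp
  obtain u where u [simp]: "u \<in> Arr C" "Dom C u = fst (Dom E h)" "Cod C u = fst (Dom E k)"
    and ku: "und k \<cdot>\<^bsub>C\<^esub> u = und h"
    by (rule kernel_factor[OF ker, of "und h"]) (use fh in simp_all)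
  have u': "(Dom E h, Dom E k, u) \<in> Arr E"
  proof (rule eqv_ArrI)
    fix g assume g [simp]: "g \<in> carrier G"
    let ?\<rho> = "ArrMap (Act T g)"
    show "snd (Dom E k) g \<cdot>\<^bsub>C\<^esub> u = ?\<rho> u \<cdot>\<^bsub>C\<^esub> snd (Dom E h) g"
    proof (rule mono_cancel[OF act_mono[OF g kernel_mono[OF ker]]])
      have "?\<rho> (und k) \<cdot>\<^bsub>C\<^esub> (snd (Dom E k) g \<cdot>\<^bsub>C\<^esub> u) = snd (Cod E k) g \<cdot>\<^bsub>C\<^esub> (und k \<cdot>\<^bsub>C\<^esub> u)"
        by (rule Comp_reassoc[OF eqv_Arr_eqv[symmetric]]) simp_all
      also have "\<dots> = ?\<rho> (und h) \<cdot>\<^bsub>C\<^esub> snd (Dom E h) g"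
        unfolding ku using eqv_Arr_eqv[of h g] by simp
      also have "?\<rho> (und h) = ?\<rho> (und k) \<cdot>\<^bsub>C\<^esub> ?\<rho> u"
        using act_Comp[OF ku g] by simp
      finally show "?\<rho> (und k) \<cdot>\<^bsub>C\<^esub> (snd (Dom E k) g \<cdot>\<^bsub>C\<^esub> u) = ?\<rho> (und k) \<cdot>\<^bsub>C\<^esub> (?\<rho> u \<cdot>\<^bsub>C\<^esub> snd (Dom E h) g)"
        by simp
    qed simp_all
  qed simp_all
  have "k \<cdot>\<^bsub>E\<^esub> (Dom E h, Dom E k, u) = h"
    by (rule eqv_Arr_eqI) (simp_all add: ku)
  then show "\<exists>u\<in>Hom E (Dom E h) (Dom E k). k \<cdot>\<^bsub>E\<^esub> u = h"
    using u' by (intro bexI[of _ "(Dom E h, Dom E k, u)"]) (simp_all add: Hom_def)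
qed (use f k in simp_all)

text \<open>Equivariance of the factorisation \<open>u\<close> is tested before composing with the
  epi \<open>c\<close>, where it follows from equivariance of \<open>c\<close> and
  \<open>h\<close>.\<close>

lemma eqv_cokernelI:
  assumes f: "f \<in> Arr E" and c: "c \<in> Arr E" "Dom E c = Cod E f"
    and cok: "is_cokernel C (und f) (und c)"
  shows "is_cokernel E f c"
proof (rule eqv.cokernelI)
  note [simp] = f c
  show "is_epi E c"
    by (rule eqv_epi_if_epi[OF c(1) cokernel_epi[OF cok]])
  show "c \<cdot>\<^bsub>E\<^esub> f = Zero E (Dom E f) (Cod E c)"
    using cokernelD[OF cok] by simp
  fix h
  assume h [simp]: "h \<in> Arr E" "Dom E h = Cod E f" and "h \<cdot>\<^bsub>E\<^esub> f = Zero E (Dom E f) (Cod E h)"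
  then have hf: "und h \<cdot>\<^bsub>C\<^esub> und f = Zero C (fst (Dom E f)) (fst (Cod E h))"
    by simp
  obtain u where u [simp]: "u \<in> Arr C" "Dom C u = fst (Cod E c)" "Cod C u = fst (Cod E h)"
    and uc: "u \<cdot>\<^bsub>C\<^esub> und c = und h"
    by (rule cokernel_factor[OF cok, of "und h"]) (use hf in simp_all)
  have u': "(Cod E c, Cod E h, u) \<in> Arr E"
  proof (rule eqv_ArrI)
    fix g assume g [simp]: "g \<in> carrier G"
    let ?\<rho> = "ArrMap (Act T g)"
    show "snd (Cod E h) g \<cdot>\<^bsub>C\<^esub> u = ?\<rho> u \<cdot>\<^bsub>C\<^esub> snd (Cod E c) g"
    proof (rule epi_cancel[OF cokernel_epi[OF cok]])
      have "(snd (Cod E h) g \<cdot>\<^bsub>C\<^esub> u) \<cdot>\<^bsub>C\<^esub> und c = ?\<rho> (und h) \<cdot>\<^bsub>C\<^esub> snd (Cod E f) g"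
        using eqv_Arr_eqv[of h g] uc by simp
      also have "?\<rho> (und h) = ?\<rho> u \<cdot>\<^bsub>C\<^esub> ?\<rho> (und c)"
        using act_Comp[OF uc g] by simp
      also have "\<dots> \<cdot>\<^bsub>C\<^esub> snd (Cod E f) g = (?\<rho> u \<cdot>\<^bsub>C\<^esub> snd (Cod E c) g) \<cdot>\<^bsub>C\<^esub> und c"
        using eqv_Arr_eqv[of c g] by simp
      finally show "(snd (Cod E h) g \<cdot>\<^bsub>C\<^esub> u) \<cdot>\<^bsub>C\<^esub> und c = (?\<rho> u \<cdot>\<^bsub>C\<^esub> snd (Cod E c) g) \<cdot>\<^bsub>C\<^esub> und c" .
    qed simp_all
  qed simp_all
  have "(Cod E c, Cod E h, u) \<cdot>\<^bsub>E\<^esub> c = h"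
    by (rule eqv_Arr_eqI) (simp_all add: uc)
  then show "\<exists>u\<in>Hom E (Cod E c) (Cod E h). u \<cdot>\<^bsub>E\<^esub> c = h"
    using u' by (intro bexI[of _ "(Cod E c, Cod E h, u)"]) (simp_all add: Hom_def)
qed (use f c in simp_all)

lemma eqv_zero_object: "\<exists>Z. is_zero_object E Z"
proof -
  obtain Z where Z: "is_zero_object C Z"
    using ex_zero_object by blast
  have [simp]: "Z \<in> Obj C"
    using Z by (simp add: is_zero_object_def)
  have from_unique: "f = f'" if "f \<in> Arr C" "f' \<in> Arr C" "Dom C f = Z" "Dom C f' = Z" "Cod C f = Cod C f'"
    for f f'
    using Z that Cod_in_Obj[of f'] unfolding is_zero_object_def Hom_def by blast
  have to_unique: "f = f'" if "f \<in> Arr C" "f' \<in> Arr C" "Cod C f = Z" "Cod C f' = Z" "Dom C f = Dom C f'"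
    for f f'
    using Z that Dom_in_Obj[of f'] unfolding is_zero_object_def Hom_def by blast
  define P where "P = (Z, \<lambda>g \<in> carrier G. Zero C Z (ObjMap (Act T g) Z))"
  have P [simp]: "P \<in> Obj E" "fst P = Z"
    \<comment> \<open>For the empty family, joint epicity says that parallel arrows out of
      \<open>Z\<close> coincide.\<close>
    unfolding P_def by (rule eqv_Obj_if_jointly_epic[where J = "{}"]) (auto intro: from_unique)
  have "\<exists>!f. f \<in> Hom E Q P" if Q [simp]: "Q \<in> Obj E" for Q
  proof (rule ex1I)
    show "(Q, P, Zero C (fst Q) (fst P)) \<in> Hom E Q P"
      using eqv_Zero[of Q P] by (simp add: Hom_def)
    show "f = (Q, P, Zero C (fst Q) (fst P))" if "f \<in> Hom E Q P" for f
      using that by (intro eqv_Arr_eqI to_unique) (simp_all add: Hom_def)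
  qed
  moreover have "\<exists>!f. f \<in> Hom E P Q" if Q [simp]: "Q \<in> Obj E" for Q
  proof (rule ex1I)
    show "(P, Q, Zero C (fst P) (fst Q)) \<in> Hom E P Q"
      using eqv_Zero[of P Q] by (simp add: Hom_def)
    show "f = (P, Q, Zero C (fst P) (fst Q))" if "f \<in> Hom E P Q" for f
      using that by (intro eqv_Arr_eqI from_unique) (simp_all add: Hom_def)
  qed
  ultimately show ?thesis
    unfolding is_zero_object_def using P(1) by blast
qed

lemma eqv_biproduct:
  assumes X [simp]: "X \<in> Obj E" and Y [simp]: "Y \<in> Obj E"
  shows "\<exists>P j1 j2 p1 p2. is_biproduct E X Y P j1 j2 p1 p2"
proof -
  obtain S j1 j2 p1 p2 where bp: "is_biproduct C (fst X) (fst Y) S j1 j2 p1 p2"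
    using ex_biproduct[of "fst X" "fst Y"] by auto
  have S [simp]: "S \<in> Obj C"
    and [simp]: "j1 \<in> Arr C" "Dom C j1 = fst X" "Cod C j1 = S" "j2 \<in> Arr C" "Dom C j2 = fst Y"
    "Cod C j2 = S" "p1 \<in> Arr C" "Dom C p1 = S" "Cod C p1 = fst X" "p2 \<in> Arr C" "Dom C p2 = S"
    "Cod C p2 = fst Y"
    and [simp]: "p1 \<cdot>\<^bsub>C\<^esub> j1 = Ident C (fst X)" "p2 \<cdot>\<^bsub>C\<^esub> j2 = Ident C (fst Y)"
    "p1 \<cdot>\<^bsub>C\<^esub> j2 = Zero C (fst Y) (fst X)" "p2 \<cdot>\<^bsub>C\<^esub> j1 = Zero C (fst X) (fst Y)"
    and sum: "Add C (j1 \<cdot>\<^bsub>C\<^esub> p1) (j2 \<cdot>\<^bsub>C\<^esub> p2) = Ident C S"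
    using bp by (auto simp: is_biproduct_def Hom_def)
  \<comment> \<open>The diagonal structure, forced by the requirement that both coprojections be
    equivariant.\<close>
  define \<chi> where "\<chi> = (\<lambda>g \<in> carrier G. Add C (ArrMap (Act T g) j1 \<cdot>\<^bsub>C\<^esub> (snd X g \<cdot>\<^bsub>C\<^esub> p1))
      (ArrMap (Act T g) j2 \<cdot>\<^bsub>C\<^esub> (snd Y g \<cdot>\<^bsub>C\<^esub> p2)))"
  have [simp]: "\<chi> g \<in> Arr C" "Dom C (\<chi> g) = S" "Cod C (\<chi> g) = ObjMap (Act T g) S"
    if "g \<in> carrier G" for g
    using that by (simp_all add: \<chi>_def)
  have \<chi>j [simp]: "\<chi> g \<cdot>\<^bsub>C\<^esub> j1 = ArrMap (Act T g) j1 \<cdot>\<^bsub>C\<^esub> snd X g"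
    "\<chi> g \<cdot>\<^bsub>C\<^esub> j2 = ArrMap (Act T g) j2 \<cdot>\<^bsub>C\<^esub> snd Y g" if "g \<in> carrier G" for g
    using that by (simp_all add: \<chi>_def Add_Zero)
  define P where "P = (S, \<chi>)"
  have P [simp]: "P \<in> Obj E"
    unfolding P_def
  proof (rule eqv_Obj_if_jointly_epic[where J = "{(X, j1), (Y, j2)}"])
    show "\<chi> \<in> extensional (carrier G)"
      by (simp add: \<chi>_def)
    fix a b
    assume ab: "a \<in> Arr C" "b \<in> Arr C" "Dom C a = S" "Dom C b = S" "Cod C a = Cod C b"
      and eq: "\<And>Q c. (Q, c) \<in> {(X, j1), (Y, j2)} \<Longrightarrow> a \<cdot>\<^bsub>C\<^esub> c = b \<cdot>\<^bsub>C\<^esub> c"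
    show "a = b"
      by (rule biproduct_epic[OF bp ab eq[of X] eq[of Y]]) simp_all
  next
    fix Q c assume "(Q, c) \<in> {(X, j1), (Y, j2)}"
    then show "Q \<in> Obj E \<and> c \<in> Arr C \<and> Dom C c = fst Q \<and> Cod C c = S"
      by (simp; elim disjE; simp)
  next
    fix Q c g assume "(Q, c) \<in> {(X, j1), (Y, j2)}" "g \<in> carrier G"
    then show "\<chi> g \<cdot>\<^bsub>C\<^esub> c = ArrMap (Act T g) c \<cdot>\<^bsub>C\<^esub> snd Q g"
      by (simp; elim disjE; simp)
  qed simp_all
  have [simp]: "fst P = S" "snd P = \<chi>"
    by (simp_all add: P_def)
  have j: "(X, P, j1) \<in> Arr E" "(Y, P, j2) \<in> Arr E"
    by (rule eqv_ArrI; simp)+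
  have p: "(P, X, p1) \<in> Arr E" "(P, Y, p2) \<in> Arr E"
  proof -
    have "snd X g \<cdot>\<^bsub>C\<^esub> p1 = ArrMap (Act T g) p1 \<cdot>\<^bsub>C\<^esub> \<chi> g"
      "snd Y g \<cdot>\<^bsub>C\<^esub> p2 = ArrMap (Act T g) p2 \<cdot>\<^bsub>C\<^esub> \<chi> g" if g [simp]: "g \<in> carrier G" for g
    proof -
      let ?\<rho> = "ArrMap (Act T g)"
      \<comment> \<open>The four rewrite rules are the images under \<open>\<rho>\<^sub>g\<close> of
        the relations between projections and coprojections, applied at the head of a composite.
        They reduce the claim to a product of a diagonal matrix with a projection.\<close>
      have [simp]: "?\<rho> p1 \<cdot>\<^bsub>C\<^esub> (?\<rho> j1 \<cdot>\<^bsub>C\<^esub> x) = x" if "x \<in> Arr C" "Cod C x = ObjMap (Act T g) (fst X)" for x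
        using Comp_assoc'[of x "?\<rho> j1" "?\<rho> p1"] act_Comp[of p1 j1 "Ident C (fst X)" g] that by simp
      have [simp]: "?\<rho> p2 \<cdot>\<^bsub>C\<^esub> (?\<rho> j2 \<cdot>\<^bsub>C\<^esub> x) = x" if "x \<in> Arr C" "Cod C x = ObjMap (Act T g) (fst Y)" for x
        using Comp_assoc'[of x "?\<rho> j2" "?\<rho> p2"] act_Comp[of p2 j2 "Ident C (fst Y)" g] that by simp
      have [simp]: "?\<rho> p1 \<cdot>\<^bsub>C\<^esub> (?\<rho> j2 \<cdot>\<^bsub>C\<^esub> x) = Zero C (Dom C x) (ObjMap (Act T g) (fst X))"
        if "x \<in> Arr C" "Cod C x = ObjMap (Act T g) (fst Y)" for x
        using Comp_assoc'[of x "?\<rho> j2" "?\<rho> p1"] act_Comp[of p1 j2 "Zero C (fst Y) (fst X)" g] that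
        by simp
      have [simp]: "?\<rho> p2 \<cdot>\<^bsub>C\<^esub> (?\<rho> j1 \<cdot>\<^bsub>C\<^esub> x) = Zero C (Dom C x) (ObjMap (Act T g) (fst Y))"
        if "x \<in> Arr C" "Cod C x = ObjMap (Act T g) (fst X)" for x
        using Comp_assoc'[of x "?\<rho> j1" "?\<rho> p2"] act_Comp[of p2 j1 "Zero C (fst X) (fst Y)" g] that
        by simp
      show "snd X g \<cdot>\<^bsub>C\<^esub> p1 = ?\<rho> p1 \<cdot>\<^bsub>C\<^esub> \<chi> g" "snd Y g \<cdot>\<^bsub>C\<^esub> p2 = ?\<rho> p2 \<cdot>\<^bsub>C\<^esub> \<chi> g"
        by (simp_all add: \<chi>_def Add_Zero)
    qed
    then show "(P, X, p1) \<in> Arr E" "(P, Y, p2) \<in> Arr E"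
      by (auto intro!: eqv_ArrI)
  qed
  have "is_biproduct E X Y P (X, P, j1) (Y, P, j2) (P, X, p1) (P, Y, p2)"
    using j p sum by (simp add: is_biproduct_def Hom_def)
  then show ?thesis
    by blast
qed

lemma eqv_additive: "additive_category E"
  using eqv_zero_object eqv_biproduct
  by (intro additive_category.intro eqv_preadditive additive_category_axioms.intro)

end

section \<open>The forgetful functor reflects and preserves enough to make the equivariant category
  abelian\<close>

lemma forget_maps [simp]: "ObjMap forget P = fst P" "ArrMap forget a = snd (snd a)"
  by (auto simp: forget_def split: prod.splits)

lemma (in cat_action) forget_functor: "is_functor E C forget"
  by (rule is_functorI) (simp_all add: eqv_category category_axioms Hom_def)

locale abelian_action = cat_action G C T + abelian_category C
  for G :: "('g, 'y) monoid_scheme" and C :: "('o, 'm, 'z) addcat_scheme"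
    and T :: "('g, 'o, 'm) action"
begin

text \<open>A kernel taken in \<open>C\<close> lifts to a kernel of \<open>f\<close> in the
  equivariant category. The given \<open>k\<close> differs from the lift by an isomorphism, whose
  underlying arrow is again invertible.\<close>

lemma eqv_kernelD:
  assumes "is_kernel E f k"
  shows "is_kernel C (und f) (und k)"
proof -
  note [simp] = eqv.kernelD[OF assms]
  obtain k' where k': "is_kernel C (und f) k'"
    using ex_kernel[of "und f"] by auto
  then obtain P where P: "P \<in> Obj E" "fst P = Dom C k'" "(P, Dom E f, k') \<in> Arr E"
    using eqv_kernel_lift[of f k'] by auto
  have "is_kernel E f (P, Dom E f, k')"
    by (rule eqv_kernelI) (use P k' in simp_all)
  then obtain v where v: "is_iso E v" "v \<in> Arr E" "Dom E v = Dom E k" "Cod E v = P"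
    "(P, Dom E f, k') \<cdot>\<^bsub>E\<^esub> v = k"
    by (rule eqv.kernel_unique[OF _ assms]) simp
  have "is_kernel C (und f) (k' \<cdot>\<^bsub>C\<^esub> und v)"
    using functor_iso[OF forget_functor v(1)] v P by (intro kernel_Comp_iso[OF k']) simp_all
  then show ?thesis
    using v(5) by auto
qed

lemma eqv_cokernelD:
  assumes "is_cokernel E f c"
  shows "is_cokernel C (und f) (und c)"
proof -
  note [simp] = eqv.cokernelD[OF assms]
  obtain c' where c': "is_cokernel C (und f) c'"
    using ex_cokernel[of "und f"] by auto
  then obtain Q where Q: "Q \<in> Obj E" "fst Q = Cod C c'" "(Cod E f, Q, c') \<in> Arr E"
    using eqv_cokernel_lift[of f c'] by auto
  have "is_cokernel E f (Cod E f, Q, c')"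
    by (rule eqv_cokernelI) (use Q c' in simp_all)
  then obtain v where v: "is_iso E v" "v \<in> Arr E" "Dom E v = Q" "Cod E v = Cod E c"
    "v \<cdot>\<^bsub>E\<^esub> (Cod E f, Q, c') = c"
    by (rule eqv.cokernel_unique[OF _ assms]) simp
  have "is_cokernel C (und f) (und v \<cdot>\<^bsub>C\<^esub> c')"
    using functor_iso[OF forget_functor v(1)] v Q by (intro cokernel_Comp_iso[OF c']) simp_all
  then show ?thesis
    using v(5) by auto
qed

lemma eqv_ex_kernel:
  assumes f: "f \<in> Arr E"
  shows "\<exists>k. is_kernel E f k"
proof -
  obtain k where k: "is_kernel C (und f) k"
    using ex_kernel[of "und f"] f by auto
  then obtain P where P: "P \<in> Obj E" "fst P = Dom C k" "(P, Dom E f, k) \<in> Arr E"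
    using eqv_kernel_lift[OF f] by auto
  have "is_kernel E f (P, Dom E f, k)"
    by (rule eqv_kernelI) (use f P k in simp_all)
  then show ?thesis ..
qed

lemma eqv_ex_cokernel:
  assumes f: "f \<in> Arr E"
  shows "\<exists>c. is_cokernel E f c"
proof -
  obtain c where c: "is_cokernel C (und f) c"
    using ex_cokernel[of "und f"] f by auto
  then obtain Q where Q: "Q \<in> Obj E" "fst Q = Cod C c" "(Cod E f, Q, c) \<in> Arr E"
    using eqv_cokernel_lift[OF f] by auto
  have "is_cokernel E f (Cod E f, Q, c)"
    by (rule eqv_cokernelI) (use f Q c in simp_all)
  then show ?thesis ..
qed

text \<open>Cancelling \<open>m\<close> in \<open>m k = m 0\<close> shows that its equivariant
  kernel \<open>k\<close> vanishes. The underlying arrow of \<open>k\<close> is a kernel of the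
  underlying arrow of \<open>m\<close>, and a zero kernel implies monicity.\<close>

lemma eqv_monoD:
  assumes m: "is_mono E m"
  shows "is_mono C (und m)"
proof -
  have [simp]: "m \<in> Arr E" by (rule eqv.mono_Arr[OF m])
  obtain k where k: "is_kernel E m k"
    using eqv_ex_kernel[of m] by auto
  note kD [simp] = eqv.kernelD[OF k]
  have "k = Zero E (Dom E k) (Cod E k)"
    by (rule eqv.mono_cancel[OF m]) (use kD eqv.Comp_Zero(1)[of m "Dom E k" "Dom E m"] eqv_Zero in simp_all)
  then have "und k = und (Zero E (Dom E k) (Cod E k))"
    by simp
  then show ?thesis
    by (intro mono_if_trivial_kernel[OF _ eqv_kernelD[OF k]]) simp_all
qed

lemma eqv_epiD:
  assumes p: "is_epi E p"
  shows "is_epi C (und p)"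
proof -
  have [simp]: "p \<in> Arr E" by (rule eqv.epi_Arr[OF p])
  obtain c where c: "is_cokernel E p c"
    using eqv_ex_cokernel[of p] by auto
  note cD [simp] = eqv.cokernelD[OF c]
  have "c = Zero E (Dom E c) (Cod E c)"
    by (rule eqv.epi_cancel[OF p]) (use cD eqv.Comp_Zero(2)[of p "Cod E c" "Cod E p"] eqv_Zero in simp_all)
  then have "und c = und (Zero E (Dom E c) (Cod E c))"
    by simp
  then show ?thesis
    by (intro epi_if_trivial_cokernel[OF _ eqv_cokernelD[OF c]]) simp_all
qed

text \<open>If \<open>m\<close> is a kernel of \<open>f\<close>, then \<open>f\<close> factors
  through \<open>c\<close>, so whatever \<open>c\<close> kills is killed by \<open>f\<close>. The
  arrow \<open>f\<close> supplied by the axiom need not be equivariant, whereas a cokernel can be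
  taken equivariant; hence this sharper form.\<close>

lemma mono_is_kernel_of_cokernel:
  assumes m: "is_mono C m" and c: "is_cokernel C m c"
  shows "is_kernel C c m"
proof -
  obtain f where f: "is_kernel C f m"
    using mono_is_kernel[OF m] by blast
  note [simp] = kernelD[OF f] cokernelD[OF c]
  show ?thesis
  proof (rule kernelI[OF _ m])
    fix h assume h: "h \<in> Arr C" "Cod C h = Dom C c" "c \<cdot>\<^bsub>C\<^esub> h = Zero C (Dom C h) (Cod C c)"
    obtain w where w: "w \<in> Arr C" "Dom C w = Cod C c" "Cod C w = Cod C f" "w \<cdot>\<^bsub>C\<^esub> c = f"
      by (rule cokernel_factor[OF c, of f]) simp_all
    have "w \<cdot>\<^bsub>C\<^esub> (c \<cdot>\<^bsub>C\<^esub> h) = (w \<cdot>\<^bsub>C\<^esub> c) \<cdot>\<^bsub>C\<^esub> h"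
      by (rule Comp_assoc'[symmetric]) (use h w(1-3) in simp_all)
    then have "f \<cdot>\<^bsub>C\<^esub> h = Zero C (Dom C h) (Cod C f)"
      unfolding w(4) h(3) using h w(1-3) by simp
    then show "\<exists>u\<in>Hom C (Dom C h) (Dom C m). m \<cdot>\<^bsub>C\<^esub> u = h"
      using kernel_factor[OF f h(1)] h(2) by (auto simp: Hom_def)
  qed simp_all
qed

text \<open>If \<open>p\<close> is a cokernel of \<open>f\<close>, then \<open>f\<close> factors
  through \<open>k\<close>, so an arrow killing \<open>k\<close> also kills
  \<open>f\<close>.\<close>

lemma epi_is_cokernel_of_kernel:
  assumes p: "is_epi C p" and k: "is_kernel C p k"
  shows "is_cokernel C k p"
proof -
  obtain f where f: "is_cokernel C f p"
    using epi_is_cokernel[OF p] by blast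
  note [simp] = cokernelD[OF f] kernelD[OF k]
  show ?thesis
  proof (rule cokernelI[OF _ p])
    fix h assume h: "h \<in> Arr C" "Dom C h = Cod C k" "h \<cdot>\<^bsub>C\<^esub> k = Zero C (Dom C k) (Cod C h)"
    obtain w where w: "w \<in> Arr C" "Dom C w = Dom C f" "Cod C w = Dom C k" "k \<cdot>\<^bsub>C\<^esub> w = f"
      by (rule kernel_factor[OF k, of f]) simp_all
    have "(h \<cdot>\<^bsub>C\<^esub> k) \<cdot>\<^bsub>C\<^esub> w = h \<cdot>\<^bsub>C\<^esub> (k \<cdot>\<^bsub>C\<^esub> w)"
      by (rule Comp_assoc') (use h w(1-3) in simp_all)
    then have "h \<cdot>\<^bsub>C\<^esub> f = Zero C (Dom C f) (Cod C h)"
      unfolding w(4) h(3) using h w(1-3) by simp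
    then show "\<exists>u\<in>Hom C (Cod C p) (Cod C h). u \<cdot>\<^bsub>C\<^esub> p = h"
      using cokernel_factor[OF f h(1)] h(2) by (auto simp: Hom_def)
  qed simp_all
qed

lemma eqv_abelian: "abelian_category E"
proof (intro abelian_category.intro eqv_additive abelian_category_axioms.intro)
  fix m assume m: "is_mono E m"
  have [simp]: "m \<in> Arr E" by (rule eqv.mono_Arr[OF m])
  obtain c where c: "is_cokernel E m c"
    using eqv_ex_cokernel[of m] by auto
  have "is_kernel E c m"
    by (rule eqv_kernelI)
      (use eqv.cokernelD[OF c] mono_is_kernel_of_cokernel[OF eqv_monoD[OF m] eqv_cokernelD[OF c]] in simp_all)
  then show "\<exists>f. is_kernel E f m" ..
next
  fix p assume p: "is_epi E p"
  have [simp]: "p \<in> Arr E" by (rule eqv.epi_Arr[OF p])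
  obtain k where k: "is_kernel E p k"
    using eqv_ex_kernel[of p] by auto
  have "is_cokernel E k p"
    by (rule eqv_cokernelI)
      (use eqv.kernelD[OF k] epi_is_cokernel_of_kernel[OF eqv_epiD[OF p] eqv_kernelD[OF k]] in simp_all)
  then show "\<exists>f. is_cokernel E f p" ..
qed (use eqv_ex_kernel eqv_ex_cokernel in blast)+

end

section \<open>Functors compatible with group actions\<close>

locale two_actions = C: cat_action G C T + D: cat_action G D U
  for G :: "('g, 'y) monoid_scheme" and C :: "('o1, 'm1, 'z1) addcat_scheme"
    and D :: "('o2, 'm2, 'z2) addcat_scheme" and T :: "('g, 'o1, 'm1) action"
    and U :: "('g, 'o2, 'm2) action"
begin

text \<open>Invertibility of \<open>\<sigma>\<close> comes for free, by the argument used for cocycles; only naturality gives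
  the mono part, since \<open>\<sigma> h\<close> is split mono a priori at objects \<open>\<rho>\<^sub>g Y\<close> only.\<close>

lemma is_gfunctorI:
  assumes H: "is_functor C D H"
    and nat: "\<And>g. g \<in> carrier G \<Longrightarrow> nat_trans C D (H \<circ>\<^sub>F Act T g) (Act U g \<circ>\<^sub>F H) (\<sigma> g)"
    and mult: "\<And>g h X. \<lbrakk>g \<in> carrier G; h \<in> carrier G; X \<in> Obj C\<rbrakk>
      \<Longrightarrow> \<sigma> (g \<otimes>\<^bsub>G\<^esub> h) X \<cdot>\<^bsub>D\<^esub> ArrMap H (Coh T g h X) = Coh U g h (ObjMap H X)
        \<cdot>\<^bsub>D\<^esub> (ArrMap (Act U g) (\<sigma> h X) \<cdot>\<^bsub>D\<^esub> \<sigma> g (ObjMap (Act T h) X))"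
    and unit: "\<And>X. X \<in> Obj C
      \<Longrightarrow> D.unit (ObjMap H X) \<cdot>\<^bsub>D\<^esub> \<sigma> \<one>\<^bsub>G\<^esub> X = ArrMap H (C.unit X)"
  shows "is_gfunctor G C D T U (H, \<sigma>)"
proof -
  note [simp] = functor_simps[OF H] functor_iso[OF H]
  have \<sigma> [simp]: "\<sigma> g X \<in> Arr D" "Dom D (\<sigma> g X) = ObjMap H (ObjMap (Act T g) X)"
    "Cod D (\<sigma> g X) = ObjMap (Act U g) (ObjMap H X)" if "g \<in> carrier G" "X \<in> Obj C" for g X
    using nat_trans_simps(1-3)[OF nat[OF that(1)] that(2)] by simp_all
  have one: "is_iso D (\<sigma> \<one>\<^bsub>G\<^esub> X)" if [simp]: "X \<in> Obj C" for X
    by (rule D.iso_right_factor[where g = "D.unit (ObjMap H X)"]) (simp_all add: unit)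
  \<comment> \<open>For a pair with product 1, multiplicativity equates a composite of isomorphisms
    with a coherence isomorphism times this arrow.\<close>
  have *: "is_iso D (ArrMap (Act U g) (\<sigma> h X) \<cdot>\<^bsub>D\<^esub> \<sigma> g (ObjMap (Act T h) X))"
    if [simp]: "g \<in> carrier G" "h \<in> carrier G" "X \<in> Obj C" and gh: "g \<otimes>\<^bsub>G\<^esub> h = \<one>\<^bsub>G\<^esub>" for g h X
  proof (rule D.iso_right_factor[where g = "Coh U g h (ObjMap H X)"])
    have "is_iso D (\<sigma> (g \<otimes>\<^bsub>G\<^esub> h) X \<cdot>\<^bsub>D\<^esub> ArrMap H (Coh T g h X))"
      by (rule D.iso_Comp) (simp_all add: gh one C.Coh_simps(3)[of g h X, unfolded gh])
    then show "is_iso D (Coh U g h (ObjMap H X) \<cdot>\<^bsub>D\<^esub>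
        (ArrMap (Act U g) (\<sigma> h X) \<cdot>\<^bsub>D\<^esub> \<sigma> g (ObjMap (Act T h) X)))"
      by (simp add: mult)
  qed simp_all
  have iso: "is_iso D (\<sigma> h X)" if h [simp]: "h \<in> carrier G" and X [simp]: "X \<in> Obj C" for h X
  proof -
    define g where "g = inv\<^bsub>G\<^esub> h"
    have g [simp]: "g \<in> carrier G" and gh: "g \<otimes>\<^bsub>G\<^esub> h = \<one>\<^bsub>G\<^esub>" "h \<otimes>\<^bsub>G\<^esub> g = \<one>\<^bsub>G\<^esub>"
      by (simp_all add: g_def)
    obtain b where b: "b \<in> Arr D" "Dom D b = ObjMap (Act U g) (ObjMap (Act U h) (ObjMap H X))"
      "Cod D b = ObjMap (Act U g) (ObjMap H (ObjMap (Act T h) X))"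
      "ArrMap (Act U g) (\<sigma> h X) \<cdot>\<^bsub>D\<^esub> b = Ident D (ObjMap (Act U g) (ObjMap (Act U h) (ObjMap H X)))"
      by (rule D.iso_Comp_splits[OF *[OF g h X gh(1)]]) simp_all
    obtain Y v where v [simp]: "Y \<in> Obj C" "v \<in> Arr C" "Dom C v = ObjMap (Act T g) Y" "Cod C v = X"
      and v_iso: "is_iso C v"
      by (rule equivalence_ess_surj[OF C.act_equivalence[OF g] X])
    have v_iso' [simp]: "is_iso D (ArrMap H (ArrMap (Act T h) v))"
      "is_iso D (ArrMap (Act U h) (ArrMap H v))"
      using v_iso by (simp_all add: C.act_iso D.act_iso)
    obtain a where a: "a \<in> Arr D" "Dom D a = ObjMap (Act U h) (ObjMap H (ObjMap (Act T g) Y))"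
      "Cod D a = ObjMap H (ObjMap (Act T h) (ObjMap (Act T g) Y))"
      "a \<cdot>\<^bsub>D\<^esub> \<sigma> h (ObjMap (Act T g) Y) = Ident D (ObjMap H (ObjMap (Act T h) (ObjMap (Act T g) Y)))"
      by (rule D.iso_Comp_splits[OF *[OF h g v(1) gh(2)]]) simp_all
    have "is_mono D (\<sigma> h (ObjMap (Act T g) Y))"
      by (rule D.split_mono[where g = a]) (use a in simp_all)
    then have "is_mono D (ArrMap (Act U h) (ArrMap H v) \<cdot>\<^bsub>D\<^esub> \<sigma> h (ObjMap (Act T g) Y))"
      by (rule D.mono_Comp) (simp_all add: D.iso_mono)
    then have "is_mono D (\<sigma> h X \<cdot>\<^bsub>D\<^esub> ArrMap H (ArrMap (Act T h) v))"
      using nat_trans_simps(4)[OF nat[OF h] v(2) v(4)[symmetric]] by simp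
    then have "is_mono D (\<sigma> h X)"
      by (rule D.mono_if_Comp_iso) simp_all
    then have "is_mono D (ArrMap (Act U g) (\<sigma> h X))"
      by (rule D.act_mono[OF g])
    then have "is_iso D (ArrMap (Act U g) (\<sigma> h X))"
      by (intro D.split_epi_mono_iso[where g = b]) (use b in simp_all)
    then show ?thesis
      by (rule equivalence_reflects_iso[OF D.act_equivalence[OF g], rotated]) simp
  qed
  show ?thesis
    using assms C.is_action D.is_action iso by (simp add: is_gfunctor_def nat_iso_def)
qed

end

section \<open>G-functors and the functors they induce on equivariant categories\<close>

locale gfunctor = two_actions G C D T U
  for G :: "('g, 'y) monoid_scheme" and C :: "('o1, 'm1, 'z1) addcat_scheme"
    and D :: "('o2, 'm2, 'z2) addcat_scheme" and T :: "('g, 'o1, 'm1) action"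
    and U :: "('g, 'o2, 'm2) action" +
  fixes H :: "('o1, 'm1, 'o2, 'm2) funct" and \<sigma> :: "'g \<Rightarrow> 'o1 \<Rightarrow> 'm2"
  assumes is_gfunctor: "is_gfunctor G C D T U (H, \<sigma>)"
begin

lemma is_functor: "is_functor C D H"
  using is_gfunctor by (simp add: is_gfunctor_def)

lemmas funct_simps [simp] = functor_simps[OF is_functor]

lemma str_nat_trans: "g \<in> carrier G \<Longrightarrow> nat_trans C D (H \<circ>\<^sub>F Act T g) (Act U g \<circ>\<^sub>F H) (\<sigma> g)"
  using is_gfunctor by (simp add: is_gfunctor_def nat_iso_def)

lemma str_simps [simp]:
  assumes "g \<in> carrier G" "X \<in> Obj C"
  shows "\<sigma> g X \<in> Arr D" "Dom D (\<sigma> g X) = ObjMap H (ObjMap (Act T g) X)"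
    "Cod D (\<sigma> g X) = ObjMap (Act U g) (ObjMap H X)" "is_iso D (\<sigma> g X)"
  using nat_trans_simps(1-3)[OF str_nat_trans[OF assms(1)] assms(2)] assms is_gfunctor
  by (simp_all add: is_gfunctor_def nat_iso_def)

lemma str_natural:
  assumes "g \<in> carrier G" "f \<in> Arr C"
  shows "\<sigma> g (Cod C f) \<cdot>\<^bsub>D\<^esub> ArrMap H (ArrMap (Act T g) f)
    = ArrMap (Act U g) (ArrMap H f) \<cdot>\<^bsub>D\<^esub> \<sigma> g (Dom C f)"
  using nat_trans_simps(4)[OF str_nat_trans[OF assms(1)] assms(2)] by simp

lemma str_mult:
  assumes "g \<in> carrier G" "h \<in> carrier G" "X \<in> Obj C"
  shows "\<sigma> (g \<otimes>\<^bsub>G\<^esub> h) X \<cdot>\<^bsub>D\<^esub> ArrMap H (Coh T g h X)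
    = Coh U g h (ObjMap H X) \<cdot>\<^bsub>D\<^esub> (ArrMap (Act U g) (\<sigma> h X) \<cdot>\<^bsub>D\<^esub> \<sigma> g (ObjMap (Act T h) X))"
  using is_gfunctor assms by (simp add: is_gfunctor_def)

lemma str_unit: "X \<in> Obj C \<Longrightarrow> D.unit (ObjMap H X) \<cdot>\<^bsub>D\<^esub> \<sigma> \<one>\<^bsub>G\<^esub> X = ArrMap H (C.unit X)"
  using is_gfunctor by (simp add: is_gfunctor_def)

lemma funct_Comp:
  assumes "a \<cdot>\<^bsub>C\<^esub> b = c" "a \<in> Arr C" "b \<in> Arr C" "Dom C a = Cod C b"
  shows "ArrMap H a \<cdot>\<^bsub>D\<^esub> ArrMap H b = ArrMap H c"
  using assms by auto

lemma funct_eq: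
  assumes "a \<cdot>\<^bsub>C\<^esub> b = c \<cdot>\<^bsub>C\<^esub> d" "a \<in> Arr C" "b \<in> Arr C" "c \<in> Arr C" "d \<in> Arr C"
    "Dom C a = Cod C b" "Dom C c = Cod C d"
  shows "ArrMap H a \<cdot>\<^bsub>D\<^esub> ArrMap H b = ArrMap H c \<cdot>\<^bsub>D\<^esub> ArrMap H d"
  using arg_cong[OF assms(1), of "ArrMap H"] assms(2-) by simp

end

lemma gfunctorI:
  assumes "group G" "is_gfunctor G C D T U (H, \<sigma>)"
  shows "gfunctor G C D T U H \<sigma>"
  using assms
  by (simp add: gfunctor_def gfunctor_axioms_def two_actions_def cat_action_def cat_action_axioms_def
      is_gfunctor_def is_action_def)

lemma eqv_ObjMap_simps [simp]:
  "fst (eqv_ObjMap G D (H, \<sigma>) P) = ObjMap H (fst P)"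
  "g \<in> carrier G \<Longrightarrow> snd (eqv_ObjMap G D (H, \<sigma>) P) g = \<sigma> g (fst P) \<cdot>\<^bsub>D\<^esub> ArrMap H (snd P g)"
  by (auto simp: eqv_ObjMap_def split: prod.splits)

lemma eqv_funct_simps [simp]:
  "ObjMap (eqv_funct G D H) P = eqv_ObjMap G D H P"
  "ArrMap (eqv_funct G D H) (P, Q, f) = (eqv_ObjMap G D H P, eqv_ObjMap G D H Q, ArrMap (fst H) f)"
  by (simp_all add: eqv_funct_def)

context gfunctor
begin

text \<open>Through \<open>eqv_ObjI\<close> the unit axiom of \<sigma> replaces a check of
  invertibility. The cocycle identity combines multiplicativity of \<sigma> with its naturality at
  \<open>snd P h\<close>.\<close>

lemma eqv_ObjMap:
  assumes P [simp]: "P \<in> Obj C.E"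
  shows "eqv_ObjMap G D (H, \<sigma>) P \<in> Obj D.E"
proof -
  let ?\<psi> = "\<lambda>g \<in> carrier G. \<sigma> g (fst P) \<cdot>\<^bsub>D\<^esub> ArrMap H (snd P g)"
  have "(ObjMap H (fst P), ?\<psi>) \<in> Obj D.E"
  proof (rule D.eqv_ObjI)
    have "D.unit (ObjMap H (fst P)) \<cdot>\<^bsub>D\<^esub> (\<sigma> \<one>\<^bsub>G\<^esub> (fst P) \<cdot>\<^bsub>D\<^esub> ArrMap H (snd P \<one>\<^bsub>G\<^esub>))
        = (D.unit (ObjMap H (fst P)) \<cdot>\<^bsub>D\<^esub> \<sigma> \<one>\<^bsub>G\<^esub> (fst P)) \<cdot>\<^bsub>D\<^esub> ArrMap H (snd P \<one>\<^bsub>G\<^esub>)"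
      by simp
    also have "\<dots> = ArrMap H (C.unit (fst P) \<cdot>\<^bsub>C\<^esub> snd P \<one>\<^bsub>G\<^esub>)"
      by (subst str_unit) simp_all
    finally show "D.unit (ObjMap H (fst P)) \<cdot>\<^bsub>D\<^esub> ?\<psi> \<one>\<^bsub>G\<^esub> = Ident D (ObjMap H (fst P))"
      using C.eqv_Obj_unit[OF P] by simp
  next
    fix g h assume [simp]: "g \<in> carrier G" "h \<in> carrier G"
    let ?\<rho> = "ArrMap (Act U g)"
    have "?\<psi> (g \<otimes>\<^bsub>G\<^esub> h) = \<sigma> (g \<otimes>\<^bsub>G\<^esub> h) (fst P) \<cdot>\<^bsub>D\<^esub> (ArrMap H (Coh T g h (fst P)) \<cdot>\<^bsub>D\<^esub>
        (ArrMap H (ArrMap (Act T g) (snd P h)) \<cdot>\<^bsub>D\<^esub> ArrMap H (snd P g)))"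
      using C.eqv_Obj_cocycle[of P g h] by simp
    also have "\<dots> = Coh U g h (ObjMap H (fst P)) \<cdot>\<^bsub>D\<^esub>
        ((?\<rho> (\<sigma> h (fst P)) \<cdot>\<^bsub>D\<^esub> \<sigma> g (Cod C (snd P h))) \<cdot>\<^bsub>D\<^esub>
        (ArrMap H (ArrMap (Act T g) (snd P h)) \<cdot>\<^bsub>D\<^esub> ArrMap H (snd P g)))"
      using str_mult[of g h "fst P"] by (intro D.Comp_reassoc) simp_all
    also have "\<dots> = Coh U g h (ObjMap H (fst P)) \<cdot>\<^bsub>D\<^esub>
        (?\<rho> (\<sigma> h (fst P)) \<cdot>\<^bsub>D\<^esub> (\<sigma> g (Cod C (snd P h)) \<cdot>\<^bsub>D\<^esub>
        (ArrMap H (ArrMap (Act T g) (snd P h)) \<cdot>\<^bsub>D\<^esub> ArrMap H (snd P g))))"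
      by simp
    also have "\<sigma> g (Cod C (snd P h)) \<cdot>\<^bsub>D\<^esub> (ArrMap H (ArrMap (Act T g) (snd P h)) \<cdot>\<^bsub>D\<^esub> ArrMap H (snd P g))
        = ?\<rho> (ArrMap H (snd P h)) \<cdot>\<^bsub>D\<^esub> (\<sigma> g (Dom C (snd P h)) \<cdot>\<^bsub>D\<^esub> ArrMap H (snd P g))"
      by (rule D.Comp_reassoc[OF str_natural]) simp_all
    finally show "?\<psi> (g \<otimes>\<^bsub>G\<^esub> h) = Coh U g h (ObjMap H (fst P)) \<cdot>\<^bsub>D\<^esub> (?\<rho> (?\<psi> h) \<cdot>\<^bsub>D\<^esub> ?\<psi> g)"
      by simp
  qed simp_all
  then show ?thesis
    by (simp add: eqv_ObjMap_def case_prod_unfold)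
qed

lemma eqv_ArrMap:
  assumes a [simp]: "a \<in> Arr C.E"
  shows "(eqv_ObjMap G D (H, \<sigma>) (Dom C.E a), eqv_ObjMap G D (H, \<sigma>) (Cod C.E a), ArrMap H (C.und a))
    \<in> Arr D.E"
proof (rule D.eqv_ArrI)
  fix g assume g [simp]: "g \<in> carrier G"
  have "\<sigma> g (fst (Cod C.E a)) \<cdot>\<^bsub>D\<^esub> (ArrMap H (snd (Cod C.E a) g) \<cdot>\<^bsub>D\<^esub> ArrMap H (C.und a))
      = \<sigma> g (Cod C (C.und a)) \<cdot>\<^bsub>D\<^esub> (ArrMap H (ArrMap (Act T g) (C.und a)) \<cdot>\<^bsub>D\<^esub> ArrMap H (snd (Dom C.E a) g))"
    using funct_eq[OF C.eqv_Arr_eqv[OF a g]] by simp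
  also have "\<dots> = ArrMap (Act U g) (ArrMap H (C.und a)) \<cdot>\<^bsub>D\<^esub>
      (\<sigma> g (Dom C (C.und a)) \<cdot>\<^bsub>D\<^esub> ArrMap H (snd (Dom C.E a) g))"
    by (rule D.Comp_reassoc[OF str_natural]) simp_all
  finally show "snd (eqv_ObjMap G D (H, \<sigma>) (Cod C.E a)) g \<cdot>\<^bsub>D\<^esub> ArrMap H (C.und a)
      = ArrMap (Act U g) (ArrMap H (C.und a)) \<cdot>\<^bsub>D\<^esub> snd (eqv_ObjMap G D (H, \<sigma>) (Dom C.E a)) g"
    by simp
qed (simp_all add: eqv_ObjMap)

lemma eqv_funct_ArrMap:
  "ArrMap (eqv_funct G D (H, \<sigma>)) a
    = (eqv_ObjMap G D (H, \<sigma>) (Dom C.E a), eqv_ObjMap G D (H, \<sigma>) (Cod C.E a), ArrMap H (C.und a))"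
  by (auto simp: eqv_funct_def eqv_cat_def split: prod.splits)

lemma eqv_funct_functor: "is_functor C.E D.E (eqv_funct G D (H, \<sigma>))"
proof (rule is_functorI)
  show "ArrMap (eqv_funct G D (H, \<sigma>)) f \<in> Hom D.E (ObjMap (eqv_funct G D (H, \<sigma>)) (Dom C.E f))
      (ObjMap (eqv_funct G D (H, \<sigma>)) (Cod C.E f))" if "f \<in> Arr C.E" for f
    using eqv_ArrMap[OF that] by (simp add: Hom_def eqv_funct_ArrMap)
qed (simp_all add: eqv_ObjMap eqv_funct_ArrMap C.eqv_category D.eqv_category)

lemma commutes_with_forget: "commutes_with_forget G C D T U (H, \<sigma>)"
  unfolding commutes_with_forget_def functs_equal_def
  by (intro conjI ballI is_functor_comp[OF eqv_funct_functor D.forget_functor] eqv_funct_functor)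
    (simp_all add: eqv_funct_ArrMap is_functor_comp[OF C.forget_functor is_functor])

end

section \<open>Identity and composite G-functors\<close>

lemma (in cat_action) id_is_gfunctor: "is_gfunctor G C C T T (id_gfunct C T)"
proof -
  interpret two_actions G C C T T ..
  show ?thesis
    unfolding id_gfunct_def
  proof (rule is_gfunctorI)
    fix g assume [simp]: "g \<in> carrier G"
    show "nat_trans C C (id_funct \<circ>\<^sub>F Act T g) (Act T g \<circ>\<^sub>F id_funct) (\<lambda>X. Ident C (ObjMap (Act T g) X))"
      by (rule nat_transI) (simp_all add: is_functor_comp[OF act_functor is_functor_id[OF category_axioms]]
          is_functor_comp[OF is_functor_id[OF category_axioms] act_functor] Hom_def)
  qed (simp_all add: is_functor_id category_axioms)
qed

text \<open>Both families are extensional and agree on the group because the structure of the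
  identity consists of identities. Off the carriers the maps may differ, hence
  \<open>functs_equal\<close>.\<close>

lemma (in cat_action) eqv_funct_id: "functs_equal E E id_funct (eqv_funct G C (id_gfunct C T))"
proof -
  interpret I: gfunctor G C C T T id_funct "\<lambda>g X. Ident C (ObjMap (Act T g) X)"
    using id_is_gfunctor is_group by (intro gfunctorI) (simp_all add: id_gfunct_def)
  have "P = eqv_ObjMap G C (id_funct, \<lambda>g X. Ident C (ObjMap (Act T g) X)) P" if P: "P \<in> Obj E" for P
  proof (rule prod_eqI)
    show "snd P = snd (eqv_ObjMap G C (id_funct, \<lambda>g X. Ident C (ObjMap (Act T g) X)) P)"
      by (rule extensionalityI[OF eqv_Obj_extensional eqv_Obj_extensional]) (use P I.eqv_ObjMap in simp_all)
  qed simp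
  then show ?thesis
    using I.eqv_funct_functor
    by (auto simp: functs_equal_def id_gfunct_def is_functor_id eqv_category I.eqv_funct_ArrMap
        eqv_Arr_collapse intro!: eqv_Arr_eqI)
qed

text \<open>Apply \<open>K\<close> to each axiom of \<sigma> and continue with the same axiom of
  \<tau>. In the multiplicative law, naturality of \<tau> at \<open>\<sigma> h X\<close>
  interchanges the two middle factors.\<close>

lemma comp_is_gfunctor:
  assumes "group G" "is_gfunctor G D E U V (K, \<tau>)" "is_gfunctor G C D T U (H, \<sigma>)"
  shows "is_gfunctor G C E T V (comp_gfunct E (K, \<tau>) (H, \<sigma>))"
proof -
  interpret H: gfunctor G C D T U H \<sigma> using assms by (intro gfunctorI)
  interpret K: gfunctor G D E U V K \<tau> using assms by (intro gfunctorI)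
  interpret two_actions G C E T V ..
  let ?\<tau> = "\<lambda>g X. \<tau> g (ObjMap H X) \<cdot>\<^bsub>E\<^esub> ArrMap K (\<sigma> g X)"
  have "is_gfunctor G C E T V (K \<circ>\<^sub>F H, ?\<tau>)"
  proof (rule is_gfunctorI)
    show "is_functor C E (K \<circ>\<^sub>F H)"
      by (rule is_functor_comp[OF H.is_functor K.is_functor])
    fix g assume g [simp]: "g \<in> carrier G"
    show "nat_trans C E ((K \<circ>\<^sub>F H) \<circ>\<^sub>F Act T g) (Act V g \<circ>\<^sub>F K \<circ>\<^sub>F H) (?\<tau> g)"
    proof (rule nat_transI)
      fix f assume f [simp]: "f \<in> Arr C"
      have "\<tau> g (ObjMap H (Cod C f)) \<cdot>\<^bsub>E\<^esub> (ArrMap K (\<sigma> g (Cod C f)) \<cdot>\<^bsub>E\<^esub> ArrMap K (ArrMap H (ArrMap (Act T g) f)))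
          = \<tau> g (Cod D (ArrMap H f)) \<cdot>\<^bsub>E\<^esub> (ArrMap K (ArrMap (Act U g) (ArrMap H f)) \<cdot>\<^bsub>E\<^esub> ArrMap K (\<sigma> g (Dom C f)))"
        using K.funct_eq[OF H.str_natural[OF g f]] by simp
      also have "\<dots> = ArrMap (Act V g) (ArrMap K (ArrMap H f)) \<cdot>\<^bsub>E\<^esub>
          (\<tau> g (Dom D (ArrMap H f)) \<cdot>\<^bsub>E\<^esub> ArrMap K (\<sigma> g (Dom C f)))"
        by (rule K.D.Comp_reassoc[OF K.str_natural]) simp_all
      finally show "?\<tau> g (Cod C f) \<cdot>\<^bsub>E\<^esub> ArrMap ((K \<circ>\<^sub>F H) \<circ>\<^sub>F Act T g) f
          = ArrMap (Act V g \<circ>\<^sub>F K \<circ>\<^sub>F H) f \<cdot>\<^bsub>E\<^esub> ?\<tau> g (Dom C f)"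
        by simp
    qed (simp_all add: Hom_def
        is_functor_comp[OF H.C.act_functor is_functor_comp[OF H.is_functor K.is_functor]]
        is_functor_comp[OF is_functor_comp[OF H.is_functor K.is_functor] K.D.act_functor])
    fix h X assume h [simp]: "h \<in> carrier G" and X [simp]: "X \<in> Obj C"
    let ?\<rho> = "ArrMap (Act V g)"
    have "\<tau> (g \<otimes>\<^bsub>G\<^esub> h) (ObjMap H X) \<cdot>\<^bsub>E\<^esub> (ArrMap K (\<sigma> (g \<otimes>\<^bsub>G\<^esub> h) X) \<cdot>\<^bsub>E\<^esub> ArrMap K (ArrMap H (Coh T g h X)))
        = \<tau> (g \<otimes>\<^bsub>G\<^esub> h) (ObjMap H X) \<cdot>\<^bsub>E\<^esub> (ArrMap K (Coh U g h (ObjMap H X)) \<cdot>\<^bsub>E\<^esub>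
          (ArrMap K (ArrMap (Act U g) (\<sigma> h X)) \<cdot>\<^bsub>E\<^esub> ArrMap K (\<sigma> g (ObjMap (Act T h) X))))"
      using K.funct_eq[OF H.str_mult[OF g h X]] by simp
    also have "\<dots> = Coh V g h (ObjMap K (ObjMap H X)) \<cdot>\<^bsub>E\<^esub>
        ((?\<rho> (\<tau> h (ObjMap H X)) \<cdot>\<^bsub>E\<^esub> \<tau> g (ObjMap (Act U h) (ObjMap H X))) \<cdot>\<^bsub>E\<^esub>
          (ArrMap K (ArrMap (Act U g) (\<sigma> h X)) \<cdot>\<^bsub>E\<^esub> ArrMap K (\<sigma> g (ObjMap (Act T h) X))))"
      by (rule K.D.Comp_reassoc[OF K.str_mult]) simp_all
    also have "\<dots> = Coh V g h (ObjMap K (ObjMap H X)) \<cdot>\<^bsub>E\<^esub>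
        (?\<rho> (\<tau> h (ObjMap H X)) \<cdot>\<^bsub>E\<^esub> (\<tau> g (Cod D (\<sigma> h X)) \<cdot>\<^bsub>E\<^esub>
          (ArrMap K (ArrMap (Act U g) (\<sigma> h X)) \<cdot>\<^bsub>E\<^esub> ArrMap K (\<sigma> g (ObjMap (Act T h) X)))))"
      by simp
    also have "\<tau> g (Cod D (\<sigma> h X)) \<cdot>\<^bsub>E\<^esub>
          (ArrMap K (ArrMap (Act U g) (\<sigma> h X)) \<cdot>\<^bsub>E\<^esub> ArrMap K (\<sigma> g (ObjMap (Act T h) X)))
        = ?\<rho> (ArrMap K (\<sigma> h X)) \<cdot>\<^bsub>E\<^esub> (\<tau> g (Dom D (\<sigma> h X)) \<cdot>\<^bsub>E\<^esub> ArrMap K (\<sigma> g (ObjMap (Act T h) X)))"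
      by (rule K.D.Comp_reassoc[OF K.str_natural]) simp_all
    finally show "?\<tau> (g \<otimes>\<^bsub>G\<^esub> h) X \<cdot>\<^bsub>E\<^esub> ArrMap (K \<circ>\<^sub>F H) (Coh T g h X)
        = Coh V g h (ObjMap (K \<circ>\<^sub>F H) X) \<cdot>\<^bsub>E\<^esub> (?\<rho> (?\<tau> h X) \<cdot>\<^bsub>E\<^esub> ?\<tau> g (ObjMap (Act T h) X))"
      by simp
  next
    fix X assume X [simp]: "X \<in> Obj C"
    have "(K.D.unit (ObjMap K (ObjMap H X)) \<cdot>\<^bsub>E\<^esub> \<tau> \<one>\<^bsub>G\<^esub> (ObjMap H X)) \<cdot>\<^bsub>E\<^esub> ArrMap K (\<sigma> \<one>\<^bsub>G\<^esub> X)
        = ArrMap K (ArrMap H (H.C.unit X))"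
      using K.funct_Comp[OF H.str_unit[OF X]] by (subst K.str_unit) simp_all
    then show "K.D.unit (ObjMap (K \<circ>\<^sub>F H) X) \<cdot>\<^bsub>E\<^esub> ?\<tau> \<one>\<^bsub>G\<^esub> X = ArrMap (K \<circ>\<^sub>F H) (H.C.unit X)"
      by simp
  qed
  then show ?thesis
    by (simp add: comp_gfunct_def)
qed

lemma eqv_funct_comp:
  assumes "group G" "is_gfunctor G D E U V (K, \<tau>)" "is_gfunctor G C D T U (H, \<sigma>)"
  shows "functs_equal (eqv_cat G C T) (eqv_cat G E V) (eqv_funct G E (K, \<tau>) \<circ>\<^sub>F eqv_funct G D (H, \<sigma>))
    (eqv_funct G E (comp_gfunct E (K, \<tau>) (H, \<sigma>)))"
proof -
  interpret H: gfunctor G C D T U H \<sigma> using assms by (intro gfunctorI)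
  interpret K: gfunctor G D E U V K \<tau> using assms by (intro gfunctorI)
  let ?\<tau> = "\<lambda>g X. \<tau> g (ObjMap H X) \<cdot>\<^bsub>E\<^esub> ArrMap K (\<sigma> g X)"
  interpret KH: gfunctor G C E T V "K \<circ>\<^sub>F H" ?\<tau>
    using comp_is_gfunctor[OF assms] assms(1) by (intro gfunctorI) (simp_all add: comp_gfunct_def)
  have *: "eqv_ObjMap G E (K, \<tau>) (eqv_ObjMap G D (H, \<sigma>) P) = eqv_ObjMap G E (K \<circ>\<^sub>F H, ?\<tau>) P"
    if P [simp]: "P \<in> Obj H.C.E" for P
  proof (rule prod_eqI)
    show "snd (eqv_ObjMap G E (K, \<tau>) (eqv_ObjMap G D (H, \<sigma>) P)) = snd (eqv_ObjMap G E (K \<circ>\<^sub>F H, ?\<tau>) P)"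
      by (rule extensionalityI[OF K.D.eqv_Obj_extensional K.D.eqv_Obj_extensional])
        (simp_all add: H.eqv_ObjMap K.eqv_ObjMap KH.eqv_ObjMap)
  qed simp
  show ?thesis
    using is_functor_comp[OF H.eqv_funct_functor K.eqv_funct_functor] KH.eqv_funct_functor
    by (simp add: functs_equal_def comp_gfunct_def * H.eqv_funct_ArrMap K.eqv_funct_ArrMap
        KH.eqv_funct_ArrMap)
qed

section \<open>G-natural transformations lifted to equivariant categories\<close>

context two_actions
begin

lemma eqv_trans_nat_trans:
  assumes \<eta>: "is_gnatural G C D T U (H, \<sigma>) (H', \<sigma>') \<eta>"
    and F: "functs_equal C.E D.E F (eqv_funct G D (H, \<sigma>))"
    and F': "functs_equal C.E D.E F' (eqv_funct G D (H', \<sigma>'))"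
  shows "nat_trans C.E D.E F F' (eqv_trans F F' \<eta>)"
proof -
  interpret H: gfunctor G C D T U H \<sigma>
    using \<eta> C.is_group by (intro gfunctorI) (simp_all add: is_gnatural_def)
  interpret H': gfunctor G C D T U H' \<sigma>'
    using \<eta> C.is_group by (intro gfunctorI) (simp_all add: is_gnatural_def)
  have nat: "nat_trans C D H H' \<eta>"
    using \<eta> by (simp add: is_gnatural_def)
  note [simp] = nat_trans_simps(1-3)[OF nat]
  have F_simps [simp]: "ObjMap F P = eqv_ObjMap G D (H, \<sigma>) P" "ObjMap F' P = eqv_ObjMap G D (H', \<sigma>') P"
    if "P \<in> Obj C.E" for P
    using F F' that by (simp_all add: functs_equal_def)
  have F_Arr [simp]: "ArrMap F a = ArrMap (eqv_funct G D (H, \<sigma>)) a"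
    "ArrMap F' a = ArrMap (eqv_funct G D (H', \<sigma>')) a" if "a \<in> Arr C.E" for a
    using F F' that by (simp_all add: functs_equal_def)
  have \<eta>_Arr: "(eqv_ObjMap G D (H, \<sigma>) P, eqv_ObjMap G D (H', \<sigma>') P, \<eta> (fst P)) \<in> Arr D.E"
    if P [simp]: "P \<in> Obj C.E" for P
  proof (rule D.eqv_ArrI)
    fix g assume g [simp]: "g \<in> carrier G"
    have "\<sigma>' g (fst P) \<cdot>\<^bsub>D\<^esub> (ArrMap H' (snd P g) \<cdot>\<^bsub>D\<^esub> \<eta> (Dom C (snd P g)))
        = \<sigma>' g (fst P) \<cdot>\<^bsub>D\<^esub> (\<eta> (Cod C (snd P g)) \<cdot>\<^bsub>D\<^esub> ArrMap H (snd P g))"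
      using nat_trans_simps(4)[OF nat, of "snd P g"] by simp
    also have "\<dots> = ArrMap (Act U g) (\<eta> (fst P)) \<cdot>\<^bsub>D\<^esub> (\<sigma> g (fst P) \<cdot>\<^bsub>D\<^esub> ArrMap H (snd P g))"
      using \<eta> by (intro D.Comp_reassoc) (simp_all add: is_gnatural_def)
    finally show "snd (eqv_ObjMap G D (H', \<sigma>') P) g \<cdot>\<^bsub>D\<^esub> \<eta> (fst P)
        = ArrMap (Act U g) (\<eta> (fst P)) \<cdot>\<^bsub>D\<^esub> snd (eqv_ObjMap G D (H, \<sigma>) P) g"
      by simp
  qed (simp_all add: H.eqv_ObjMap H'.eqv_ObjMap)
  show ?thesis
  proof (rule nat_transI)
    show "is_functor C.E D.E F" "is_functor C.E D.E F'"
      using F F' by (simp_all add: functs_equal_def)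
    show "eqv_trans F F' \<eta> P \<in> Hom D.E (ObjMap F P) (ObjMap F' P)" if "P \<in> Obj C.E" for P
      using \<eta>_Arr[OF that] that by (simp add: Hom_def eqv_trans_def)
    show "eqv_trans F F' \<eta> (Cod C.E a) \<cdot>\<^bsub>D.E\<^esub> ArrMap F a
        = ArrMap F' a \<cdot>\<^bsub>D.E\<^esub> eqv_trans F F' \<eta> (Dom C.E a)" if [simp]: "a \<in> Arr C.E" for a
      using nat_trans_simps(4)[OF nat, of "C.und a"]
      by (simp add: H.eqv_funct_ArrMap H'.eqv_funct_ArrMap eqv_trans_def)
  qed
qed

lemma eqv_trans_nat_iso:
  assumes \<eta>: "is_gnatural G C D T U (H, \<sigma>) (H', \<sigma>') \<eta>" and iso: "nat_iso C D H H' \<eta>"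
    and F: "functs_equal C.E D.E F (eqv_funct G D (H, \<sigma>))"
    and F': "functs_equal C.E D.E F' (eqv_funct G D (H', \<sigma>'))"
  shows "nat_iso C.E D.E F F' (eqv_trans F F' \<eta>)"
  unfolding nat_iso_def
proof (intro conjI ballI)
  show nat: "nat_trans C.E D.E F F' (eqv_trans F F' \<eta>)"
    by (rule eqv_trans_nat_trans[OF \<eta> F F'])
  show "is_iso D.E (eqv_trans F F' \<eta> P)" if "P \<in> Obj C.E" for P
    using that nat_trans_simps(1)[OF nat that] nat_iso_iso[OF iso, of "fst P"]
    by (intro D.eqv_iso_if_iso) (simp_all add: eqv_trans_def)
qed

end

section \<open>The canonical structure of a left adjoint\<close>

locale left_adjoint_of_gfunctor = two_actions G C D T U + R: gfunctor G D C U T R \<sigma>R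
  for G :: "('g, 'y) monoid_scheme" and C :: "('o1, 'm1, 'z1) addcat_scheme"
    and D :: "('o2, 'm2, 'z2) addcat_scheme" and T :: "('g, 'o1, 'm1) action"
    and U :: "('g, 'o2, 'm2) action" and R :: "('o2, 'm2, 'o1, 'm1) funct"
    and \<sigma>R :: "'g \<Rightarrow> 'o2 \<Rightarrow> 'm1" +
  fixes L :: "('o1, 'm1, 'o2, 'm2) funct" and \<eta> :: "'o1 \<Rightarrow> 'm1" and \<epsilon> :: "'o2 \<Rightarrow> 'm2"
  assumes adjunction: "adjunction C D L R \<eta> \<epsilon>"
begin

lemma L_functor: "is_functor C D L"
  and unit_nat_trans: "nat_trans C C id_funct (R \<circ>\<^sub>F L) \<eta>"
  and counit_nat_trans: "nat_trans D D (L \<circ>\<^sub>F R) id_funct \<epsilon>"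
  using adjunction by (simp_all add: adjunction_def)

lemmas L_simps [simp] = functor_simps[OF L_functor]

lemma unit_simps [simp]:
  "X \<in> Obj C \<Longrightarrow> \<eta> X \<in> Arr C" "X \<in> Obj C \<Longrightarrow> Dom C (\<eta> X) = X"
  "X \<in> Obj C \<Longrightarrow> Cod C (\<eta> X) = ObjMap R (ObjMap L X)"
  using nat_trans_simps(1-3)[OF unit_nat_trans] by simp_all

lemma counit_simps [simp]:
  "Y \<in> Obj D \<Longrightarrow> \<epsilon> Y \<in> Arr D" "Y \<in> Obj D \<Longrightarrow> Dom D (\<epsilon> Y) = ObjMap L (ObjMap R Y)"
  "Y \<in> Obj D \<Longrightarrow> Cod D (\<epsilon> Y) = Y"
  using nat_trans_simps(1-3)[OF counit_nat_trans] by simp_all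

lemma unit_natural:
  "f \<in> Arr C \<Longrightarrow> ArrMap R (ArrMap L f) \<cdot>\<^bsub>C\<^esub> \<eta> (Dom C f) = \<eta> (Cod C f) \<cdot>\<^bsub>C\<^esub> f"
  using nat_trans_simps(4)[OF unit_nat_trans, of f] by simp

lemma counit_natural:
  "f \<in> Arr D \<Longrightarrow> \<epsilon> (Cod D f) \<cdot>\<^bsub>D\<^esub> ArrMap L (ArrMap R f) = f \<cdot>\<^bsub>D\<^esub> \<epsilon> (Dom D f)"
  using nat_trans_simps(4)[OF counit_nat_trans, of f] by simp

lemma triangle [simp]:
  "X \<in> Obj C \<Longrightarrow> \<epsilon> (ObjMap L X) \<cdot>\<^bsub>D\<^esub> ArrMap L (\<eta> X) = Ident D (ObjMap L X)"
  "Y \<in> Obj D \<Longrightarrow> ArrMap R (\<epsilon> Y) \<cdot>\<^bsub>C\<^esub> \<eta> (ObjMap R Y) = Ident C (ObjMap R Y)"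
  using adjunction by (simp_all add: adjunction_def)

text \<open>The arrow is recovered from its transpose by applying \<open>L\<close> and composing
  with the counit; naturality of the counit and a triangle identity give it back.\<close>

lemma transpose_unique:
  assumes X [simp]: "X \<in> Obj C" and a: "a \<in> Arr D" "Dom D a = ObjMap L X"
    and b: "b \<in> Arr D" "Dom D b = ObjMap L X" "Cod D a = Cod D b"
    and eq: "ArrMap R a \<cdot>\<^bsub>C\<^esub> \<eta> X = ArrMap R b \<cdot>\<^bsub>C\<^esub> \<eta> X"
  shows "a = b"
proof -
  have *: "\<epsilon> (Cod D c) \<cdot>\<^bsub>D\<^esub> ArrMap L (ArrMap R c \<cdot>\<^bsub>C\<^esub> \<eta> X) = c"
    if [simp]: "c \<in> Arr D" "Dom D c = ObjMap L X" for c
  proof -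
    have "\<epsilon> (Cod D c) \<cdot>\<^bsub>D\<^esub> (ArrMap L (ArrMap R c) \<cdot>\<^bsub>D\<^esub> ArrMap L (\<eta> X))
        = c \<cdot>\<^bsub>D\<^esub> (\<epsilon> (Dom D c) \<cdot>\<^bsub>D\<^esub> ArrMap L (\<eta> X))"
      by (rule D.Comp_reassoc[OF counit_natural]) simp_all
    then show ?thesis
      by simp
  qed
  show ?thesis
    using *[OF a] *[OF b(1,2)] unfolding eq b(3) by (rule trans[OF sym])
qed

lemma transpose_ex:
  assumes f [simp]: "f \<in> Arr C" and Y [simp]: "Y \<in> Obj D" "Cod C f = ObjMap R Y"
  obtains s where "s \<in> Arr D" "Dom D s = ObjMap L (Dom C f)" "Cod D s = Y"
    "ArrMap R s \<cdot>\<^bsub>C\<^esub> \<eta> (Dom C f) = f"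
proof
  let ?s = "\<epsilon> Y \<cdot>\<^bsub>D\<^esub> ArrMap L f"
  have "ArrMap R ?s \<cdot>\<^bsub>C\<^esub> \<eta> (Dom C f) = (ArrMap R (\<epsilon> Y) \<cdot>\<^bsub>C\<^esub> \<eta> (ObjMap R Y)) \<cdot>\<^bsub>C\<^esub> f"
    using unit_natural[OF f] by (subst C.Comp_assoc') simp_all
  then show "ArrMap R ?s \<cdot>\<^bsub>C\<^esub> \<eta> (Dom C f) = f"
    by simp
qed simp_all

text \<open>The component \<open>s : L \<rho>\<^sub>g X \<rightarrow> \<rho>\<^sub>g L X\<close> is forced by $G$-naturality of the unit, which
  prescribes its transpose.\<close>

lemma str_ex:
  assumes [simp]: "g \<in> carrier G" "X \<in> Obj C"
  shows "\<exists>s. s \<in> Arr D \<and> Dom D s = ObjMap L (ObjMap (Act T g) X) \<and>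
    Cod D s = ObjMap (Act U g) (ObjMap L X) \<and>
    \<sigma>R g (ObjMap L X) \<cdot>\<^bsub>C\<^esub> (ArrMap R s \<cdot>\<^bsub>C\<^esub> \<eta> (ObjMap (Act T g) X)) = ArrMap (Act T g) (\<eta> X)"
proof -
  have "is_iso C (\<sigma>R g (ObjMap L X))"
    by simp
  then obtain t where t [simp]: "t \<in> Arr C" "Dom C t = ObjMap (Act T g) (ObjMap R (ObjMap L X))"
    "Cod C t = ObjMap R (ObjMap (Act U g) (ObjMap L X))"
    and \<sigma>t: "\<sigma>R g (ObjMap L X) \<cdot>\<^bsub>C\<^esub> t = Ident C (ObjMap (Act T g) (ObjMap R (ObjMap L X)))"
    by (rule C.isoE) simp
  \<comment> \<open>This is the mate of the inverse of \<open>\<sigma>R\<close>: the arrow whose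
    transpose is the image of the unit followed by \<open>t\<close>.\<close>
  obtain s where s: "s \<in> Arr D" "Dom D s = ObjMap L (ObjMap (Act T g) X)"
    "Cod D s = ObjMap (Act U g) (ObjMap L X)"
    "ArrMap R s \<cdot>\<^bsub>C\<^esub> \<eta> (ObjMap (Act T g) X) = t \<cdot>\<^bsub>C\<^esub> ArrMap (Act T g) (\<eta> X)"
    using transpose_ex[of "t \<cdot>\<^bsub>C\<^esub> ArrMap (Act T g) (\<eta> X)" "ObjMap (Act U g) (ObjMap L X)"] by simp metis
  have "\<sigma>R g (ObjMap L X) \<cdot>\<^bsub>C\<^esub> (t \<cdot>\<^bsub>C\<^esub> ArrMap (Act T g) (\<eta> X))
      = (\<sigma>R g (ObjMap L X) \<cdot>\<^bsub>C\<^esub> t) \<cdot>\<^bsub>C\<^esub> ArrMap (Act T g) (\<eta> X)"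
    by simp
  then show ?thesis
    using s unfolding \<sigma>t by auto
qed

text \<open>Chosen by its transposed equation rather than by the explicit mate, because every later
  argument goes through that equation; by \<open>str_eqI\<close> it determines the arrow.\<close>

definition str :: "'g \<Rightarrow> 'o1 \<Rightarrow> 'm2" where
  "str g X = (SOME s. s \<in> Arr D \<and> Dom D s = ObjMap L (ObjMap (Act T g) X) \<and>
    Cod D s = ObjMap (Act U g) (ObjMap L X) \<and>
    \<sigma>R g (ObjMap L X) \<cdot>\<^bsub>C\<^esub> (ArrMap R s \<cdot>\<^bsub>C\<^esub> \<eta> (ObjMap (Act T g) X)) = ArrMap (Act T g) (\<eta> X))"

lemma str_simps [simp]:
  assumes "g \<in> carrier G" "X \<in> Obj C"
  shows "str g X \<in> Arr D" "Dom D (str g X) = ObjMap L (ObjMap (Act T g) X)"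
    "Cod D (str g X) = ObjMap (Act U g) (ObjMap L X)"
    and str_transpose: "\<sigma>R g (ObjMap L X) \<cdot>\<^bsub>C\<^esub> (ArrMap R (str g X) \<cdot>\<^bsub>C\<^esub> \<eta> (ObjMap (Act T g) X))
      = ArrMap (Act T g) (\<eta> X)"
  using someI_ex[OF str_ex[OF assms]] by (simp_all add: str_def)

lemma str_transpose_Comp [simp]:
  assumes "g \<in> carrier G" "X \<in> Obj C" "x \<in> Arr C" "Cod C x = ObjMap (Act T g) X"
  shows "\<sigma>R g (ObjMap L X) \<cdot>\<^bsub>C\<^esub> (ArrMap R (str g X) \<cdot>\<^bsub>C\<^esub> (\<eta> (ObjMap (Act T g) X) \<cdot>\<^bsub>C\<^esub> x))
    = ArrMap (Act T g) (\<eta> X) \<cdot>\<^bsub>C\<^esub> x"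
  unfolding str_transpose[OF assms(1,2), symmetric] using assms by (simp del: str_transpose)

text \<open>Transposition and composition with the invertible \<open>\<sigma>R\<close> are both
  injective. Naturality, multiplicativity, compatibility with the counit and uniqueness of
  \<open>str\<close> are all checked in this form.\<close>

lemma str_eqI:
  assumes [simp]: "g \<in> carrier G" "X \<in> Obj C" "Z \<in> Obj D"
    and a [simp]: "a \<in> Arr D" "Dom D a = ObjMap L X" "Cod D a = ObjMap (Act U g) Z"
    and b [simp]: "b \<in> Arr D" "Dom D b = ObjMap L X" "Cod D b = ObjMap (Act U g) Z"
    and eq: "\<sigma>R g Z \<cdot>\<^bsub>C\<^esub> (ArrMap R a \<cdot>\<^bsub>C\<^esub> \<eta> X) = \<sigma>R g Z \<cdot>\<^bsub>C\<^esub> (ArrMap R b \<cdot>\<^bsub>C\<^esub> \<eta> X)"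
  shows "a = b"
proof (rule transpose_unique[of X])
  show "ArrMap R a \<cdot>\<^bsub>C\<^esub> \<eta> X = ArrMap R b \<cdot>\<^bsub>C\<^esub> \<eta> X"
    by (rule C.mono_cancel[OF C.iso_mono eq]) simp_all
qed simp_all

lemma str_natural:
  assumes g [simp]: "g \<in> carrier G" and f [simp]: "f \<in> Arr C"
  shows "str g (Cod C f) \<cdot>\<^bsub>D\<^esub> ArrMap L (ArrMap (Act T g) f)
    = ArrMap (Act U g) (ArrMap L f) \<cdot>\<^bsub>D\<^esub> str g (Dom C f)"
proof (rule str_eqI[of g "ObjMap (Act T g) (Dom C f)" "ObjMap L (Cod C f)"])
  let ?\<rho> = "ArrMap (Act T g)" and ?\<rho>' = "ArrMap (Act U g)" and ?X = "Dom C f" and ?Y = "Cod C f"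
  let ?\<eta>' = "\<eta> (ObjMap (Act T g) ?X)"
  have "\<sigma>R g (ObjMap L ?Y) \<cdot>\<^bsub>C\<^esub> (ArrMap R (str g ?Y) \<cdot>\<^bsub>C\<^esub> (ArrMap R (ArrMap L (?\<rho> f)) \<cdot>\<^bsub>C\<^esub> ?\<eta>'))
      = ?\<rho> (\<eta> ?Y) \<cdot>\<^bsub>C\<^esub> ?\<rho> f"
    using unit_natural[of "?\<rho> f"] by simp
  also have "\<dots> = ?\<rho> (ArrMap R (ArrMap L f)) \<cdot>\<^bsub>C\<^esub> ?\<rho> (\<eta> ?X)"
    by (rule C.act_eq[OF unit_natural[symmetric]]) simp_all
  also have "\<dots> = ?\<rho> (ArrMap R (ArrMap L f)) \<cdot>\<^bsub>C\<^esub>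
      (\<sigma>R g (ObjMap L ?X) \<cdot>\<^bsub>C\<^esub> (ArrMap R (str g ?X) \<cdot>\<^bsub>C\<^esub> ?\<eta>'))"
    by simp
  also have "\<dots> = \<sigma>R g (Cod D (ArrMap L f)) \<cdot>\<^bsub>C\<^esub>
      (ArrMap R (?\<rho>' (ArrMap L f)) \<cdot>\<^bsub>C\<^esub> (ArrMap R (str g ?X) \<cdot>\<^bsub>C\<^esub> ?\<eta>'))"
    using R.str_natural[OF g, of "ArrMap L f"] by (intro C.Comp_reassoc) simp_all
  finally show "\<sigma>R g (ObjMap L ?Y) \<cdot>\<^bsub>C\<^esub> (ArrMap R (str g ?Y \<cdot>\<^bsub>D\<^esub> ArrMap L (?\<rho> f)) \<cdot>\<^bsub>C\<^esub> ?\<eta>')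
      = \<sigma>R g (ObjMap L ?Y) \<cdot>\<^bsub>C\<^esub> (ArrMap R (?\<rho>' (ArrMap L f) \<cdot>\<^bsub>D\<^esub> str g ?X) \<cdot>\<^bsub>C\<^esub> ?\<eta>')"
    by simp
qed simp_all

text \<open>After transposition the left side is the unit followed by a coherence isomorphism.
  Unfolding the iterated action of the unit through both transposed equations leaves exactly
  multiplicativity of \<open>\<sigma>R\<close>.\<close>

lemma str_mult:
  assumes g [simp]: "g \<in> carrier G" and h [simp]: "h \<in> carrier G" and X [simp]: "X \<in> Obj C"
  shows "str (g \<otimes>\<^bsub>G\<^esub> h) X \<cdot>\<^bsub>D\<^esub> ArrMap L (Coh T g h X)
    = Coh U g h (ObjMap L X) \<cdot>\<^bsub>D\<^esub> (ArrMap (Act U g) (str h X) \<cdot>\<^bsub>D\<^esub> str g (ObjMap (Act T h) X))"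
proof (rule str_eqI[of "g \<otimes>\<^bsub>G\<^esub> h" "ObjMap (Act T g) (ObjMap (Act T h) X)" "ObjMap L X"])
  let ?\<rho> = "ArrMap (Act T g)" and ?\<rho>' = "ArrMap (Act U g)" and ?gh = "g \<otimes>\<^bsub>G\<^esub> h"
  let ?hX = "ObjMap (Act T h) X"
  let ?\<eta>' = "\<eta> (ObjMap (Act T g) ?hX)"
  have "\<sigma>R ?gh (ObjMap L X) \<cdot>\<^bsub>C\<^esub> (ArrMap R (str ?gh X) \<cdot>\<^bsub>C\<^esub> (ArrMap R (ArrMap L (Coh T g h X)) \<cdot>\<^bsub>C\<^esub> ?\<eta>'))
      = ArrMap (Act T ?gh) (\<eta> X) \<cdot>\<^bsub>C\<^esub> Coh T g h X"
    using unit_natural[of "Coh T g h X"] by simp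
  also have "\<dots> = Coh T g h (ObjMap R (ObjMap L X)) \<cdot>\<^bsub>C\<^esub> ?\<rho> (ArrMap (Act T h) (\<eta> X))"
    using C.Coh_natural[of g h "\<eta> X"] by simp
  \<comment> \<open>The transposed equation is read backwards in order to introduce
    \<open>str h X\<close>; the same happens with \<open>str g\<close> two steps later.\<close>
  also have "ArrMap (Act T h) (\<eta> X)
      = \<sigma>R h (ObjMap L X) \<cdot>\<^bsub>C\<^esub> (ArrMap R (str h X) \<cdot>\<^bsub>C\<^esub> \<eta> ?hX)"
    by simp
  also have "?\<rho> \<dots> = ?\<rho> (\<sigma>R h (ObjMap L X)) \<cdot>\<^bsub>C\<^esub> (?\<rho> (ArrMap R (str h X)) \<cdot>\<^bsub>C\<^esub> ?\<rho> (\<eta> ?hX))"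
    by (simp del: str_transpose)
  also have "?\<rho> (\<eta> ?hX) = \<sigma>R g (ObjMap L ?hX) \<cdot>\<^bsub>C\<^esub> (ArrMap R (str g ?hX) \<cdot>\<^bsub>C\<^esub> ?\<eta>')"
    by simp
  also have "?\<rho> (ArrMap R (str h X)) \<cdot>\<^bsub>C\<^esub> \<dots>
      = \<sigma>R g (ObjMap (Act U h) (ObjMap L X)) \<cdot>\<^bsub>C\<^esub>
        (ArrMap R (?\<rho>' (str h X)) \<cdot>\<^bsub>C\<^esub> (ArrMap R (str g ?hX) \<cdot>\<^bsub>C\<^esub> ?\<eta>'))"
    using R.str_natural[OF g, of "str h X"] by (intro C.Comp_reassoc) simp_all
  also have "Coh T g h (ObjMap R (ObjMap L X)) \<cdot>\<^bsub>C\<^esub> (?\<rho> (\<sigma>R h (ObjMap L X)) \<cdot>\<^bsub>C\<^esub> \<dots>)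
      = (Coh T g h (ObjMap R (ObjMap L X)) \<cdot>\<^bsub>C\<^esub> (?\<rho> (\<sigma>R h (ObjMap L X)) \<cdot>\<^bsub>C\<^esub>
          \<sigma>R g (ObjMap (Act U h) (ObjMap L X)))) \<cdot>\<^bsub>C\<^esub>
        (ArrMap R (?\<rho>' (str h X)) \<cdot>\<^bsub>C\<^esub> (ArrMap R (str g ?hX) \<cdot>\<^bsub>C\<^esub> ?\<eta>'))"
    by simp
  also have "\<dots> = (\<sigma>R ?gh (ObjMap L X) \<cdot>\<^bsub>C\<^esub> ArrMap R (Coh U g h (ObjMap L X))) \<cdot>\<^bsub>C\<^esub>
        (ArrMap R (?\<rho>' (str h X)) \<cdot>\<^bsub>C\<^esub> (ArrMap R (str g ?hX) \<cdot>\<^bsub>C\<^esub> ?\<eta>'))"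
    by (subst R.str_mult) simp_all
  finally show "\<sigma>R ?gh (ObjMap L X) \<cdot>\<^bsub>C\<^esub> (ArrMap R (str ?gh X \<cdot>\<^bsub>D\<^esub> ArrMap L (Coh T g h X)) \<cdot>\<^bsub>C\<^esub> ?\<eta>')
      = \<sigma>R ?gh (ObjMap L X) \<cdot>\<^bsub>C\<^esub>
        (ArrMap R (Coh U g h (ObjMap L X) \<cdot>\<^bsub>D\<^esub> (?\<rho>' (str h X) \<cdot>\<^bsub>D\<^esub> str g ?hX)) \<cdot>\<^bsub>C\<^esub> ?\<eta>')"
    by simp
qed simp_all

text \<open>Both arrows end in \<open>L X\<close> itself, so plain transposition suffices. The unit
  axiom of \<open>R\<close> brings in \<open>\<sigma>R\<close>, after which the transposed equation
  and naturality of the action unit and of \<eta> apply.\<close>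

lemma str_unit:
  assumes X [simp]: "X \<in> Obj C"
  shows "D.unit (ObjMap L X) \<cdot>\<^bsub>D\<^esub> str \<one>\<^bsub>G\<^esub> X = ArrMap L (C.unit X)"
proof (rule transpose_unique[of "ObjMap (Act T \<one>\<^bsub>G\<^esub>) X"])
  let ?\<rho> = "ArrMap (Act T \<one>\<^bsub>G\<^esub>)" and ?\<eta>' = "\<eta> (ObjMap (Act T \<one>\<^bsub>G\<^esub>) X)"
  have "ArrMap R (D.unit (ObjMap L X)) \<cdot>\<^bsub>C\<^esub> (ArrMap R (str \<one>\<^bsub>G\<^esub> X) \<cdot>\<^bsub>C\<^esub> ?\<eta>')
      = C.unit (Cod C (\<eta> X)) \<cdot>\<^bsub>C\<^esub> (\<sigma>R \<one>\<^bsub>G\<^esub> (ObjMap L X) \<cdot>\<^bsub>C\<^esub> (ArrMap R (str \<one>\<^bsub>G\<^esub> X) \<cdot>\<^bsub>C\<^esub> ?\<eta>'))"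
    using R.str_unit[of "ObjMap L X", symmetric] by simp
  also have "\<dots> = C.unit (Cod C (\<eta> X)) \<cdot>\<^bsub>C\<^esub> ?\<rho> (\<eta> X)"
    by simp
  also have "\<dots> = \<eta> X \<cdot>\<^bsub>C\<^esub> C.unit X"
    using C.unit_natural[of "\<eta> X"] by simp
  also have "\<dots> = ArrMap R (ArrMap L (C.unit X)) \<cdot>\<^bsub>C\<^esub> ?\<eta>'"
    using unit_natural[of "C.unit X"] by simp
  finally show "ArrMap R (D.unit (ObjMap L X) \<cdot>\<^bsub>D\<^esub> str \<one>\<^bsub>G\<^esub> X) \<cdot>\<^bsub>C\<^esub> ?\<eta>' = ArrMap R (ArrMap L (C.unit X)) \<cdot>\<^bsub>C\<^esub> ?\<eta>'"
    by simp
qed simp_all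

lemma L_is_gfunctor: "is_gfunctor G C D T U (L, str)"
proof (rule is_gfunctorI[OF L_functor])
  show "nat_trans C D (L \<circ>\<^sub>F Act T g) (Act U g \<circ>\<^sub>F L) (str g)" if "g \<in> carrier G" for g
    using that str_natural by (intro nat_transI)
      (simp_all add: Hom_def is_functor_comp[OF C.act_functor L_functor] is_functor_comp[OF L_functor D.act_functor])
qed (simp_all add: str_mult str_unit)

text \<open>Transposed, both sides become \<open>\<sigma>R g Y\<close> by a triangle identity, taken
  at \<open>\<rho>\<^sub>g Y\<close> on the left and at \<open>Y\<close>, under
  \<open>\<rho>\<^sub>g\<close>, on the right.\<close>

lemma counit_gnatural:
  assumes g [simp]: "g \<in> carrier G" and Y [simp]: "Y \<in> Obj D"
  shows "\<epsilon> (ObjMap (Act U g) Y)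
    = ArrMap (Act U g) (\<epsilon> Y) \<cdot>\<^bsub>D\<^esub> (str g (ObjMap R Y) \<cdot>\<^bsub>D\<^esub> ArrMap L (\<sigma>R g Y))"
proof (rule str_eqI[of g "ObjMap R (ObjMap (Act U g) Y)" Y])
  let ?\<rho> = "ArrMap (Act T g)" and ?\<rho>' = "ArrMap (Act U g)" and ?RY = "ObjMap R Y"
  let ?\<eta>' = "\<eta> (ObjMap R (ObjMap (Act U g) Y))"
  have "\<sigma>R g Y \<cdot>\<^bsub>C\<^esub> (ArrMap R (?\<rho>' (\<epsilon> Y)) \<cdot>\<^bsub>C\<^esub> (ArrMap R (str g ?RY) \<cdot>\<^bsub>C\<^esub> (ArrMap R (ArrMap L (\<sigma>R g Y)) \<cdot>\<^bsub>C\<^esub> ?\<eta>')))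
      = \<sigma>R g Y \<cdot>\<^bsub>C\<^esub> (ArrMap R (?\<rho>' (\<epsilon> Y)) \<cdot>\<^bsub>C\<^esub> (ArrMap R (str g ?RY) \<cdot>\<^bsub>C\<^esub> (\<eta> (ObjMap (Act T g) ?RY) \<cdot>\<^bsub>C\<^esub> \<sigma>R g Y)))"
    using unit_natural[of "\<sigma>R g Y"] by simp
  also have "\<dots> = ?\<rho> (ArrMap R (\<epsilon> Y)) \<cdot>\<^bsub>C\<^esub> (\<sigma>R g (ObjMap L ?RY) \<cdot>\<^bsub>C\<^esub>
      (ArrMap R (str g ?RY) \<cdot>\<^bsub>C\<^esub> (\<eta> (ObjMap (Act T g) ?RY) \<cdot>\<^bsub>C\<^esub> \<sigma>R g Y)))"
    using R.str_natural[OF g, of "\<epsilon> Y"] by (intro C.Comp_reassoc) simp_all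
  also have "\<dots> = (?\<rho> (ArrMap R (\<epsilon> Y)) \<cdot>\<^bsub>C\<^esub> ?\<rho> (\<eta> ?RY)) \<cdot>\<^bsub>C\<^esub> \<sigma>R g Y"
    by simp
  also have "?\<rho> (ArrMap R (\<epsilon> Y)) \<cdot>\<^bsub>C\<^esub> ?\<rho> (\<eta> ?RY) = ?\<rho> (Ident C ?RY)"
    by (rule C.act_Comp) simp_all
  finally show "\<sigma>R g Y \<cdot>\<^bsub>C\<^esub> (ArrMap R (\<epsilon> (ObjMap (Act U g) Y)) \<cdot>\<^bsub>C\<^esub> ?\<eta>') = \<sigma>R g Y \<cdot>\<^bsub>C\<^esub>
      (ArrMap R (?\<rho>' (\<epsilon> Y) \<cdot>\<^bsub>D\<^esub> (str g ?RY \<cdot>\<^bsub>D\<^esub> ArrMap L (\<sigma>R g Y))) \<cdot>\<^bsub>C\<^esub> ?\<eta>')"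
    by simp
qed simp_all

lemma the_left_adjoint_structure:
  "the_structure G C (left_adjoint_structure G C D T U L (R, \<sigma>R) \<eta> \<epsilon>) str"
  unfolding the_structure_def
proof (intro conjI allI impI ballI)
  interpret L: gfunctor G C D T U L str
    by (rule gfunctorI[OF C.is_group L_is_gfunctor])
  have RL: "is_gfunctor G C C T T (comp_gfunct C (R, \<sigma>R) (L, str))"
    by (rule comp_is_gfunctor[OF C.is_group R.is_gfunctor L_is_gfunctor])
  have LR: "is_gfunctor G D D U U (comp_gfunct D (L, str) (R, \<sigma>R))"
    by (rule comp_is_gfunctor[OF C.is_group L_is_gfunctor R.is_gfunctor])
  show "left_adjoint_structure G C D T U L (R, \<sigma>R) \<eta> \<epsilon> str"
    unfolding left_adjoint_structure_def
    using L_is_gfunctor RL LR C.id_is_gfunctor D.id_is_gfunctor unit_nat_trans counit_nat_trans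
    by (simp add: is_gnatural_def comp_gfunct_def id_gfunct_def str_transpose counit_gnatural)
  fix \<sigma>' g X
  assume \<sigma>': "left_adjoint_structure G C D T U L (R, \<sigma>R) \<eta> \<epsilon> \<sigma>'"
    and g [simp]: "g \<in> carrier G" and X [simp]: "X \<in> Obj C"
  interpret L': gfunctor G C D T U L \<sigma>'
    using \<sigma>' by (intro gfunctorI[OF C.is_group]) (simp add: left_adjoint_structure_def)
  \<comment> \<open>G-naturality of the unit for the competing structure is precisely the equation
    that defines \<open>str\<close>.\<close>
  have "(\<sigma>R g (ObjMap L X) \<cdot>\<^bsub>C\<^esub> ArrMap R (\<sigma>' g X)) \<cdot>\<^bsub>C\<^esub> \<eta> (ObjMap (Act T g) X) = ArrMap (Act T g) (\<eta> X)"
    using \<sigma>' by (simp add: left_adjoint_structure_def is_gnatural_def comp_gfunct_def id_gfunct_def)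
  then show "\<sigma>' g X = str g X"
    by (intro str_eqI[of g "ObjMap (Act T g) X" "ObjMap L X"]) (simp_all add: str_transpose)
qed

text \<open>Unit and counit lift because they are G-natural. The triangle identities are equations
  between underlying arrows and hold as they stand.\<close>

lemma eqv_adjunction:
  assumes \<sigma>: "left_adjoint_structure G C D T U L (R, \<sigma>R) \<eta> \<epsilon> \<sigma>"
  defines "LG \<equiv> eqv_funct G D (L, \<sigma>)" and "RG \<equiv> eqv_funct G C (R, \<sigma>R)"
  shows "adjunction C.E D.E LG RG (eqv_trans id_funct (RG \<circ>\<^sub>F LG) \<eta>) (eqv_trans (LG \<circ>\<^sub>F RG) id_funct \<epsilon>)"
proof -
  have L: "is_gfunctor G C D T U (L, \<sigma>)"
    using \<sigma> by (simp add: left_adjoint_structure_def)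
  interpret L: gfunctor G C D T U L \<sigma>
    by (rule gfunctorI[OF C.is_group L])
  have "two_actions G C C T T" "two_actions G D D U U"
    by unfold_locales
  note nat = two_actions.eqv_trans_nat_trans[OF this(1)] two_actions.eqv_trans_nat_trans[OF this(2)]
  have \<eta>_nat: "nat_trans C.E C.E id_funct (RG \<circ>\<^sub>F LG) (eqv_trans id_funct (RG \<circ>\<^sub>F LG) \<eta>)"
    using \<sigma> C.eqv_funct_id eqv_funct_comp[OF C.is_group R.is_gfunctor L] unfolding LG_def RG_def
    by (intro nat) (simp_all add: left_adjoint_structure_def comp_gfunct_def id_gfunct_def)
  have \<epsilon>_nat: "nat_trans D.E D.E (LG \<circ>\<^sub>F RG) id_funct (eqv_trans (LG \<circ>\<^sub>F RG) id_funct \<epsilon>)"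
    using \<sigma> D.eqv_funct_id eqv_funct_comp[OF C.is_group L R.is_gfunctor] unfolding LG_def RG_def
    by (intro nat) (simp_all add: left_adjoint_structure_def comp_gfunct_def id_gfunct_def)
  show ?thesis
    unfolding adjunction_def
    using \<eta>_nat \<epsilon>_nat L.eqv_funct_functor R.eqv_funct_functor
    by (simp add: eqv_trans_def LG_def RG_def L.eqv_funct_ArrMap R.eqv_funct_ArrMap)
qed

end

section \<open>The canonical structure of a kernel\<close>

text \<open>The component of \<tau> is the restriction of \<sigma> to the kernel. Each axiom is an
  equation that holds for \<open>F\<close> and is cancelled back along the image of \<iota> under
  the action, a mono.\<close>

lemma (in two_actions) ex_subfunctor_structure:
  assumes \<epsilon>: "is_gnatural G C D T U (F, \<sigma>) (F', \<sigma>') \<epsilon>" and K: "is_kernel_functor C D F F' \<epsilon> K \<iota>"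
  shows "\<exists>\<tau>. the_structure G C (subfunctor_structure G C D T U K (F, \<sigma>) \<iota>) \<tau>"
proof -
  have F: "is_gfunctor G C D T U (F, \<sigma>)"
    using \<epsilon> by (simp add: is_gnatural_def)
  interpret F: gfunctor G C D T U F \<sigma>
    by (rule gfunctorI[OF C.is_group F])
  interpret F': gfunctor G C D T U F' \<sigma>'
    using \<epsilon> by (intro gfunctorI[OF C.is_group]) (simp add: is_gnatural_def)
  have nat: "nat_trans C D F F' \<epsilon>" "nat_trans C D K F \<iota>" and K_functor: "is_functor C D K"
    and ker: "\<And>X. X \<in> Obj C \<Longrightarrow> is_kernel D (\<epsilon> X) (\<iota> X)"
    using K by (simp_all add: is_kernel_functor_def nat_trans_def)
  note [simp] = nat_trans_simps(1-3)[OF nat(1)] nat_trans_simps(1-3)[OF nat(2)] functor_simps[OF K_functor]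
  have \<iota>_natural: "\<iota> (Cod C f) \<cdot>\<^bsub>D\<^esub> ArrMap K f = ArrMap F f \<cdot>\<^bsub>D\<^esub> \<iota> (Dom C f)" if "f \<in> Arr C" for f
    using nat_trans_simps(4)[OF nat(2) that] by simp
  have \<epsilon>\<iota>: "\<epsilon> X \<cdot>\<^bsub>D\<^esub> \<iota> X = Zero D (ObjMap K X) (ObjMap F' X)" if "X \<in> Obj C" for X
    using D.kernelD(4)[OF ker[OF that]] that by simp
  have mono: "is_mono D (ArrMap (Act U g) (\<iota> X))" if "g \<in> carrier G" "X \<in> Obj C" for g X
    using that D.act_mono D.kernel_mono ker by blast
  have "\<exists>t. t \<in> Arr D \<and> Dom D t = ObjMap K (ObjMap (Act T g) X) \<and> Cod D t = ObjMap (Act U g) (ObjMap K X) \<and>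
      ArrMap (Act U g) (\<iota> X) \<cdot>\<^bsub>D\<^esub> t = \<sigma> g X \<cdot>\<^bsub>D\<^esub> \<iota> (ObjMap (Act T g) X)"
    if g [simp]: "g \<in> carrier G" and X [simp]: "X \<in> Obj C" for g X
  proof -
    \<comment> \<open>G-naturality of \<epsilon> moves it past \<sigma>, where it meets \<iota> and
      vanishes; so the arrow factors through \<open>\<rho>\<^sub>g \<iota>\<close>.\<close>
    have "ArrMap (Act U g) (\<epsilon> X) \<cdot>\<^bsub>D\<^esub> (\<sigma> g X \<cdot>\<^bsub>D\<^esub> \<iota> (ObjMap (Act T g) X))
        = \<sigma>' g X \<cdot>\<^bsub>D\<^esub> (\<epsilon> (ObjMap (Act T g) X) \<cdot>\<^bsub>D\<^esub> \<iota> (ObjMap (Act T g) X))"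
      using \<epsilon> by (intro D.Comp_reassoc) (simp_all add: is_gnatural_def)
    then show ?thesis
      using D.kernel_factor[OF D.act_kernel[OF g ker[OF X]], of "\<sigma> g X \<cdot>\<^bsub>D\<^esub> \<iota> (ObjMap (Act T g) X)"]
      by (simp add: \<epsilon>\<iota>) metis
  qed
  then obtain \<tau> where \<tau>: "\<And>g X. \<lbrakk>g \<in> carrier G; X \<in> Obj C\<rbrakk> \<Longrightarrow> \<tau> g X \<in> Arr D \<and>
      Dom D (\<tau> g X) = ObjMap K (ObjMap (Act T g) X) \<and> Cod D (\<tau> g X) = ObjMap (Act U g) (ObjMap K X) \<and>
      ArrMap (Act U g) (\<iota> X) \<cdot>\<^bsub>D\<^esub> \<tau> g X = \<sigma> g X \<cdot>\<^bsub>D\<^esub> \<iota> (ObjMap (Act T g) X)"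
    by metis
  then have \<tau>_simps [simp]: "\<tau> g X \<in> Arr D" "Dom D (\<tau> g X) = ObjMap K (ObjMap (Act T g) X)"
    "Cod D (\<tau> g X) = ObjMap (Act U g) (ObjMap K X)"
    and \<iota>\<tau>: "ArrMap (Act U g) (\<iota> X) \<cdot>\<^bsub>D\<^esub> \<tau> g X = \<sigma> g X \<cdot>\<^bsub>D\<^esub> \<iota> (ObjMap (Act T g) X)"
    if "g \<in> carrier G" "X \<in> Obj C" for g X
    using that by simp_all
  have gf: "is_gfunctor G C D T U (K, \<tau>)"
  proof (rule is_gfunctorI[OF K_functor])
    fix g assume g [simp]: "g \<in> carrier G"
    let ?\<rho> = "ArrMap (Act U g)"
    show "nat_trans C D (K \<circ>\<^sub>F Act T g) (Act U g \<circ>\<^sub>F K) (\<tau> g)"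
    proof (rule nat_transI)
      fix f assume f [simp]: "f \<in> Arr C"
      let ?X = "Dom C f" and ?Y = "Cod C f" and ?f = "ArrMap (Act T g) f"
      have "\<tau> g ?Y \<cdot>\<^bsub>D\<^esub> ArrMap K ?f = ?\<rho> (ArrMap K f) \<cdot>\<^bsub>D\<^esub> \<tau> g ?X"
      proof (rule D.mono_cancel[OF mono[OF g, of ?Y]])
        have "?\<rho> (\<iota> ?Y) \<cdot>\<^bsub>D\<^esub> (\<tau> g ?Y \<cdot>\<^bsub>D\<^esub> ArrMap K ?f)
            = \<sigma> g ?Y \<cdot>\<^bsub>D\<^esub> (\<iota> (Cod C ?f) \<cdot>\<^bsub>D\<^esub> ArrMap K ?f)"
          using \<iota>\<tau>[OF g, of ?Y] by (intro D.Comp_reassoc) simp_all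
        also have "\<iota> (Cod C ?f) \<cdot>\<^bsub>D\<^esub> ArrMap K ?f = ArrMap F ?f \<cdot>\<^bsub>D\<^esub> \<iota> (Dom C ?f)"
          by (rule \<iota>_natural) simp
        also have "\<sigma> g ?Y \<cdot>\<^bsub>D\<^esub> \<dots> = ?\<rho> (ArrMap F f) \<cdot>\<^bsub>D\<^esub> (\<sigma> g ?X \<cdot>\<^bsub>D\<^esub> \<iota> (Dom C ?f))"
          by (rule D.Comp_reassoc[OF F.str_natural]) simp_all
        also have "\<sigma> g ?X \<cdot>\<^bsub>D\<^esub> \<iota> (Dom C ?f) = ?\<rho> (\<iota> ?X) \<cdot>\<^bsub>D\<^esub> \<tau> g ?X"
          by (simp add: \<iota>\<tau>)
        also have "?\<rho> (ArrMap F f) \<cdot>\<^bsub>D\<^esub> \<dots> = ?\<rho> (\<iota> ?Y) \<cdot>\<^bsub>D\<^esub> (?\<rho> (ArrMap K f) \<cdot>\<^bsub>D\<^esub> \<tau> g ?X)"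
          using D.act_eq[OF \<iota>_natural[OF f] g] by (intro D.Comp_reassoc) simp_all
        finally show "?\<rho> (\<iota> ?Y) \<cdot>\<^bsub>D\<^esub> (\<tau> g ?Y \<cdot>\<^bsub>D\<^esub> ArrMap K ?f)
            = ?\<rho> (\<iota> ?Y) \<cdot>\<^bsub>D\<^esub> (?\<rho> (ArrMap K f) \<cdot>\<^bsub>D\<^esub> \<tau> g ?X)" .
      qed simp_all
      then show "\<tau> g ?Y \<cdot>\<^bsub>D\<^esub> ArrMap (K \<circ>\<^sub>F Act T g) f = ArrMap (Act U g \<circ>\<^sub>F K) f \<cdot>\<^bsub>D\<^esub> \<tau> g ?X"
        by simp
    qed (simp_all add: Hom_def is_functor_comp[OF C.act_functor K_functor]
        is_functor_comp[OF K_functor D.act_functor])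
    fix h X assume h [simp]: "h \<in> carrier G" and X [simp]: "X \<in> Obj C"
    let ?gh = "g \<otimes>\<^bsub>G\<^esub> h" and ?hX = "ObjMap (Act T h) X"
    let ?\<iota>' = "\<iota> (ObjMap (Act T g) ?hX)"
    show "\<tau> ?gh X \<cdot>\<^bsub>D\<^esub> ArrMap K (Coh T g h X)
        = Coh U g h (ObjMap K X) \<cdot>\<^bsub>D\<^esub> (?\<rho> (\<tau> h X) \<cdot>\<^bsub>D\<^esub> \<tau> g ?hX)"
    \<comment> \<open>The common target carries the action of the product, so the test mono is the
      image of \<iota> under that product.\<close>
    proof (rule D.mono_cancel[OF mono[of ?gh X]])
      have "ArrMap (Act U ?gh) (\<iota> X) \<cdot>\<^bsub>D\<^esub> (\<tau> ?gh X \<cdot>\<^bsub>D\<^esub> ArrMap K (Coh T g h X))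
          = \<sigma> ?gh X \<cdot>\<^bsub>D\<^esub> (\<iota> (Cod C (Coh T g h X)) \<cdot>\<^bsub>D\<^esub> ArrMap K (Coh T g h X))"
        using \<iota>\<tau>[of ?gh X] by (intro D.Comp_reassoc) simp_all
      also have "\<iota> (Cod C (Coh T g h X)) \<cdot>\<^bsub>D\<^esub> ArrMap K (Coh T g h X) = ArrMap F (Coh T g h X) \<cdot>\<^bsub>D\<^esub> ?\<iota>'"
        using \<iota>_natural[of "Coh T g h X"] by simp
      also have "\<sigma> ?gh X \<cdot>\<^bsub>D\<^esub> \<dots>
          = Coh U g h (ObjMap F X) \<cdot>\<^bsub>D\<^esub> ((?\<rho> (\<sigma> h X) \<cdot>\<^bsub>D\<^esub> \<sigma> g ?hX) \<cdot>\<^bsub>D\<^esub> ?\<iota>')"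
        by (rule D.Comp_reassoc[OF F.str_mult]) simp_all
      also have "(?\<rho> (\<sigma> h X) \<cdot>\<^bsub>D\<^esub> \<sigma> g ?hX) \<cdot>\<^bsub>D\<^esub> ?\<iota>' = ?\<rho> (\<sigma> h X) \<cdot>\<^bsub>D\<^esub> (?\<rho> (\<iota> ?hX) \<cdot>\<^bsub>D\<^esub> \<tau> g ?hX)"
        by (simp add: \<iota>\<tau>)
      also have "\<dots> = ?\<rho> (ArrMap (Act U h) (\<iota> X)) \<cdot>\<^bsub>D\<^esub> (?\<rho> (\<tau> h X) \<cdot>\<^bsub>D\<^esub> \<tau> g ?hX)"
        using D.act_eq[OF \<iota>\<tau>[OF h X] g] by (intro D.Comp_reassoc) simp_all
      also have "Coh U g h (ObjMap F X) \<cdot>\<^bsub>D\<^esub> \<dots>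
          = ArrMap (Act U ?gh) (\<iota> X) \<cdot>\<^bsub>D\<^esub> (Coh U g h (ObjMap K X) \<cdot>\<^bsub>D\<^esub> (?\<rho> (\<tau> h X) \<cdot>\<^bsub>D\<^esub> \<tau> g ?hX))"
        using D.Coh_natural_Comp[of g h "\<iota> X" "?\<rho> (\<tau> h X) \<cdot>\<^bsub>D\<^esub> \<tau> g ?hX"] by simp
      finally show "ArrMap (Act U ?gh) (\<iota> X) \<cdot>\<^bsub>D\<^esub> (\<tau> ?gh X \<cdot>\<^bsub>D\<^esub> ArrMap K (Coh T g h X))
          = ArrMap (Act U ?gh) (\<iota> X) \<cdot>\<^bsub>D\<^esub> (Coh U g h (ObjMap K X) \<cdot>\<^bsub>D\<^esub> (?\<rho> (\<tau> h X) \<cdot>\<^bsub>D\<^esub> \<tau> g ?hX))" .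
    qed simp_all
  next
    fix X assume X [simp]: "X \<in> Obj C"
    let ?\<iota>' = "\<iota> (ObjMap (Act T \<one>\<^bsub>G\<^esub>) X)"
    show "D.unit (ObjMap K X) \<cdot>\<^bsub>D\<^esub> \<tau> \<one>\<^bsub>G\<^esub> X = ArrMap K (C.unit X)"
    \<comment> \<open>The unit isomorphism ends in \<open>K X\<close> itself, so \<iota> serves as
      the test mono.\<close>
    proof (rule D.mono_cancel[OF D.kernel_mono[OF ker[OF X]]])
      have "\<iota> X \<cdot>\<^bsub>D\<^esub> (D.unit (ObjMap K X) \<cdot>\<^bsub>D\<^esub> \<tau> \<one>\<^bsub>G\<^esub> X)
          = D.unit (ObjMap F X) \<cdot>\<^bsub>D\<^esub> (ArrMap (Act U \<one>\<^bsub>G\<^esub>) (\<iota> X) \<cdot>\<^bsub>D\<^esub> \<tau> \<one>\<^bsub>G\<^esub> X)"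
        using D.unit_natural[of "\<iota> X"] by (intro D.Comp_reassoc) simp_all
      also have "\<dots> = (D.unit (ObjMap F X) \<cdot>\<^bsub>D\<^esub> \<sigma> \<one>\<^bsub>G\<^esub> X) \<cdot>\<^bsub>D\<^esub> ?\<iota>'"
        by (simp add: \<iota>\<tau>)
      also have "\<dots> = ArrMap F (C.unit X) \<cdot>\<^bsub>D\<^esub> ?\<iota>'"
        by (simp only: F.str_unit[OF X])
      also have "\<dots> = \<iota> X \<cdot>\<^bsub>D\<^esub> ArrMap K (C.unit X)"
        using \<iota>_natural[of "C.unit X"] by simp
      finally show "\<iota> X \<cdot>\<^bsub>D\<^esub> (D.unit (ObjMap K X) \<cdot>\<^bsub>D\<^esub> \<tau> \<one>\<^bsub>G\<^esub> X) = \<iota> X \<cdot>\<^bsub>D\<^esub> ArrMap K (C.unit X)" .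
    qed simp_all
  qed
  have "the_structure G C (subfunctor_structure G C D T U K (F, \<sigma>) \<iota>) \<tau>"
    unfolding the_structure_def
  proof (intro conjI allI impI ballI)
    show "subfunctor_structure G C D T U K (F, \<sigma>) \<iota> \<tau>"
      using gf F nat(2) by (simp add: subfunctor_structure_def is_gnatural_def \<iota>\<tau>)
    fix \<tau>' g X
    assume \<tau>': "subfunctor_structure G C D T U K (F, \<sigma>) \<iota> \<tau>'"
      and g [simp]: "g \<in> carrier G" and X [simp]: "X \<in> Obj C"
    interpret K': gfunctor G C D T U K \<tau>'
      using \<tau>' by (intro gfunctorI[OF C.is_group]) (simp add: subfunctor_structure_def)
    have "ArrMap (Act U g) (\<iota> X) \<cdot>\<^bsub>D\<^esub> \<tau>' g X = ArrMap (Act U g) (\<iota> X) \<cdot>\<^bsub>D\<^esub> \<tau> g X"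
      using \<tau>' by (simp add: subfunctor_structure_def is_gnatural_def \<iota>\<tau>)
    then show "\<tau>' g X = \<tau> g X"
      by (rule D.mono_cancel[OF mono[OF g X]]) simp_all
  qed
  then show ?thesis by blast
qed


section \<open>Equivariant cleft extensions\<close>

context gfunctor
begin

lemma eqv_funct_faithful:
  assumes "is_faithful C D H"
  shows "is_faithful C.E D.E (eqv_funct G D (H, \<sigma>))"
  unfolding is_faithful_def
proof (intro conjI ballI inj_onI eqv_funct_functor)
  fix P Q a b
  assume ab: "P \<in> Obj C.E" "Q \<in> Obj C.E" "a \<in> Hom C.E P Q" "b \<in> Hom C.E P Q"
    and eq: "ArrMap (eqv_funct G D (H, \<sigma>)) a = ArrMap (eqv_funct G D (H, \<sigma>)) b"
  have "inj_on (ArrMap H) (Hom C (fst P) (fst Q))"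
    using assms ab by (simp add: is_faithful_def)
  moreover have "C.und a \<in> Hom C (fst P) (fst Q)" "C.und b \<in> Hom C (fst P) (fst Q)"
    using ab by (auto simp: Hom_def)
  ultimately have "C.und a = C.und b"
    using eq by (simp add: eqv_funct_ArrMap inj_on_eq_iff)
  then show "a = b"
    using ab by (intro C.eqv_Arr_eqI) (simp_all add: Hom_def)
qed

text \<open>A short exact sequence is pushed down to \<open>C\<close>, mapped by \<open>H\<close>,
  and lifted to the equivariant category of \<open>D\<close>. Descent compares with kernels and
  cokernels taken in \<open>C\<close>, whence the abelian hypothesis.\<close>

lemma eqv_funct_exact:
  assumes H: "is_exact_functor C D H" and "abelian_category C"
  shows "is_exact_functor C.E D.E (eqv_funct G D (H, \<sigma>))"
proof -
  interpret abelian_category C by fact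
  interpret C': abelian_action G C T ..
  have add: "is_additive_functor C D H"
    using H by (simp add: is_exact_functor_def)
  have "short_exact D.E (ArrMap (eqv_funct G D (H, \<sigma>)) f) (ArrMap (eqv_funct G D (H, \<sigma>)) g)"
    if fg: "short_exact C.E f g" for f g
  proof -
    have ker: "is_kernel C.E g f" and cok: "is_cokernel C.E f g"
      using fg by (simp_all add: short_exact_def)
    note D [simp] = C.eqv.kernelD[OF ker]
    have "short_exact C (C.und f) (C.und g)"
      using C'.eqv_kernelD[OF ker] C'.eqv_cokernelD[OF cok] by (simp add: short_exact_def)
    then have "short_exact D (ArrMap H (C.und f)) (ArrMap H (C.und g))"
      using H by (simp add: is_exact_functor_def)
    then show ?thesis
      unfolding short_exact_def eqv_funct_ArrMap
      using eqv_ArrMap[OF D(1)] eqv_ArrMap[OF D(2)]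
      by (intro conjI D.eqv_kernelI D.eqv_cokernelI) simp_all
  qed
  moreover have "is_additive_functor C.E D.E (eqv_funct G D (H, \<sigma>))"
    unfolding is_additive_functor_def
  proof (intro conjI ballI eqv_funct_functor)
    fix P Q a b
    assume "P \<in> Obj C.E" "Q \<in> Obj C.E" "a \<in> Hom C.E P Q" "b \<in> Hom C.E P Q"
    then show "ArrMap (eqv_funct G D (H, \<sigma>)) (Add C.E a b)
        = Add D.E (ArrMap (eqv_funct G D (H, \<sigma>)) a) (ArrMap (eqv_funct G D (H, \<sigma>)) b)"
      using additive_functor_Add[OF add C.category_axioms, of "C.und a" "C.und b"]
      by (auto simp: eqv_funct_ArrMap Hom_def)
  qed
  ultimately show ?thesis
    by (simp add: is_exact_functor_def)
qed

end

section \<open>Assembly for an equivariant cleft extension\<close>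

lemma gfunctor_commutes_with_forget:
  assumes "group G" "is_gfunctor G C D T U H"
  shows "commutes_with_forget G C D T U H"
  using gfunctor.commutes_with_forget[OF gfunctorI] assms by (metis surj_pair)

theorem proposition3p2:
  fixes G :: "('g, 'x) monoid_scheme"
    and B :: "('bo, 'bm, 'y) addcat_scheme"
    and A :: "('ao, 'am, 'z) addcat_scheme"
    and T :: "('g, 'bo, 'bm) action"
    and U :: "('g, 'ao, 'am) action"
    and i l :: "('bo, 'bm, 'ao, 'am) funct"
    and e q :: "('ao, 'am, 'bo, 'bm) funct"
    and K :: "('ao, 'am, 'ao, 'am) funct"
  assumes "group G" and "finite (carrier G)"
    and "equivariant_cleft_extension G B A T U (i, \<sigma>i) (e, \<sigma>e) l \<eta> \<epsilon> \<kappa>"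
    and "adjunction A B q i \<eta>q \<epsilon>q"
    and "is_kernel_functor A A (l \<circ>\<^sub>F e) id_funct \<epsilon> K \<iota>"
  shows "\<exists>\<sigma>l \<sigma>q \<sigma>K.
    the_structure G B (left_adjoint_structure G B A T U l (e, \<sigma>e) \<eta> \<epsilon>) \<sigma>l \<and>
    the_structure G A (left_adjoint_structure G A B U T q (i, \<sigma>i) \<eta>q \<epsilon>q) \<sigma>q \<and>
    the_structure G A
      (subfunctor_structure G A A U U K (comp_gfunct A (l, \<sigma>l) (e, \<sigma>e)) \<iota>) \<sigma>K \<and>
    is_gfunctor G B B T T (comp_gfunct B (e, \<sigma>e) (comp_gfunct A (K, \<sigma>K) (i, \<sigma>i))) \<and>
    (let BG = eqv_cat G B T; AG = eqv_cat G A U;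
         iG = eqv_funct G A (i, \<sigma>i); eG = eqv_funct G B (e, \<sigma>e);
         lG = eqv_funct G A (l, \<sigma>l); qG = eqv_funct G B (q, \<sigma>q)
     in cleft_extension BG AG iG eG lG
          (eqv_trans id_funct (eG \<circ>\<^sub>F lG) \<eta>)
          (eqv_trans (lG \<circ>\<^sub>F eG) id_funct \<epsilon>)
          (eqv_trans (eG \<circ>\<^sub>F iG) id_funct \<kappa>) \<and>
        adjunction AG BG qG iG
          (eqv_trans id_funct (iG \<circ>\<^sub>F qG) \<eta>q)
          (eqv_trans (qG \<circ>\<^sub>F iG) id_funct \<epsilon>q)) \<and>
    commutes_with_forget G B A T U (i, \<sigma>i) \<and>
    commutes_with_forget G A B U T (e, \<sigma>e) \<and>
    commutes_with_forget G B A T U (l, \<sigma>l) \<and>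
    commutes_with_forget G A B U T (q, \<sigma>q) \<and>
    commutes_with_forget G A A U U (K, \<sigma>K) \<and>
    commutes_with_forget G B B T T
      (comp_gfunct B (e, \<sigma>e) (comp_gfunct A (K, \<sigma>K) (i, \<sigma>i)))"
proof -
  note G = \<open>group G\<close>
  have cleft: "cleft_extension B A i e l \<eta> \<epsilon> \<kappa>"
    and i: "is_gfunctor G B A T U (i, \<sigma>i)" and e: "is_gfunctor G A B U T (e, \<sigma>e)"
    and \<kappa>: "is_gnatural G B B T T (comp_gfunct B (e, \<sigma>e) (i, \<sigma>i)) (id_gfunct B T) \<kappa>"
    using assms(3) by (simp_all add: equivariant_cleft_extension_def)
  interpret i: gfunctor G B A T U i \<sigma>i by (rule gfunctorI[OF G i])
  interpret e: gfunctor G A B U T e \<sigma>e by (rule gfunctorI[OF G e])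
  interpret l: left_adjoint_of_gfunctor G B A T U e \<sigma>e l \<eta> \<epsilon>
    using cleft by unfold_locales (simp add: cleft_extension_def)
  interpret q: left_adjoint_of_gfunctor G A B U T i \<sigma>i q \<eta>q \<epsilon>q
    using assms(4) by unfold_locales
  interpret abelian_category B
    using cleft by (simp add: cleft_extension_def)
  interpret A: abelian_category A
    using cleft by (simp add: cleft_extension_def)
  interpret BB: abelian_action G B T ..
  interpret AA: abelian_action G A U ..
  have AA: "two_actions G A A U U" and BB: "two_actions G B B T T"
    by unfold_locales
  define \<sigma>l \<sigma>q where "\<sigma>l = l.str" and "\<sigma>q = q.str"
  have l_str: "the_structure G B (left_adjoint_structure G B A T U l (e, \<sigma>e) \<eta> \<epsilon>) \<sigma>l"
    and q_str: "the_structure G A (left_adjoint_structure G A B U T q (i, \<sigma>i) \<eta>q \<epsilon>q) \<sigma>q"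
    unfolding \<sigma>l_def \<sigma>q_def by (rule l.the_left_adjoint_structure q.the_left_adjoint_structure)+
  then have l_str': "left_adjoint_structure G B A T U l (e, \<sigma>e) \<eta> \<epsilon> \<sigma>l"
    and q_str': "left_adjoint_structure G A B U T q (i, \<sigma>i) \<eta>q \<epsilon>q \<sigma>q"
    by (simp_all add: the_structure_def)
  then have l: "is_gfunctor G B A T U (l, \<sigma>l)" and q: "is_gfunctor G A B U T (q, \<sigma>q)"
    and \<epsilon>: "is_gnatural G A A U U (comp_gfunct A (l, \<sigma>l) (e, \<sigma>e)) (id_gfunct A U) \<epsilon>"
    by (simp_all add: left_adjoint_structure_def)
  \<comment> \<open>The counit is G-natural for the composite structure on \<open>l e\<close>, which
    is what the kernel construction takes as input.\<close>
  obtain \<sigma>K where K_str: "the_structure G A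
      (subfunctor_structure G A A U U K (comp_gfunct A (l, \<sigma>l) (e, \<sigma>e)) \<iota>) \<sigma>K"
    using two_actions.ex_subfunctor_structure[OF AA] \<epsilon> assms(5)
    unfolding comp_gfunct_def id_gfunct_def prod.case by blast
  then have K: "is_gfunctor G A A U U (K, \<sigma>K)"
    by (simp add: the_structure_def subfunctor_structure_def)
  have Ki: "is_gfunctor G B A T U (comp_gfunct A (K, \<sigma>K) (i, \<sigma>i))"
    by (rule comp_is_gfunctor[OF G K i])
  have F: "is_gfunctor G B B T T (comp_gfunct B (e, \<sigma>e) (comp_gfunct A (K, \<sigma>K) (i, \<sigma>i)))"
    using comp_is_gfunctor[OF G e] Ki by (metis surj_pair)
  \<comment> \<open>The composite of the induced functors and the functor induced by the composite
    agree on the carriers, so \<kappa> lifts to the former.\<close>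
  have "nat_iso (eqv_cat G B T) (eqv_cat G B T) (eqv_funct G B (e, \<sigma>e) \<circ>\<^sub>F eqv_funct G A (i, \<sigma>i)) id_funct
      (eqv_trans (eqv_funct G B (e, \<sigma>e) \<circ>\<^sub>F eqv_funct G A (i, \<sigma>i)) id_funct \<kappa>)"
    using two_actions.eqv_trans_nat_iso[OF BB] \<kappa> cleft eqv_funct_comp[OF G e i] i.C.eqv_funct_id
    unfolding comp_gfunct_def id_gfunct_def prod.case cleft_extension_def by blast
  then have cleft': "cleft_extension (eqv_cat G B T) (eqv_cat G A U) (eqv_funct G A (i, \<sigma>i))
      (eqv_funct G B (e, \<sigma>e)) (eqv_funct G A (l, \<sigma>l))
      (eqv_trans id_funct (eqv_funct G B (e, \<sigma>e) \<circ>\<^sub>F eqv_funct G A (l, \<sigma>l)) \<eta>)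
      (eqv_trans (eqv_funct G A (l, \<sigma>l) \<circ>\<^sub>F eqv_funct G B (e, \<sigma>e)) id_funct \<epsilon>)
      (eqv_trans (eqv_funct G B (e, \<sigma>e) \<circ>\<^sub>F eqv_funct G A (i, \<sigma>i)) id_funct \<kappa>)"
    using cleft l.eqv_adjunction[OF l_str'] BB.eqv_abelian AA.eqv_abelian
      i.eqv_funct_functor e.eqv_funct_functor gfunctor.eqv_funct_functor[OF gfunctorI[OF G l]]
      e.eqv_funct_faithful e.eqv_funct_exact
    by (simp add: cleft_extension_def)
  show ?thesis
    unfolding Let_def
    using l_str q_str K_str F cleft' q.eqv_adjunction[OF q_str']
      gfunctor_commutes_with_forget[OF G i] gfunctor_commutes_with_forget[OF G e]
      gfunctor_commutes_with_forget[OF G l] gfunctor_commutes_with_forget[OF G q]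
      gfunctor_commutes_with_forget[OF G K] gfunctor_commutes_with_forget[OF G F]
    by blast
qed

end
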